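(* Let $n\ge 1$. The flip graph $G^n_{4n,2}$ of $n$-periodic $2$-triangulations on the $4n$-gon is regular of degree $2(n-1)$.
   Context: **Polygon setting.** An edge of the convex $4n$-gon is a segment joining two distinct vertices; its length is the cyclic distance between its endpoints (the smaller of the two numbers of polygon sides separating them). Convention: edges of length $<2$ are disregarded. A $2$-triangulation of the $4n$-gon is an inclusion-maximal set of edges such that no three of them mutually intersect inside the polygon. It is $n$-periodic if it is invariant under rotation by $\pi/2$ radians. An edge is $2$-relevant if its length is $>2$. **Periodic edges and flips.** An $n$-periodic edge $\tilde e$ is a set consisting of an edge $e$ of the $4n$-gon and all its images under rotation by integer multiples of $\pi/2$; it is $2$-relevant if $e$ is. An $n$-periodic $2$-triangulation $T$ is identified with the set $\tilde T$ of $n$-periodic edges it contains. A flip replaces a $2$-relevant $n$-periodic edge $\tilde e\in\tilde T$ by an $n$-periodic edge $\tilde f\notin\tilde T$ such that $(\tilde T\setminus\{\tilde e\})\cup\{\tilde f\}$ is again an $n$-periodic $2$-triangulation. **Flip graph.** $G^n_{4n,2}$ is the graph whose vertices are the $n$-periodic $2$-triangulations on the $4n$-gon and whose edges are the pairs related by a flip. *)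

theory Defs
  imports "HOL-Analysis.Analysis"
begin

section \<open>Edges of a convex polygon and 2-triangulations\<close>

text \<open>The convex \<open>m\<close>-gon is the regular one, so that rotation by \<open>\<pi>/2\<close> makes sense if \<open>4\<close> divides
  \<open>m\<close>. Its vertices are labelled counterclockwise by \<open>0, \<dots>, m - 1\<close>, and an edge is represented by
  the set of the labels of its two endpoints.\<close>

definition vertex :: "nat \<Rightarrow> nat \<Rightarrow> complex" where
  "vertex m k = cis (2 * pi * real k / real m)"

definition polygon :: "nat \<Rightarrow> complex set" where
  "polygon m = convex hull (vertex m ` {..<m})"

definition segment :: "nat \<Rightarrow> nat set \<Rightarrow> complex set" where
  "segment m e = convex hull (vertex m ` e)"

text \<open>For \<open>e = {a, b}\<close> with \<open>a < b\<close>, there are \<open>b - a\<close> sides on one side of \<open>e\<close> and \<open>m - (b - a)\<close>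
  on the other.\<close>

definition edge_length :: "nat \<Rightarrow> nat set \<Rightarrow> nat" where
  "edge_length m e = min (Max e - Min e) (m - (Max e - Min e))"

text \<open>Edges of length less than 2, that is, the sides of the polygon, are disregarded throughout.\<close>

definition edges :: "nat \<Rightarrow> nat set set" where
  "edges m = {e. e \<subseteq> {..<m} \<and> card e = 2 \<and> edge_length m e \<ge> 2}"

definition cross :: "nat \<Rightarrow> nat set \<Rightarrow> nat set \<Rightarrow> bool" where
  "cross m e f \<longleftrightarrow> segment m e \<inter> segment m f \<inter> interior (polygon m) \<noteq> {}"

definition no_3_crossing :: "nat \<Rightarrow> nat set set \<Rightarrow> bool" where
  "no_3_crossing m T \<longleftrightarrow>
    \<not> (\<exists>e\<in>T. \<exists>f\<in>T. \<exists>g\<in>T. e \<noteq> f \<and> e \<noteq> g \<and> f \<noteq> g \<and> cross m e f \<and> cross m e g \<and> cross m f g)"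

definition two_triangulation :: "nat \<Rightarrow> nat set set \<Rightarrow> bool" where
  "two_triangulation m T \<longleftrightarrow>
    T \<subseteq> edges m \<and> no_3_crossing m T \<and>
    (\<forall>T'. T \<subseteq> T' \<and> T' \<subseteq> edges m \<and> no_3_crossing m T' \<longrightarrow> T' = T)"


section \<open>Periodicity and flips on the \<open>4 n\<close>-gon\<close>

text \<open>Rotation by \<open>j\<close> times \<open>\<pi>/2\<close>; see \<open>vertex_rotate\<close> below.\<close>

definition rotate_edge :: "nat \<Rightarrow> nat \<Rightarrow> nat set \<Rightarrow> nat set" where
  "rotate_edge n j e = (\<lambda>k. (k + j * n) mod (4 * n)) ` e"

definition periodic_two_triangulation :: "nat \<Rightarrow> nat set set \<Rightarrow> bool" where
  "periodic_two_triangulation n T \<longleftrightarrow> two_triangulation (4 * n) T \<and> rotate_edge n 1 ` T = T"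

definition orbit :: "nat \<Rightarrow> nat set \<Rightarrow> nat set set" where
  "orbit n e = {rotate_edge n j e | j. j < 4}"

definition periodic_edges :: "nat \<Rightarrow> nat set set set" where
  "periodic_edges n = orbit n ` edges (4 * n)"

definition relevant :: "nat \<Rightarrow> nat set set \<Rightarrow> bool" where
  "relevant n E \<longleftrightarrow> (\<exists>e\<in>edges (4 * n). E = orbit n e \<and> edge_length (4 * n) e > 2)"

definition periodic_edges_of :: "nat \<Rightarrow> nat set set \<Rightarrow> nat set set set" where
  "periodic_edges_of n T = {E \<in> periodic_edges n. E \<subseteq> T}"

definition flip :: "nat \<Rightarrow> nat set set \<Rightarrow> nat set set \<Rightarrow> bool" where
  "flip n T T' \<longleftrightarrow>
    periodic_two_triangulation n T \<and> periodic_two_triangulation n T' \<and>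
    (\<exists>E F. E \<in> periodic_edges_of n T \<and> relevant n E \<and>
       F \<in> periodic_edges n \<and> F \<notin> periodic_edges_of n T \<and>
       periodic_edges_of n T' = (periodic_edges_of n T - {E}) \<union> {F})"


section \<open>The flip graph\<close>

text \<open>A simple graph is a pair of a vertex set and a set of two-element subsets of it.\<close>

type_synonym 'a graph = "'a set \<times> 'a set set"

definition regular_of_degree :: "'a graph \<Rightarrow> nat \<Rightarrow> bool" where
  "regular_of_degree G d \<longleftrightarrow>
    (\<forall>v\<in>fst G. finite {e \<in> snd G. v \<in> e} \<and> card {e \<in> snd G. v \<in> e} = d)"

definition flip_graph :: "nat \<Rightarrow> nat set set graph" where
  "flip_graph n = ({T. periodic_two_triangulation n T}, {{T, T'} | T T'. flip n T T'})"


section \<open>Checks of the definitions\<close>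

lemma vertex_rotate:
  assumes "n \<ge> 1"
  shows "vertex (4 * n) ((k + j * n) mod (4 * n)) = cis (real j * (pi / 2)) * vertex (4 * n) k"
proof -
  define q where "q = (k + j * n) div (4 * n)"
  have eq: "k + j * n = (k + j * n) mod (4 * n) + q * (4 * n)"
    unfolding q_def by (metis add.commute div_mult_mod_eq)
  have mod_eq: "real ((k + j * n) mod (4 * n)) = real k + real j * real n - real q * (4 * real n)"
    using arg_cong[OF eq, of real] by simp
  have "2 * pi * real ((k + j * n) mod (4 * n)) / real (4 * n)
      = real j * (pi / 2) + 2 * pi * real k / real (4 * n) - 2 * pi * real q"
    unfolding mod_eq using assms by (simp add: field_simps)
  hence "vertex (4 * n) ((k + j * n) mod (4 * n)) =
      cis (real j * (pi / 2) + 2 * pi * real k / real (4 * n) - 2 * pi * real q)"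
    unfolding vertex_def by simp
  also have "\<dots> = cis (real j * (pi / 2) + 2 * pi * real k / real (4 * n)) / cis (2 * pi * real q)"
    by (simp only: cis_divide)
  also have "cis (2 * pi * real q) = 1"
    by (rule cis_multiple_2pi) simp
  finally show ?thesis
    unfolding vertex_def by (simp add: cis_mult)
qed

lemma flip_graph_simple:
  assumes "e \<in> snd (flip_graph n)"
  shows "e \<subseteq> fst (flip_graph n)" "card e = 2"
proof -
  from assms obtain T T' where e: "e = {T, T'}" and fl: "flip n T T'"
    by (auto simp: flip_graph_def)
  have "T \<noteq> T'" using fl unfolding flip_def by auto
  thus "card e = 2" using e by simp
  show "e \<subseteq> fst (flip_graph n)" using e fl by (auto simp: flip_graph_def flip_def)
qed

text \<open>The signed distance of \<open>z\<close> to the line through \<open>vertex m a\<close> and \<open>vertex m b\<close>, for \<open>a \<le> b\<close>.\<close>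

definition side :: "nat \<Rightarrow> nat \<Rightarrow> nat \<Rightarrow> complex \<Rightarrow> real" where
  "side m a b z = cos (pi * (real a - real b) / real m) -
     Re (z * cis (- (pi * (real a + real b) / real m)))"

lemma side_vertex:
  assumes "m > 0"
  shows "side m a b (vertex m c) =
    2 * sin (pi * (real c - real a) / real m) * sin (pi * (real c - real b) / real m)"
proof -
  have "vertex m c * cis (- (pi * (real a + real b) / real m))
      = cis (pi * (real c - real a) / real m + pi * (real c - real b) / real m)"
    unfolding vertex_def cis_mult using assms by (intro arg_cong[where f = cis]) (simp add: field_simps)
  moreover have "pi * (real a - real b) / real m =
      pi * (real c - real b) / real m - pi * (real c - real a) / real m"
    using assms by (simp add: field_simps)
  ultimately show ?thesis
    unfolding side_def by (simp add: cos_add cos_diff)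
qed

lemma side_convex_comb:
  assumes "s + t = 1"
  shows "side m a b (s *\<^sub>R x + t *\<^sub>R y) = s * side m a b x + t * side m a b y"
proof -
  have t: "t = 1 - s" using assms by simp
  show ?thesis
    unfolding side_def t by (simp add: algebra_simps)
qed

lemma sgn_sin_label:
  fixes a c :: nat
  assumes "a < m" "c < m"
  shows "sgn (sin (pi * (real c - real a) / real m)) = sgn (real c - real a)"
proof -
  consider "a = c" | "a < c" | "c < a" by linarith
  thus ?thesis
  proof cases
    case 2
    have "0 < pi * (real c - real a) / real m" using 2 assms by simp
    moreover have "pi * (real c - real a) < pi * real m"
      using 2 assms by (intro mult_strict_left_mono) auto
    hence "pi * (real c - real a) / real m < pi"
      using assms by (simp add: pos_divide_less_eq)
    ultimately show ?thesis using 2 sin_gt_zero by simp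
  next
    case 3
    have "0 < pi * (real a - real c) / real m" using 3 assms by simp
    moreover have "pi * (real a - real c) < pi * real m"
      using 3 assms by (intro mult_strict_left_mono) auto
    hence "pi * (real a - real c) / real m < pi"
      using assms by (simp add: pos_divide_less_eq)
    ultimately have "sin (pi * (real a - real c) / real m) > 0" by (rule sin_gt_zero)
    moreover have "pi * (real c - real a) / real m = - (pi * (real a - real c) / real m)"
      by (simp add: right_diff_distrib diff_divide_distrib)
    ultimately show ?thesis using 3 by (simp only: sin_minus) simp
  qed simp
qed

lemma sgn_side_vertex:
  assumes "a < m" "b < m" "c < m"
  shows "sgn (side m a b (vertex m c)) = sgn ((real c - real a) * (real c - real b))"
  using assms by (simp add: side_vertex sgn_mult sgn_sin_label)

lemma side_vertex_pos_iff:
  assumes "a < b" "b < m" "c < m"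
  shows "side m a b (vertex m c) > 0 \<longleftrightarrow> c < a \<or> b < c"
    and "side m a b (vertex m c) < 0 \<longleftrightarrow> a < c \<and> c < b"
    and "side m a b (vertex m c) = 0 \<longleftrightarrow> c = a \<or> c = b"
proof -
  have s: "sgn (side m a b (vertex m c)) = sgn ((real c - real a) * (real c - real b))"
    using assms by (intro sgn_side_vertex) auto
  have "side m a b (vertex m c) > 0 \<longleftrightarrow> (real c - real a) * (real c - real b) > 0"
    using s by (metis sgn_greater)
  thus "side m a b (vertex m c) > 0 \<longleftrightarrow> c < a \<or> b < c"
    using assms by (auto simp: zero_less_mult_iff)
  have "side m a b (vertex m c) < 0 \<longleftrightarrow> (real c - real a) * (real c - real b) < 0"
    using s by (metis sgn_less)
  thus "side m a b (vertex m c) < 0 \<longleftrightarrow> a < c \<and> c < b"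
    using assms by (auto simp: mult_less_0_iff)
  have "side m a b (vertex m c) = 0 \<longleftrightarrow> (real c - real a) * (real c - real b) = 0"
    using s by (metis sgn_0_0)
  thus "side m a b (vertex m c) = 0 \<longleftrightarrow> c = a \<or> c = b"
    by auto
qed

lemma norm_vertex [simp]: "norm (vertex m k) = 1"
  by (simp add: vertex_def)

lemma norm_interior_polygon:
  assumes "p \<in> interior (polygon m)"
  shows "norm p < 1"
proof -
  have "polygon m \<subseteq> cball 0 1"
    unfolding polygon_def by (intro hull_minimal) auto
  hence "interior (polygon m) \<subseteq> ball 0 1"
    using interior_mono by (metis interior_cball)
  thus ?thesis using assms by auto
qed

lemma in_segmentE:
  assumes "p \<in> segment m {c, d}"
  obtains s t where "s \<ge> 0" "t \<ge> 0" "s + t = 1" "p = s *\<^sub>R vertex m c + t *\<^sub>R vertex m d"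
  using assms unfolding segment_def by (auto simp: convex_hull_2)

lemma side_segment_self:
  assumes "m > 0" "p \<in> segment m {a, b}"
  shows "side m a b p = 0"
proof -
  obtain s t where "s + t = 1" "p = s *\<^sub>R vertex m a + t *\<^sub>R vertex m b"
    using in_segmentE[OF assms(2)] .
  moreover have "side m a b (vertex m a) = 0" "side m a b (vertex m b) = 0"
    using assms(1) by (simp_all add: side_vertex)
  ultimately show ?thesis by (simp add: side_convex_comb)
qed

lemma in_segment_if:
  assumes m: "m > 0" and z: "side m a b p = 0" and n: "norm p \<le> 1"
    and ab: "sin (pi * (real b - real a) / real m) > 0"
  shows "p \<in> segment m {a, b}"
proof -
  define \<sigma> \<delta> where "\<sigma> = pi * (real a + real b) / real m" and "\<delta> = pi * (real b - real a) / real m"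
  define q where "q = p * cis (- \<sigma>)"
  have "pi * (real a - real b) / real m = - \<delta>"
    unfolding \<delta>_def using m by (simp add: field_simps)
  hence Re: "Re q = cos \<delta>"
    using z unfolding side_def q_def \<sigma>_def by simp
  have "norm q \<le> 1" using n unfolding q_def by (simp add: norm_mult)
  hence "(Re q)\<^sup>2 + (Im q)\<^sup>2 \<le> 1"
    by (simp add: cmod_def)
  hence "(Im q)\<^sup>2 \<le> (sin \<delta>)\<^sup>2"
    using sin_cos_squared_add[of \<delta>] unfolding Re by linarith
  moreover have sp: "sin \<delta> > 0" using ab unfolding \<delta>_def .
  ultimately have Im: "\<bar>Im q\<bar> \<le> sin \<delta>"
    using abs_le_square_iff[of "Im q" "sin \<delta>"] by simp
  define s where "s = (sin \<delta> - Im q) / (2 * sin \<delta>)"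
  have s: "0 \<le> s" "s \<le> 1" using Im sp unfolding s_def by (auto simp: field_simps)
  have "q = s *\<^sub>R cis (- \<delta>) + (1 - s) *\<^sub>R cis \<delta>"
  proof (rule complex_eqI)
    show "Re q = Re (s *\<^sub>R cis (- \<delta>) + (1 - s) *\<^sub>R cis \<delta>)"
      using Re by (simp add: algebra_simps)
    show "Im q = Im (s *\<^sub>R cis (- \<delta>) + (1 - s) *\<^sub>R cis \<delta>)"
      using sp unfolding s_def by (simp add: field_simps)
  qed
  moreover have "p = q * cis \<sigma>"
    unfolding q_def by (simp add: mult.assoc cis_mult)
  ultimately have "p = s *\<^sub>R (cis (- \<delta>) * cis \<sigma>) + (1 - s) *\<^sub>R (cis \<delta> * cis \<sigma>)"
    by (simp only: distrib_right mult_scaleR_left)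
  moreover have "- \<delta> + \<sigma> = 2 * pi * real a / real m" "\<delta> + \<sigma> = 2 * pi * real b / real m"
    unfolding \<delta>_def \<sigma>_def using m by (simp_all add: field_simps)
  ultimately have "p = s *\<^sub>R vertex m a + (1 - s) *\<^sub>R vertex m b"
    unfolding vertex_def cis_mult by simp
  thus ?thesis
    unfolding segment_def using s
    by (simp add: convex_hull_2) (rule exI[of _ s], rule exI[of _ "1 - s"], simp)
qed

lemma cross_imp_interleaved:
  assumes ab: "a < b" "b < m" and cd: "c < d" "d < m" and ne: "{a, b} \<noteq> {c, d}"
    and cr: "cross m {a, b} {c, d}"
  shows "a < c \<and> c < b \<and> b < d \<or> c < a \<and> a < d \<and> d < b"
proof (rule ccontr)
  assume nil: "\<not> ?thesis"
  from cr obtain p where p: "p \<in> segment m {a, b}" "p \<in> segment m {c, d}" "p \<in> interior (polygon m)"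
    unfolding cross_def by auto
  have m: "m > 0" using ab by simp
  have 0: "side m a b p = 0" using side_segment_self[OF m p(1)] .
  obtain s t where st: "s \<ge> 0" "t \<ge> 0" "s + t = 1" "p = s *\<^sub>R vertex m c + t *\<^sub>R vertex m d"
    using in_segmentE[OF p(2)] .
  let ?C = "side m a b (vertex m c)" and ?D = "side m a b (vertex m d)"
  have eq: "s * ?C + t * ?D = 0" using 0 st side_convex_comb by metis
  have np: "norm p < 1" using norm_interior_polygon[OF p(3)] .
  have "s \<noteq> 0" "t \<noteq> 0" using np st by auto
  hence pos: "s > 0" "t > 0" using st by auto
  have "\<not> (?C \<ge> 0 \<and> ?D > 0)" "\<not> (?C > 0 \<and> ?D \<ge> 0)" "\<not> (?C \<le> 0 \<and> ?D < 0)" "\<not> (?C < 0 \<and> ?D \<le> 0)"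
    using eq pos
    by (smt (verit) mult_nonneg_nonneg mult_pos_pos mult_nonneg_nonpos mult_pos_neg)+
  hence "?C = 0 \<and> ?D = 0 \<or> ?C > 0 \<and> ?D < 0 \<or> ?C < 0 \<and> ?D > 0" by linarith
  moreover have C: "?C > 0 \<longleftrightarrow> c < a \<or> b < c" "?C < 0 \<longleftrightarrow> a < c \<and> c < b" "?C = 0 \<longleftrightarrow> c = a \<or> c = b"
    using ab cd by (intro side_vertex_pos_iff; simp)+
  moreover have D: "?D > 0 \<longleftrightarrow> d < a \<or> b < d" "?D < 0 \<longleftrightarrow> a < d \<and> d < b" "?D = 0 \<longleftrightarrow> d = a \<or> d = b"
    using ab cd by (intro side_vertex_pos_iff; simp)+
  ultimately consider "(c = a \<or> c = b) \<and> (d = a \<or> d = b)"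
    | "(c < a \<or> b < c) \<and> a < d \<and> d < b" | "a < c \<and> c < b \<and> (d < a \<or> b < d)"
    by metis
  thus False
  proof cases
    case 1
    hence "c = a \<and> d = b" using ab cd by linarith
    thus ?thesis using ne by simp
  next
    case 2
    thus ?thesis using nil cd by linarith
  next
    case 3
    thus ?thesis using nil cd by linarith
  qed
qed

text \<open>A line meets the unit circle in at most two points.\<close>

lemma circle_line_two_points:
  fixes A B C u :: complex
  assumes "norm A = 1" "norm B = 1" "norm C = 1" "A \<noteq> B" "A \<noteq> C" "u \<noteq> 0"
    and "u \<bullet> B = u \<bullet> A" "u \<bullet> C = u \<bullet> A"
  shows "B = C"
proof -
  have *: "\<exists>r. X = A + r *\<^sub>R (\<i> * u)" if "u \<bullet> X = u \<bullet> A" for X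
  proof
    let ?w = "X - A"
    have u2: "(Re u)\<^sup>2 + (Im u)\<^sup>2 \<noteq> 0"
      using assms(6) by (simp add: complex_eq_iff sum_power2_eq_zero_iff)
    have "Re u * Re ?w + Im u * Im ?w = 0"
      using that by (simp add: inner_complex_def algebra_simps)
    thus "X = A + ((?w \<bullet> (\<i> * u)) / ((Re u)\<^sup>2 + (Im u)\<^sup>2)) *\<^sub>R (\<i> * u)"
      using u2 by (simp add: complex_eq_iff inner_complex_def field_simps power2_eq_square) algebra
  qed
  define w where "w = \<i> * u"
  have w: "w \<bullet> w \<noteq> 0" using assms(6) by (simp add: w_def)
  have **: "r = - 2 * (A \<bullet> w) / (w \<bullet> w)" if "norm (A + r *\<^sub>R w) = 1" "r \<noteq> 0" for r
  proof -
    have "(A + r *\<^sub>R w) \<bullet> (A + r *\<^sub>R w) = A \<bullet> A"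
      using that(1) assms(1) by (simp add: dot_square_norm)
    hence "r * (2 * (A \<bullet> w) + r * (w \<bullet> w)) = 0"
      by (simp add: inner_simps inner_commute[of w A] algebra_simps)
    hence "2 * (A \<bullet> w) + r * (w \<bullet> w) = 0" using that(2) by simp
    thus ?thesis using w by (simp add: field_simps)
  qed
  obtain r s where "B = A + r *\<^sub>R w" "C = A + s *\<^sub>R w"
    using * assms(7,8) unfolding w_def by metis
  moreover have "r \<noteq> 0" "s \<noteq> 0" using calculation assms(4,5) by auto
  ultimately show ?thesis using ** assms(2,3) by metis
qed

lemma interleaved_imp_cross:
  assumes ord: "a < c" "c < b" "b < d" "d < m"
  shows "cross m {a, b} {c, d}"
proof -
  have m: "m > 0" using ord by simp
  let ?L = "side m a b" and ?A = "vertex m a" and ?B = "vertex m b"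
    and ?C = "vertex m c" and ?D = "vertex m d"
  have C: "?L ?C < 0" and D: "?L ?D > 0"
    using side_vertex_pos_iff(2)[of a b m c] side_vertex_pos_iff(1)[of a b m d] ord by auto
  have A: "side m c d ?A > 0" and B: "side m c d ?B < 0"
    using side_vertex_pos_iff(1)[of c d m a] side_vertex_pos_iff(2)[of c d m b] ord by auto
  define s where "s = ?L ?D / (?L ?D - ?L ?C)"
  define p where "p = s *\<^sub>R ?C + (1 - s) *\<^sub>R ?D"
  have s: "0 < s" "s < 1" using C D unfolding s_def by (auto simp: field_simps)
  have pcd: "p \<in> segment m {c, d}"
    unfolding segment_def p_def using s
    by (simp add: convex_hull_2) (rule exI[of _ s], rule exI[of _ "1 - s"], simp)
  have "?L p = s * ?L ?C + (1 - s) * ?L ?D"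
    unfolding p_def by (rule side_convex_comb) simp
  hence Lp: "?L p = 0" using C D unfolding s_def by (simp add: field_simps)
  have seg: "segment m e \<subseteq> cball 0 1" for e
    unfolding segment_def by (intro hull_minimal) auto
  have np: "norm p \<le> 1" using subsetD[OF seg pcd] by simp
  have "sgn (sin (pi * (real b - real a) / real m)) = sgn (real b - real a)"
    using ord by (intro sgn_sin_label) auto
  hence "sin (pi * (real b - real a) / real m) > 0" using ord by (simp add: sgn_1_pos)
  hence pab: "p \<in> segment m {a, b}" using in_segment_if[OF m Lp np] by simp
  then obtain u v where uv: "u \<ge> 0" "v \<ge> 0" "u + v = 1" "p = u *\<^sub>R ?A + v *\<^sub>R ?B"
    using in_segmentE by blast
  have Mp: "side m c d p = 0" using side_segment_self[OF m pcd] .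
  have "u * side m c d ?A + v * side m c d ?B = 0" using Mp uv side_convex_comb by metis
  hence "u \<noteq> 0" "v \<noteq> 0" using A B uv(3) by auto
  hence uvp: "u > 0" "v > 0" using uv by auto
  have inP: "vertex m k \<in> polygon m" if "k < m" for k
    unfolding polygon_def using that by (intro hull_inc) auto
  have "p \<in> interior (polygon m)"
  proof (rule ccontr)
    assume ni: "p \<notin> interior (polygon m)"
    have cvx: "convex (polygon m)" unfolding polygon_def by simp
    have pP: "p \<in> polygon m"
      using uv inP[of a] inP[of b] ord cvx unfolding convex_def by auto
    obtain w where w: "w \<noteq> 0" "\<And>x. x \<in> polygon m \<Longrightarrow> w \<bullet> p \<le> w \<bullet> x"
    proof (cases "interior (polygon m) = {}")
      case True
      then obtain w b where w: "w \<noteq> 0" and "polygon m \<subseteq> {x. w \<bullet> x = b}"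
        using empty_interior_subset_hyperplane[OF cvx] by metis
      hence "w \<bullet> x = b" if "x \<in> polygon m" for x using that by auto
      thus thesis using that[OF w] pP by simp
    next
      case False
      hence "p \<notin> rel_interior (polygon m)" using ni by (simp add: rel_interior_nonempty_interior)
      moreover have "p \<in> closure (polygon m)" using pP closure_subset by blast
      ultimately obtain w where w: "w \<noteq> 0" "\<And>x. x \<in> closure (polygon m) \<Longrightarrow> w \<bullet> p \<le> w \<bullet> x"
        using supporting_hyperplane_relative_frontier[OF cvx] by metis
      show thesis
        by (rule that[OF w(1)], rule w(2)) (rule subsetD[OF closure_subset])
    qed
    have le: "w \<bullet> p \<le> w \<bullet> vertex m k" if "k < m" for k
      using w(2) inP[OF that] by blast
    have key: "w \<bullet> X = w \<bullet> p" "w \<bullet> Y = w \<bullet> p"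
      if "p = x *\<^sub>R X + y *\<^sub>R Y" "x > 0" "y > 0" "x + y = 1" "w \<bullet> p \<le> w \<bullet> X" "w \<bullet> p \<le> w \<bullet> Y"
      for x y X Y
    proof -
      have "w \<bullet> p = x * (w \<bullet> X) + y * (w \<bullet> Y)" using that(1) by (simp add: inner_simps)
      moreover have "w \<bullet> p = x * (w \<bullet> p) + y * (w \<bullet> p)" using that(4) by (metis distrib_right mult_1)
      ultimately have "x * (w \<bullet> X - w \<bullet> p) + y * (w \<bullet> Y - w \<bullet> p) = 0"
        unfolding right_diff_distrib by linarith
      moreover have "x * (w \<bullet> X - w \<bullet> p) \<ge> 0" "y * (w \<bullet> Y - w \<bullet> p) \<ge> 0" using that by auto
      ultimately have "x * (w \<bullet> X - w \<bullet> p) = 0" "y * (w \<bullet> Y - w \<bullet> p) = 0" by linarith+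
      thus "w \<bullet> X = w \<bullet> p" "w \<bullet> Y = w \<bullet> p" using that by auto
    qed
    have "w \<bullet> ?A = w \<bullet> p" "w \<bullet> ?B = w \<bullet> p"
      using key[OF uv(4) uvp uv(3)] le ord by auto
    moreover have "w \<bullet> ?C = w \<bullet> p"
      using key(1)[of s ?C "1 - s" ?D] s le ord by (auto simp: p_def)
    moreover have "?A \<noteq> ?B" using A B by auto
    moreover have "?L ?A = 0" "?L ?B = 0"
      using side_vertex_pos_iff(3)[of a b m] ord by auto
    hence "?C \<noteq> ?A" "?C \<noteq> ?B" using C by auto
    ultimately show False
      using circle_line_two_points[of ?A ?B ?C w] w(1) by auto
  qed
  thus ?thesis using pab pcd unfolding cross_def by auto
qed

lemma cross_commute: "cross m e f \<longleftrightarrow> cross m f e"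
  unfolding cross_def by (simp add: Int_commute)

theorem cross_iff_interleaved:
  assumes "a < b" "b < m" "c < d" "d < m" "{a, b} \<noteq> {c, d}"
  shows "cross m {a, b} {c, d} \<longleftrightarrow> a < c \<and> c < b \<and> b < d \<or> c < a \<and> a < d \<and> d < b"
  using cross_imp_interleaved[OF assms] interleaved_imp_cross[of a c b d m]
    interleaved_imp_cross[of c a d b m] assms cross_commute by metis

end

theory Submission
  imports Defs
begin

text \<open>Write \<open>m = 4 n\<close> and \<open>N = m - 4\<close>. Place the edge \<open>{a, b}\<close>, lifted to integers \<open>a < b < a + m\<close>, at time
  \<open>t = a + b\<close> and height \<open>i = b - a - 2\<close>; times \<open>0 \<le> t < m\<close> represent each edge once. An edge that is
  not in \<open>T\<close> exchanges the wires \<open>i - 1\<close> and \<open>i\<close> at time \<open>t\<close>, so \<open>T\<close> becomes a network on \<open>N\<close> wires (whose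
  strands are the 2-stars of \<open>T\<close>). Reading the exchanges as comparators, the 0-1 principle and a
  last-passage percolation identity show that the network sorts iff \<open>T\<close> contains no
  three mutually crossing edges. Hence \<open>T\<close> is a 2-triangulation iff its network reverses the
  wires and every pair of strands crosses exactly once.

  If \<open>T\<close> is periodic, let \<open>V\<close> be the permutation of the wires effected by the times \<open>0 \<le> t < 2 n\<close>; being
  a 2-triangulation then means that \<open>V \<circ> V\<close> is the reversal \<open>\<rho>\<close>, up to a count of the crossings.
  Removing a periodic edge \<open>E\<close> and adding \<open>F\<close> multiplies \<open>V\<close> by two \<open>\<rho>\<close>-symmetric exchanges \<open>r\<close> and
  \<open>s\<close> of strands. Since \<open>V\<close> acts like a complex structure, the square remains \<open>\<rho>\<close> only for \<open>s = r\<close> or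
  \<open>s = V r V\<^sup>-\<^sup>1\<close>, and exactly one of these two is the exchange at a crossing of \<open>T\<close>: each relevant
  periodic edge has exactly one exchange. Counting orbits gives \<open>2 (n - 1)\<close> relevant periodic
  edges, one of which consists of diameters.\<close>

section \<open>Networks of comparators\<close>

text \<open>Three mutually crossing edges are three contacts whose first and second endpoints both
  strictly increase. Each contact of such a chain holds back one particle of a 0-1 input, and
  running \<open>N = m - 4\<close> wires for \<open>m\<close> steps leaves slack for exactly two
  delays; a third one leaves some input unsorted. Maximality is traded for a count. In a reversing
  network every pair of strands crosses, so at least \<open>N choose 2\<close> relevant edges are
  missing from \<open>T\<close>, with equality iff no pair crosses twice. An exchange that keeps the
  reversal and the number of edges therefore yields a 2-triangulation again. Exactly one of
  \<open>r\<close> and its conjugate under \<open>V\<close> is available because \<open>V\<close>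
  applied twice inverts every pair of labels: \<open>V\<close> inverts exactly one of
  \<open>{x, y}\<close> and \<open>{V x, V y}\<close>, and the pairs inverted by \<open>V\<close>
  are those that cross at times below \<open>2 n\<close>. Diameters need care: their orbits have two
  elements instead of four. By the count they can only be exchanged for each other, which excludes
  products of a plain transposition with a double one.\<close>

definition active :: "nat \<Rightarrow> (nat \<Rightarrow> bool) \<Rightarrow> nat \<Rightarrow> nat \<Rightarrow> bool" where
  "active N c t i \<longleftrightarrow> 0 < i \<and> i < N \<and> even (t + i) \<and> \<not> c i"

text \<open>All active heights of one time have the same parity, so the exchanges of a layer are
  disjoint and the order of the two tests does not matter.\<close>

definition layer :: "nat \<Rightarrow> (nat \<Rightarrow> bool) \<Rightarrow> nat \<Rightarrow> nat \<Rightarrow> nat" where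
  "layer N c t p =
    (if active N c t p then p - 1 else if active N c t (Suc p) then Suc p else p)"

primrec strand :: "nat \<Rightarrow> (nat \<Rightarrow> nat \<Rightarrow> bool) \<Rightarrow> nat \<Rightarrow> nat \<Rightarrow> nat" where
  "strand N C 0 x = x"
| "strand N C (Suc t) x = layer N (C t) t (strand N C t x)"

lemma active_parity: "active N c t i \<Longrightarrow> \<not> active N c t (Suc i)"
  by (auto simp: active_def)

lemma layer_layer [simp]: "layer N c t (layer N c t p) = p"
  by (cases p) (auto simp: layer_def active_def)

lemma layer_less [simp]: "layer N c t p < N \<longleftrightarrow> p < N"
  by (auto simp: layer_def active_def)

lemma layer_idem: "p \<ge> N \<Longrightarrow> layer N c t p = p"
  by (auto simp: layer_def active_def)

lemma layer_inj: "layer N c t p = layer N c t q \<longleftrightarrow> p = q"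
  by (metis layer_layer)

text \<open>Only an exchange at height \<open>i\<close> itself carries a strand across the cut
  between the wires \<open>i - 1\<close> and \<open>i\<close>.\<close>

lemma layer_ge:
  assumes "\<not> active N c t i"
  shows "i \<le> layer N c t p \<longleftrightarrow> i \<le> p"
proof -
  consider "active N c t p" | "\<not> active N c t p" "active N c t (Suc p)"
    | "\<not> active N c t p" "\<not> active N c t (Suc p)" by blast
  thus ?thesis
  proof cases
    case 1
    hence "i \<noteq> p" "p > 0" using assms by (auto simp: active_def)
    thus ?thesis using 1 by (auto simp: layer_def)
  next
    case 2
    hence "i \<noteq> Suc p" using assms by auto
    thus ?thesis using 2 by (auto simp: layer_def)
  qed (simp add: layer_def)
qed

lemma layer_active: "active N c t i \<Longrightarrow> layer N c t i = i - 1"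
  "active N c t i \<Longrightarrow> layer N c t (i - 1) = i"
  by (auto simp: layer_def active_def)

lemma layer_le: "layer N c t p \<le> Suc p"
  by (auto simp: layer_def)

lemma strand_inj: "strand N C t x = strand N C t y \<longleftrightarrow> x = y"
  by (induction t) (auto simp: layer_inj)

lemma strand_less [simp]: "strand N C t x < N \<longleftrightarrow> x < N"
  by (induction t) auto

lemma strand_surj: "\<exists>x. strand N C t x = p"
proof (induction t arbitrary: p)
  case (Suc t)
  obtain x where "strand N C t x = layer N (C t) t p" using Suc by blast
  hence "strand N C (Suc t) x = p" by simp
  thus ?case by blast
qed auto

lemma strand_cong:
  assumes "\<And>s i. s < t \<Longrightarrow> active N (C s) s i = active N (D s) s i"
  shows "strand N C t x = strand N D t x"
  using assms
proof (induction t)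
  case (Suc t)
  have "layer N (C t) t p = layer N (D t) t p" for p
    using Suc.prems[of t] by (simp add: layer_def)
  thus ?case using Suc by simp
qed simp

text \<open>Writing \<open>Suc (q x) = i\<close> instead of \<open>q x = i - 1\<close> makes this
  false at \<open>i = 0\<close>.\<close>

definition ordered :: "(nat \<Rightarrow> nat) \<Rightarrow> nat \<Rightarrow> bool" where
  "ordered q i \<longleftrightarrow> (\<exists>x y. x < y \<and> Suc (q x) = i \<and> q y = i)"

primrec cstrand :: "nat \<Rightarrow> (nat \<Rightarrow> nat \<Rightarrow> bool) \<Rightarrow> nat \<Rightarrow> nat \<Rightarrow> nat" where
  "cstrand N C 0 x = x"
| "cstrand N C (Suc t) x =
    layer N (\<lambda>i. C t i \<or> \<not> ordered (cstrand N C t) i) t (cstrand N C t x)"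

text \<open>A comparator exchanges its inputs only if they still have their original order; otherwise it acts
  like a contact. Recording this as a contact turns the run of a comparator network into a plain
  network of crossings.\<close>

definition completion :: "nat \<Rightarrow> (nat \<Rightarrow> nat \<Rightarrow> bool) \<Rightarrow> nat \<Rightarrow> nat \<Rightarrow> bool" where
  "completion N C t i \<longleftrightarrow> C t i \<or> \<not> ordered (cstrand N C t) i"

lemma strand_completion: "strand N (completion N C) t x = cstrand N C t x"
  by (induction t arbitrary: x) (simp_all add: completion_def[abs_def])

lemma completion_iff:
  "completion N C t i \<longleftrightarrow> C t i \<or> \<not> ordered (strand N (completion N C) t) i"
proof -
  have "strand N (completion N C) t = cstrand N C t" using strand_completion by blast
  thus ?thesis by (simp add: completion_def)
qed

section \<open>Particle counts of 0-1 inputs; the labels below \<open>j\<close> are the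
  particles\<close>

definition count_above :: "nat \<Rightarrow> (nat \<Rightarrow> nat \<Rightarrow> bool) \<Rightarrow> nat \<Rightarrow> nat \<Rightarrow> nat \<Rightarrow> nat" where
  "count_above N C j t i = card {x. x < j \<and> i \<le> strand N C t x}"

lemma above_0: "count_above N C j 0 i = j - i"
proof -
  have "{x. x < j \<and> i \<le> x} = {i..<j}" by auto
  thus ?thesis by (simp add: count_above_def)
qed

lemma above_le: "count_above N C j t i \<le> j"
  unfolding count_above_def by (rule order_trans[OF card_mono[of "{..<j}"]]) auto

lemma above_inactive: "\<not> active N (C t) t i \<Longrightarrow> count_above N C j (Suc t) i = count_above N C j t i"
  by (simp add: count_above_def layer_ge)

lemma above_split:
  assumes "strand N C t z = p"
  shows "count_above N C j t p = count_above N C j t (Suc p) + (if z < j then 1 else 0)"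
proof -
  have "strand N C t x = p \<longleftrightarrow> x = z" for x
    using assms strand_inj by metis
  hence "p \<le> strand N C t x \<longleftrightarrow> Suc p \<le> strand N C t x \<or> x = z" for x
    by (metis Suc_le_eq le_less)
  hence "{x. x < j \<and> p \<le> strand N C t x} =
      {x. x < j \<and> Suc p \<le> strand N C t x} \<union> (if z < j then {z} else {})"
    by auto
  moreover have "z \<notin> {x. x < j \<and> Suc p \<le> strand N C t x}" using assms by auto
  ultimately show ?thesis by (simp add: count_above_def)
qed

lemma above_Suc_ge: "count_above N C j t p \<le> Suc (count_above N C j t (Suc p))"
proof -
  obtain z where "strand N C t z = p" using strand_surj by blast
  from above_split[OF this] show ?thesis by simp
qed

lemma above_zero: "count_above N C j t 0 = j"
  by (simp add: count_above_def)

lemma above_ge: "j \<le> i + count_above N C j t i"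
proof (induction i)
  case (Suc i)
  thus ?case using above_Suc_ge[of N C j t i] by linarith
qed (simp add: above_zero)

lemma above_shift: "count_above N C j (Suc t) (Suc i) \<le> count_above N C j t i"
proof -
  have "i \<le> strand N C t x" if "Suc i \<le> strand N C (Suc t) x" for x
    using that layer_le[of N "C t" t "strand N C t x"] by simp
  thus ?thesis unfolding count_above_def by (intro card_mono) auto
qed

text \<open>A comparator sends the smaller label up, so afterwards its upper wire carries a particle
  iff at least one of its two inputs was a particle. Expressed through the counts above the
  neighbouring cuts, this "or" is a minimum.\<close>

lemma above_step:
  assumes i: "0 < i" "i < N" "even (t + i)" and nc: "\<not> C t i"
  shows "count_above N (completion N C) j (Suc t) i =
    min (count_above N (completion N C) j t (i - 1)) (Suc (count_above N (completion N C) j t (Suc i)))"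
proof -
  let ?D = "completion N C"
  let ?A = "count_above N ?D j t"
  obtain x y where x: "strand N ?D t x = i - 1" and y: "strand N ?D t y = i"
    using strand_surj by metis
  have ne: "x \<noteq> y" using x y i by auto
  have sp: "?A i = ?A (Suc i) + (if y < j then 1 else 0)"
    "?A (i - 1) = ?A i + (if x < j then 1 else 0)"
    using above_split[OF y, of j] above_split[OF x, of j] i by auto
  show ?thesis
  proof (cases "x < y")
    case True
    have "Suc (strand N ?D t x) = i" using x i by simp
    hence "ordered (strand N ?D t) i" unfolding ordered_def using True y by blast
    hence "\<not> ?D t i" using nc completion_iff by blast
    hence act: "active N (?D t) t i" using i by (simp add: active_def)
    have x': "strand N ?D (Suc t) x = i" using layer_active(2)[OF act] x by simp
    have na: "\<not> active N (?D t) t (Suc i)" using active_parity[OF act] .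
    have "count_above N ?D j (Suc t) i = ?A (Suc i) + (if x < j then 1 else 0)"
      using above_split[OF x', of j] above_inactive[of N ?D t "Suc i", OF na, of j] by simp
    thus ?thesis using sp True by auto
  next
    case False
    have "\<not> ordered (strand N ?D t) i"
    proof
      assume "ordered (strand N ?D t) i"
      then obtain x' y' where xy: "x' < y'" "Suc (strand N ?D t x') = i" "strand N ?D t y' = i"
        unfolding ordered_def by blast
      hence "strand N ?D t x' = strand N ?D t x" "strand N ?D t y' = strand N ?D t y"
        using x y by auto
      hence "x' = x" "y' = y" by (simp_all add: strand_inj)
      thus False using xy False by simp
    qed
    hence "?D t i" using completion_iff by blast
    hence "\<not> active N (?D t) t i" by (simp add: active_def)
    from above_inactive[of N ?D t i, OF this, of j] show ?thesis using sp False ne by auto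
  qed
qed

section \<open>Last-passage percolation: longest strict chains of contacts\<close>

primrec strict_chain :: "(nat \<Rightarrow> nat \<Rightarrow> bool) \<Rightarrow> nat \<Rightarrow> nat \<Rightarrow> nat \<Rightarrow> bool" where
  "strict_chain D 0 u w \<longleftrightarrow> True"
| "strict_chain D (Suc g) u w \<longleftrightarrow> (\<exists>u'<u. \<exists>w'<w. D u' w' \<and> strict_chain D g u' w')"

lemma chain_mono: "strict_chain D g u w \<Longrightarrow> u \<le> u' \<Longrightarrow> w \<le> w' \<Longrightarrow> strict_chain D g u' w'"
  by (cases g) (auto intro: less_le_trans)

text \<open>The last element of a chain may be replaced by the contact \<open>(u, w)\<close>, which
  dominates every other candidate below the new corner.\<close>

lemma chain_contact:
  assumes "D u w"
  shows "strict_chain D (Suc g) (Suc u) (Suc w) \<longleftrightarrow> strict_chain D g u w"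
proof
  assume "strict_chain D (Suc g) (Suc u) (Suc w)"
  then obtain u' w' where "u' \<le> u" "w' \<le> w" "strict_chain D g u' w'"
    by (auto simp: less_Suc_eq_le)
  thus "strict_chain D g u w" using chain_mono by blast
qed (use assms in auto)

text \<open>The last element of a chain is not \<open>(u, w)\<close>, so it lies below the top row
  or left of the top column.\<close>

lemma chain_no_contact:
  assumes "\<not> D u w"
  shows "strict_chain D g (Suc u) (Suc w) \<longleftrightarrow> strict_chain D g (Suc u) w \<or> strict_chain D g u (Suc w)"
proof (cases g)
  case (Suc h)
  show ?thesis
  proof
    assume "strict_chain D g (Suc u) (Suc w)"
    then obtain u' w' where uw: "u' < Suc u" "w' < Suc w" "D u' w'" "strict_chain D h u' w'"
      unfolding Suc by auto
    hence "u' < u \<or> w' < w" using assms by (metis less_SucE)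
    thus "strict_chain D g (Suc u) w \<or> strict_chain D g u (Suc w)"
      unfolding Suc using uw by auto
  next
    assume "strict_chain D g (Suc u) w \<or> strict_chain D g u (Suc w)"
    thus "strict_chain D g (Suc u) (Suc w)" using chain_mono by (metis le_SucI order_refl)
  qed
qed simp

text \<open>\<open>\<kappa> u w\<close> is the number of particles of a 0-1 input that have passed the corner \<open>(u, w)\<close>. Each
  contact of a chain delays one more of them, so \<open>u - \<kappa> u w\<close> is the length of the longest chain.\<close>

lemma last_passage:
  fixes \<kappa> :: "nat \<Rightarrow> nat \<Rightarrow> nat" and S :: "nat \<Rightarrow> nat \<Rightarrow> bool"
  assumes row0: "\<And>w. S 0 w \<Longrightarrow> \<kappa> 0 w = 0"
    and col0: "\<And>u. S u 0 \<Longrightarrow> \<kappa> u 0 = u"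
    and contact: "\<And>u w. S (Suc u) (Suc w) \<Longrightarrow> D u w \<Longrightarrow> S u w \<and> \<kappa> (Suc u) (Suc w) = \<kappa> u w"
    and free: "\<And>u w. S (Suc u) (Suc w) \<Longrightarrow> \<not> D u w \<Longrightarrow> S (Suc u) w \<and> S u (Suc w) \<and>
      \<kappa> (Suc u) (Suc w) = min (\<kappa> (Suc u) w) (Suc (\<kappa> u (Suc w)))"
  shows "S u w \<Longrightarrow> \<kappa> u w + g \<le> u \<longleftrightarrow> strict_chain D g u w"
proof (induction "u + w" arbitrary: u w g rule: less_induct)
  case less
  show ?case
  proof (cases "u = 0 \<or> w = 0")
    case True
    thus ?thesis using row0 col0 less.prems by (cases g) auto
  next
    case False
    then obtain u' w' where [simp]: "u = Suc u'" "w = Suc w'" using not0_implies_Suc by blast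
    show ?thesis
    proof (cases "D u' w'")
      case True
      have S: "S u' w'" and k: "\<kappa> u w = \<kappa> u' w'" using contact[OF _ True] less.prems by auto
      have IH: "\<kappa> u' w' + g \<le> u' \<longleftrightarrow> strict_chain D g u' w'" for g
        using less.hyps[OF _ S] by simp
      show ?thesis
      proof (cases g)
        case 0
        thus ?thesis using IH[of 0] k by simp
      next
        case (Suc h)
        have "\<kappa> u w + g \<le> u \<longleftrightarrow> \<kappa> u' w' + h \<le> u'" using k Suc by simp
        also have "\<dots> \<longleftrightarrow> strict_chain D g u w"
          using chain_contact[of D u' w', OF True, of h] IH[of h] Suc by simp
        finally show ?thesis .
      qed
    next
      case nD: False
      have S: "S (Suc u') w'" "S u' (Suc w')"
        and k: "\<kappa> u w = min (\<kappa> (Suc u') w') (Suc (\<kappa> u' (Suc w')))"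
        using free[OF _ nD] less.prems by auto
      have "\<kappa> (Suc u') w' + g \<le> Suc u' \<longleftrightarrow> strict_chain D g (Suc u') w'"
        using less.hyps[OF _ S(1)] by simp
      moreover have "\<kappa> u' (Suc w') + g \<le> u' \<longleftrightarrow> strict_chain D g u' (Suc w')"
        using less.hyps[OF _ S(2)] by simp
      moreover have "\<kappa> u w + g \<le> u \<longleftrightarrow>
          \<kappa> (Suc u') w' + g \<le> Suc u' \<or> \<kappa> u' (Suc w') + g \<le> u'"
        using k by (auto simp: min_def)
      ultimately show ?thesis using chain_no_contact[of D u' w', OF nD, of g] by simp
    qed
  qed
qed

text \<open>Light-cone coordinates with apex at height \<open>j\<close>: \<open>u\<close> counts
  steps down, \<open>w\<close> steps up, and \<open>j mod 2\<close> starts the clock with the parity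
  of \<open>j\<close>. The two inequalities keep the height between \<open>0\<close> and
  \<open>N\<close>, so the natural subtraction is exact.\<close>

definition cone_contact :: "nat \<Rightarrow> (nat \<Rightarrow> nat \<Rightarrow> bool) \<Rightarrow> nat \<Rightarrow> nat \<Rightarrow> nat \<Rightarrow> bool" where
  "cone_contact N C j u w \<longleftrightarrow> u \<le> j + w \<and> j + w \<le> N + u \<and> C (j mod 2 + u + w) (j + w - u)"

text \<open>The counts along the cone satisfy the hypotheses of \<open>last_passage\<close>. The
  walls at heights \<open>0\<close> and \<open>N\<close> consist of contacts, so every corner
  without a contact is a genuine comparator with both neighbouring corners inside the strip.\<close>

lemma above_chain:
  assumes j: "j \<le> N" and bd: "\<And>t. even t \<Longrightarrow> C t 0" "\<And>t. even (t + N) \<Longrightarrow> C t N"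
    and uw: "u \<le> j + w" "j + w \<le> N + u"
  shows "count_above N (completion N C) j (j mod 2 + u + w) (j + w - u) + g \<le> u \<longleftrightarrow>
    strict_chain (cone_contact N C j) g u w"
proof -
  let ?D = "completion N C" and ?s = "j mod 2"
  let ?S = "\<lambda>u w. u \<le> j + w \<and> j + w \<le> N + u"
  define k where "k u w = count_above N ?D j (?s + u + w) (j + w - u)" for u w
  \<comment> \<open>For odd \<open>j\<close> the apex is at time 1, but the cut at height
    \<open>j\<close> is idle at time 0.\<close>
  have start: "count_above N ?D j ?s j = 0"
  proof (cases "even j")
    case True
    hence "?s = 0" by (simp add: even_iff_mod_2_eq_zero)
    thus ?thesis using above_0[of N ?D j j] by simp
  next
    case False
    hence s: "?s = Suc 0" by presburger
    have "\<not> active N (?D 0) 0 j" using False by (simp add: active_def)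
    from above_inactive[of N ?D 0 j, OF this, of j] show ?thesis using above_0[of N ?D j j] s by simp
  qed
  have parity: "even (?s + u + w + (j + w - u))" if "u \<le> j + w" for u w
  proof -
    have e: "?s + u + w + (j + w - u) = ?s + j + 2 * w" using that by simp
    have "even (?s + j)" by presburger
    thus ?thesis unfolding e by simp
  qed
  \<comment> \<open>A cut that rises by one wire per step is not overtaken by any particle.\<close>
  have row0: "k 0 w = 0" if "?S 0 w" for w
  proof (induction w)
    case 0
    show ?case using start by (simp add: k_def)
  next
    case (Suc w)
    thus ?case using above_shift[of N ?D j "?s + w" "j + w"] by (simp add: k_def)
  qed
  \<comment> \<open>A cut that falls by one wire per step gains at most one particle each time; it
    also gains at least one, because only \<open>j - u\<close> of the \<open>j\<close> particles fit
    below it.\<close>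
  have col0: "k u 0 = u" if "u \<le> j" for u
    using that
  proof (induction u)
    case 0
    show ?case using start by (simp add: k_def)
  next
    case (Suc u)
    let ?t = "?s + u" and ?i = "j - Suc u"
    have i: "Suc ?i = j - u" using Suc.prems by simp
    have IH: "count_above N ?D j ?t (j - u) = u" using Suc by (simp add: k_def)
    have "count_above N ?D j (Suc ?t) ?i \<le> Suc (count_above N ?D j ?t (Suc ?i))"
    proof (cases "active N (?D ?t) ?t ?i")
      case True
      hence "\<not> C ?t ?i" using completion_iff by (auto simp: active_def)
      hence "count_above N ?D j (Suc ?t) ?i =
          min (count_above N ?D j ?t (?i - 1)) (Suc (count_above N ?D j ?t (Suc ?i)))"
        using True by (intro above_step) (auto simp: active_def)
      thus ?thesis by simp
    next
      case False
      from above_inactive[of N ?D ?t ?i, OF this, of j] show ?thesis using above_Suc_ge[of N ?D j ?t ?i] by simp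
    qed
    hence "count_above N ?D j (Suc ?t) ?i \<le> Suc u" using IH i by simp
    moreover have "j \<le> ?i + count_above N ?D j (Suc ?t) ?i" by (rule above_ge)
    ultimately have "count_above N ?D j (Suc ?t) ?i = Suc u" using Suc.prems by linarith
    thus ?case by (simp add: k_def)
  qed
  have step: "?S u w \<Longrightarrow> k (Suc u) (Suc w) =
      (if C (?s + u + w) (j + w - u) then k u w else min (k (Suc u) w) (Suc (k u (Suc w))))" 
    if S1: "?S (Suc u) (Suc w)" for u w
  proof -
    assume S: "?S u w"
    let ?t = "?s + u + w" and ?i = "j + w - u"
    have ev: "even (?t + ?i)" using parity S by blast
    \<comment> \<open>The corner \<open>(u + 1, w + 1)\<close> has the same height two time units
      later; in the second of them this height is idle.\<close>
    have na: "\<not> active N c (Suc ?t) ?i" for c using ev by (simp add: active_def)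
    have "k (Suc u) (Suc w) = count_above N ?D j (Suc (Suc ?t)) ?i" by (simp add: k_def)
    also have "\<dots> = count_above N ?D j (Suc ?t) ?i" by (rule above_inactive[of N ?D "Suc ?t" ?i, OF na])
    finally have k1: "k (Suc u) (Suc w) = count_above N ?D j (Suc ?t) ?i" .
    show ?thesis
    proof (cases "C ?t ?i")
      case True
      hence "\<not> active N (?D ?t) ?t ?i" using completion_iff by (auto simp: active_def)
      from above_inactive[of N ?D ?t ?i, OF this, of j] show ?thesis using k1 True by (simp add: k_def)
    next
      case False
      have ne: "?i \<noteq> 0" "?i \<noteq> N" using False bd ev by (metis add.right_neutral, metis)
      hence i: "0 < ?i" "?i < N" using S by auto
      have na': "\<not> active N c ?t (?i - 1)" "\<not> active N c ?t (Suc ?i)" for c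
        using ev i by (auto simp: active_def)
      have "count_above N ?D j (Suc ?t) ?i = min (count_above N ?D j ?t (?i - 1)) (Suc (count_above N ?D j ?t (Suc ?i)))"
        using i ev False by (rule above_step)
      moreover have "count_above N ?D j ?t (?i - 1) = k (Suc u) w"
        using above_inactive[of N ?D ?t "?i - 1", OF na'(1), of j] i by (simp add: k_def)
      moreover have "count_above N ?D j ?t (Suc ?i) = k u (Suc w)"
        using above_inactive[of N ?D ?t "Suc ?i", OF na'(2), of j] i by (simp add: k_def Suc_diff_le)
      ultimately show ?thesis using k1 False by simp
    qed
  qed
  have "k u w + g \<le> u \<longleftrightarrow> strict_chain (cone_contact N C j) g u w"
  proof (rule last_passage[where S = ?S])
    show "u \<le> j + w \<and> j + w \<le> N + u" using uw by simp
    show "k 0 w = 0" if "?S 0 w" for w using row0 that .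
    show "k u 0 = u" if "?S u 0" for u using col0 that by simp
    show "?S u w \<and> k (Suc u) (Suc w) = k u w"
      if "?S (Suc u) (Suc w)" "cone_contact N C j u w" for u w
      using step[of u w] that by (auto simp: cone_contact_def)
    show "?S (Suc u) w \<and> ?S u (Suc w) \<and> k (Suc u) (Suc w) = min (k (Suc u) w) (Suc (k u (Suc w)))"
      if S: "?S (Suc u) (Suc w)" and nc: "\<not> cone_contact N C j u w" for u w
    proof -
      have S': "?S u w" using S by simp
      have nC: "\<not> C (?s + u + w) (j + w - u)" using S' nc by (simp add: cone_contact_def)
      have "j + w - u \<noteq> 0" "j + w - u \<noteq> N"
        using nC bd parity[of u w] S' by (metis add.right_neutral, metis)
      thus ?thesis using step[of u w] S S' nC by auto
    qed
  qed
  thus ?thesis by (simp add: k_def)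
qed

definition reversing :: "nat \<Rightarrow> (nat \<Rightarrow> nat) \<Rightarrow> bool" where
  "reversing N q \<longleftrightarrow> (\<forall>x<N. q x = N - 1 - x)"

text \<open>The corner \<open>(j + 2, N - j + 2)\<close> has height \<open>N - j\<close> and, up to
  an idle step for odd \<open>j\<close>, time \<open>N + 4\<close>. If not all \<open>j\<close>
  particles are above it, then the count plus 3 is at most \<open>j + 2\<close>, which is a chain of
  length 3. The reversal is characterised by these cuts for all \<open>j\<close>.\<close>

theorem sorts_iff_no_chain:
  assumes bd: "\<And>t. even t \<Longrightarrow> C t 0" "\<And>t. even (t + N) \<Longrightarrow> C t N"
  shows "reversing N (strand N (completion N C) (N + 4)) \<longleftrightarrow>
    (\<forall>j\<le>N. \<not> strict_chain (cone_contact N C j) 3 (j + 2) (N - j + 2))"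
proof -
  let ?q = "strand N (completion N C) (N + 4)"
  let ?A = "\<lambda>j. count_above N (completion N C) j (N + 4) (N - j)"
  have "?A j = j \<longleftrightarrow> \<not> strict_chain (cone_contact N C j) 3 (j + 2) (N - j + 2)" if j: "j \<le> N" for j
  proof -
    have e: "j mod 2 + (j + 2) + (N - j + 2) = N + 4 + j mod 2" "j + (N - j + 2) - (j + 2) = N - j"
      using j by auto
    have "count_above N (completion N C) j (N + 4 + j mod 2) (N - j) = ?A j"
    proof (cases "even j")
      case True
      hence "j mod 2 = 0" by (simp add: even_iff_mod_2_eq_zero)
      thus ?thesis by simp
    next
      case False
      hence s: "j mod 2 = Suc 0" by presburger
      have "\<not> active N (completion N C (N + 4)) (N + 4) (N - j)"
        using False j by (auto simp: active_def)
      from above_inactive[of N "completion N C" "N + 4" "N - j", OF this, of j] show ?thesis using s by simp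
    qed
    hence "?A j + 3 \<le> j + 2 \<longleftrightarrow> strict_chain (cone_contact N C j) 3 (j + 2) (N - j + 2)"
      using above_chain[of j N C "j + 2" "N - j + 2" 3, OF j bd, unfolded e] j by simp
    thus ?thesis using above_le[of N "completion N C" j "N + 4" "N - j"] by linarith
  qed
  moreover have "reversing N ?q \<longleftrightarrow> (\<forall>j\<le>N. ?A j = j)"
  proof
    assume r: "reversing N ?q"
    show "\<forall>j\<le>N. ?A j = j"
    proof (intro allI impI)
      fix j assume j: "j \<le> N"
      have "{x. x < j \<and> N - j \<le> ?q x} = {..<j}" using r j unfolding reversing_def by auto
      thus "?A j = j" unfolding count_above_def by simp
    qed
  next
    assume a: "\<forall>j\<le>N. ?A j = j"
    \<comment> \<open>The cut for \<open>Suc x\<close> particles bounds \<open>?q x\<close> from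
      below; by induction all higher wires are taken by smaller labels.\<close>
    have ge: "N - Suc x \<le> ?q x" if "x < N" for x
    proof -
      let ?B = "{y. y < Suc x \<and> N - Suc x \<le> ?q y}"
      have "card ?B = Suc x" using a that unfolding count_above_def by auto
      hence "?B = {..<Suc x}" by (intro card_subset_eq) auto
      moreover have "x \<in> {..<Suc x}" by simp
      ultimately show ?thesis by blast
    qed
    have "?q x = N - 1 - x" if "x < N" for x
      using that
    proof (induction x rule: less_induct)
      case (less x)
      show ?case
      proof (rule ccontr)
        assume ne: "?q x \<noteq> N - 1 - x"
        have "?q x < N" using less.prems by simp
        define y where "y = N - 1 - ?q x"
        have "?q x \<noteq> N - Suc x" using ne by simp
        hence y: "y < x" "?q x = N - 1 - y"
          using ge[OF less.prems] less.prems \<open>?q x < N\<close> unfolding y_def by linarith+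
        hence "?q y = ?q x" using less by simp
        hence "y = x" by (simp only: strand_inj)
        thus False using y by simp
      qed
    qed
    thus "reversing N ?q" by (simp add: reversing_def)
  qed
  ultimately show ?thesis by blast
qed

section \<open>Reduced networks\<close>

text \<open>Equivalently, no pair of strands crosses twice: strands start in order, so an exchange
  out of order needs an earlier one of the same pair.\<close>

definition reduced :: "nat \<Rightarrow> (nat \<Rightarrow> nat \<Rightarrow> bool) \<Rightarrow> nat \<Rightarrow> bool" where
  "reduced N C m \<longleftrightarrow> (\<forall>t<m. \<forall>i. active N (C t) t i \<longrightarrow> ordered (strand N C t) i)"

definition crossings :: "nat \<Rightarrow> (nat \<Rightarrow> nat \<Rightarrow> bool) \<Rightarrow> nat \<Rightarrow> (nat \<times> nat) set" where
  "crossings N C m = {(t, i). t < m \<and> active N (C t) t i}"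

definition pair_at :: "nat \<Rightarrow> (nat \<Rightarrow> nat \<Rightarrow> bool) \<Rightarrow> nat \<times> nat \<Rightarrow> nat set" where
  "pair_at N C = (\<lambda>(t, i). {x. Suc (strand N C t x) = i \<or> strand N C t x = i})"

lemma finite_crossings: "finite (crossings N C m)"
  by (rule finite_subset[of _ "{..<m} \<times> {..<N}"]) (auto simp: crossings_def active_def)

lemma pair_atE:
  assumes "active N c t i"
  obtains x y where "Suc (strand N C t x) = i" "strand N C t y = i" "x \<noteq> y" "x < N" "y < N"
    "pair_at N C (t, i) = {x, y}"
proof -
  obtain x y where x: "strand N C t x = i - 1" and y: "strand N C t y = i"
    using strand_surj by metis
  have i: "0 < i" "i < N" using assms by (auto simp: active_def)
  have x': "Suc (strand N C t x) = i" using x i by simp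
  moreover have "x \<noteq> y" using x' y by auto
  moreover have "x < N" "y < N"
    using x' y i strand_less[of N C t x] strand_less[of N C t y] by linarith+
  moreover have "pair_at N C (t, i) = {x, y}"
  proof -
    have "Suc (strand N C t z) = i \<longleftrightarrow> z = x" for z
      using x' strand_inj by (metis Suc_inject)
    moreover have "strand N C t z = i \<longleftrightarrow> z = y" for z
      using y strand_inj by metis
    ultimately show ?thesis by (auto simp: pair_at_def)
  qed
  ultimately show ?thesis using that y by blast
qed

lemma layer_order_change:
  assumes "p < q" "\<not> layer N c t p < layer N c t q"
  shows "active N c t q \<and> q = Suc p"
proof -
  have "layer N c t p \<noteq> layer N c t q" using assms layer_inj by (metis less_irrefl)
  thus ?thesis using assms by (auto simp: layer_def active_def split: if_splits)
qed

lemma strand_order_change: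
  assumes "strand N C t x < strand N C t y" "\<not> strand N C (Suc t) x < strand N C (Suc t) y"
  shows "active N (C t) t (strand N C t y) \<and> strand N C t y = Suc (strand N C t x)"
  using layer_order_change assms by simp

lemma crossing_swaps:
  assumes "active N (C t) t i" "Suc (strand N C t x) = i" "strand N C t y = i"
  shows "strand N C (Suc t) x = i" "Suc (strand N C (Suc t) y) = i"
proof -
  have "strand N C t x = i - 1" "i > 0" using assms by auto
  thus "strand N C (Suc t) x = i" "Suc (strand N C (Suc t) y) = i"
    using layer_active[OF assms(1)] assms(3) by simp_all
qed

lemma first_crossing:
  assumes "strand N C s x < strand N C s y" "\<not> strand N C t x < strand N C t y" "s \<le> t"
  obtains r where "s \<le> r" "r < t" "active N (C r) r (strand N C r y)"
    "strand N C r y = Suc (strand N C r x)"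
proof -
  have "\<exists>r. s \<le> r \<and> r < t \<and> strand N C r x < strand N C r y \<and>
      \<not> strand N C (Suc r) x < strand N C (Suc r) y"
    using assms
  proof (induction t)
    case (Suc t)
    show ?case
    proof (cases "strand N C t x < strand N C t y")
      case True
      hence "s \<le> t" using Suc.prems by (cases "s = Suc t") auto
      thus ?thesis using True Suc.prems by blast
    next
      case False
      hence "s \<le> t" using Suc.prems by (cases "s = Suc t") auto
      then obtain r where "s \<le> r" "r < t" "strand N C r x < strand N C r y \<and>
          \<not> strand N C (Suc r) x < strand N C (Suc r) y"
        using Suc.IH Suc.prems(1) False by blast
      thus ?thesis using less_SucI by blast
    qed
  qed auto
  thus ?thesis using that strand_order_change by metis
qed

lemma pair_at_eqI:
  assumes "Suc (strand N C t x) = i" "strand N C t y = i"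
  shows "pair_at N C (t, i) = {x, y}"
proof -
  have "Suc (strand N C t z) = i \<longleftrightarrow> z = x" for z
    using assms strand_inj by (metis Suc_inject)
  moreover have "strand N C t z = i \<longleftrightarrow> z = y" for z
    using assms strand_inj by metis
  ultimately show ?thesis by (auto simp: pair_at_def)
qed

text \<open>To return to its original order the pair would have to cross while inverted.\<close>

lemma reduced_stays_inverted:
  assumes "reduced N C m" "x < y" "strand N C s y < strand N C s x" "s \<le> t" "t \<le> m"
  shows "strand N C t y < strand N C t x"
proof (rule ccontr)
  assume "\<not> strand N C t y < strand N C t x"
  then obtain r where r: "s \<le> r" "r < t" "active N (C r) r (strand N C r x)"
    "strand N C r x = Suc (strand N C r y)"
    using first_crossing[OF assms(3) _ assms(4)] by metis
  hence "ordered (strand N C r) (strand N C r x)"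
    using assms(1,5) unfolding reduced_def by (meson less_le_trans)
  then obtain x' y' where xy: "x' < y'" "Suc (strand N C r x') = strand N C r x"
    "strand N C r y' = strand N C r x"
    unfolding ordered_def by blast
  hence "strand N C r x' = strand N C r y" using r by simp
  hence "x' = y" "y' = x" using xy strand_inj by metis+
  thus False using xy assms(2) by simp
qed

lemma reduced_inj:
  assumes "reduced N C m"
  shows "inj_on (pair_at N C) (crossings N C m)"
proof -
  have *: False if tt: "t < t'" "t' < m" and a: "active N (C t) t i" "active N (C t') t' i'"
    and eq: "pair_at N C (t, i) = pair_at N C (t', i')" for t i t' i'
  proof -
    have "ordered (strand N C t) i" "ordered (strand N C t') i'"
      using assms a tt unfolding reduced_def by (meson less_trans)+
    then obtain x y x' y' where xy: "x < y" "Suc (strand N C t x) = i" "strand N C t y = i"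
      and xy': "x' < y'" "Suc (strand N C t' x') = i'" "strand N C t' y' = i'"
      unfolding ordered_def by blast
    have "{x, y} = {x', y'}"
      using eq pair_at_eqI[OF xy(2,3)] pair_at_eqI[OF xy'(2,3)] by simp
    hence [simp]: "x' = x" "y' = y" using xy xy' by (auto simp: doubleton_eq_iff)
    have "strand N C (Suc t) y < strand N C (Suc t) x"
      using crossing_swaps[OF a(1) xy(2,3)] by simp
    hence "strand N C t' y < strand N C t' x"
      using reduced_stays_inverted[OF assms xy(1), of "Suc t" t'] tt by simp
    thus False using xy' by simp
  qed
  show ?thesis
  proof (rule inj_onI, clarify)
    fix t i t' i'
    assume c: "(t, i) \<in> crossings N C m" "(t', i') \<in> crossings N C m"
      and eq: "pair_at N C (t, i) = pair_at N C (t', i')"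
    have [simp]: "t = t'"
      using *[of t t' i i'] *[of t' t i' i] c eq by (auto simp: crossings_def) (metis linorder_neqE_nat)
    have a: "active N (C t) t i" "active N (C t) t i'" using c by (auto simp: crossings_def)
    obtain x y where xy: "Suc (strand N C t x) = i" "strand N C t y = i" "pair_at N C (t, i) = {x, y}"
      "x \<noteq> y"
      using pair_atE[OF a(1)] by metis
    obtain x' y' where xy': "Suc (strand N C t x') = i'" "strand N C t y' = i'"
      "pair_at N C (t, i') = {x', y'}"
      using pair_atE[OF a(2)] by metis
    have "x' = x \<and> y' = y \<or> x' = y \<and> y' = x"
      using xy xy' eq by (auto simp: doubleton_eq_iff)
    thus "t = t' \<and> i = i'" using xy xy' by auto
  qed
qed

section \<open>Counting the crossings of a reversing network\<close>

definition pairs :: "nat \<Rightarrow> nat set set" where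
  "pairs N = {A. A \<subseteq> {..<N} \<and> card A = 2}"

lemma card_pairs: "card (pairs N) = N choose 2"
  unfolding pairs_def using n_subsets[of "{..<N}" 2] by simp

lemma pair_at_pairs: "pair_at N C ` crossings N C m \<subseteq> pairs N"
proof
  fix A assume "A \<in> pair_at N C ` crossings N C m"
  then obtain t i where a: "active N (C t) t i" "A = pair_at N C (t, i)"
    by (auto simp: crossings_def)
  then obtain x y where "x \<noteq> y" "x < N" "y < N" "A = {x, y}"
    using pair_atE[OF a(1)] by metis
  thus "A \<in> pairs N" by (auto simp: pairs_def)
qed

lemma reversing_pairs:
  assumes "reversing N (strand N C m)"
  shows "pair_at N C ` crossings N C m = pairs N"
proof
  show "pairs N \<subseteq> pair_at N C ` crossings N C m"
  proof
    fix A assume A: "A \<in> pairs N"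
    then obtain x y where "A = {x, y}" "x \<noteq> y" unfolding pairs_def card_2_iff by auto
    then obtain x y where xy: "A = {x, y}" "x < y"
      by (metis insert_commute linorder_neqE_nat)
    have "y < N" using A xy by (auto simp: pairs_def)
    hence "\<not> strand N C m x < strand N C m y"
      using assms xy by (auto simp: reversing_def)
    moreover have "strand N C 0 x < strand N C 0 y" using xy by simp
    ultimately obtain r where r: "r < m" "active N (C r) r (strand N C r y)"
      "strand N C r y = Suc (strand N C r x)"
      using first_crossing[of N C 0 x y m] by auto
    have "pair_at N C (r, strand N C r y) = A"
      using pair_at_eqI[of N C r x "strand N C r y" y] r xy by simp
    thus "A \<in> pair_at N C ` crossings N C m"
      using r by (force simp: crossings_def)
  qed
qed (rule pair_at_pairs)

lemma card_crossings:
  assumes "reversing N (strand N C m)" "reduced N C m"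
  shows "card (crossings N C m) = N choose 2"
  using card_image[OF reduced_inj[OF assms(2)]] reversing_pairs[OF assms(1)] card_pairs by simp

text \<open>Every pair crosses, so with \<open>N choose 2\<close> crossings the map to pairs is a
  bijection. A crossing of an inverted pair would be preceded by another crossing of the same
  pair.\<close>

lemma reduced_if_card:
  assumes rev: "reversing N (strand N C m)" and "card (crossings N C m) = N choose 2"
  shows "reduced N C m"
proof -
  have inj: "inj_on (pair_at N C) (crossings N C m)"
    using assms card_pairs reversing_pairs[OF rev] finite_crossings
    by (intro eq_card_imp_inj_on) simp_all
  have "ordered (strand N C t) i" if t: "t < m" and a: "active N (C t) t i" for t i
  proof -
    obtain x y where xy: "Suc (strand N C t x) = i" "strand N C t y = i" "x \<noteq> y"
      "pair_at N C (t, i) = {x, y}"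
      using pair_atE[OF a] by metis
    show ?thesis
    proof (cases "x < y")
      case True
      thus ?thesis using xy unfolding ordered_def by blast
    next
      case False
      hence "strand N C 0 y < strand N C 0 x" "\<not> strand N C t y < strand N C t x" using xy by auto
      then obtain r where r: "r < t" "active N (C r) r (strand N C r x)"
        "strand N C r x = Suc (strand N C r y)"
        using first_crossing[of N C 0 y x t] by auto
      have "pair_at N C (r, strand N C r x) = pair_at N C (t, i)"
        using pair_at_eqI[of N C r y "strand N C r x" x] r xy by auto
      moreover have "(r, strand N C r x) \<in> crossings N C m" "(t, i) \<in> crossings N C m"
        using r t a by (auto simp: crossings_def)
      ultimately have "r = t" using inj unfolding inj_on_def by blast
      thus ?thesis using r by simp
    qed
  qed
  thus ?thesis by (simp add: reduced_def)
qed

lemma reduced_completion: "reduced N (completion N C) m"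
  unfolding reduced_def using completion_iff by (auto simp: active_def)

text \<open>In a reduced network comparators always meet their inputs in order, hence act as plain
  crossings.\<close>

lemma strand_completion_reduced:
  assumes "reduced N C m" "t \<le> m"
  shows "strand N (completion N C) t x = strand N C t x"
  using assms(2)
proof (induction t arbitrary: x)
  case (Suc t)
  have eq: "strand N (completion N C) t = strand N C t" using Suc by auto
  have "active N (completion N C t) t i = active N (C t) t i" for i
    using assms(1) Suc.prems completion_iff[of N C t i] unfolding eq
    by (auto simp: active_def reduced_def)
  hence "layer N (completion N C t) t p = layer N (C t) t p" for p
    by (simp add: layer_def)
  thus ?case using eq by simp
qed simp

section \<open>Edges as cells of a network\<close>

text \<open>Integer endpoints lift the polygon to its universal cover. The edges then form a Moebius
  strip with deck transformation \<open>edge_glide\<close>, which is why time runs through only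
  \<open>m\<close> values and a further turn mirrors the heights.\<close>

definition edge :: "nat \<Rightarrow> int \<Rightarrow> int \<Rightarrow> nat set" where
  "edge m a b = {nat (a mod int m), nat (b mod int m)}"

lemma edge_glide: "edge m b (a + int m) = edge m a b"
  by (auto simp: edge_def)

lemma edge_nat: "a < m \<Longrightarrow> b < m \<Longrightarrow> edge m (int a) (int b) = {a, b}"
  by (simp add: edge_def)

lemma edge_period: "edge m (a + int m * k) (b + int m * k) = edge m a b"
  by (simp add: edge_def)

lemma mod_wrap:
  fixes x :: int
  assumes "k \<le> x" "x < 2 * k"
  shows "x mod k = x - k"
proof -
  have "x mod k = (x - k) mod k" using mod_add_self2[of "x - k" k] by simp
  also have "\<dots> = x - k" using assms by (intro mod_pos_pos_trivial) auto
  finally show ?thesis .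
qed

lemma edge_repr:
  assumes "a < b" "b < a + int m"
  obtains p q where "p < q" "q < m" "edge m a b = {p, q}"
    "int (q - p) = b - a \<or> int (q - p) = int m - (b - a)"
proof -
  have m: "int m > 0" using assms by linarith
  define k where "k = a div int m"
  define a' where "a' = a - int m * k"
  define b' where "b' = b - int m * k"
  have a': "0 \<le> a'" "a' < int m" unfolding a'_def k_def using m
    by (simp_all add: minus_mult_div_eq_mod)
  have e: "edge m a b = edge m a' b'"
    using edge_period[of m a' k b'] by (simp add: a'_def b'_def)
  have ab: "a' < b'" "b' < a' + int m" "b' - a' = b - a" using assms by (simp_all add: a'_def b'_def)
  show ?thesis
  proof (cases "b' < int m")
    case True
    have "edge m a' b' = {nat a', nat b'}"
      using a' ab True by (simp add: edge_def)
    thus ?thesis using that[of "nat a'" "nat b'"] e a' ab True by auto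
  next
    case False
    have "b' mod int m = b' - int m" using False ab a' by (intro mod_wrap) auto
    hence "edge m a' b' = {nat (b' - int m), nat a'}"
      using a' by (simp add: edge_def insert_commute)
    thus ?thesis using that[of "nat (b' - int m)" "nat a'"] e a' ab False by auto
  qed
qed

lemma edge_in_edges:
  assumes "2 \<le> b - a" "b - a \<le> int m - 2"
  shows "edge m a b \<in> edges m" "int (edge_length m (edge m a b)) = min (b - a) (int m - (b - a))"
proof -
  obtain p q where pq: "p < q" "q < m" "edge m a b = {p, q}"
    "int (q - p) = b - a \<or> int (q - p) = int m - (b - a)"
    using edge_repr[of a b m] assms by auto
  have "Max {p, q} - Min {p, q} = q - p" using pq by simp
  thus l: "int (edge_length m (edge m a b)) = min (b - a) (int m - (b - a))"
    using pq by (auto simp: edge_length_def)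
  show "edge m a b \<in> edges m" using l pq assms by (auto simp: edges_def)
qed

lemma edges_repr:
  assumes "e \<in> edges m"
  obtains p q where "p < q" "q < m" "e = {p, q}" "2 \<le> q - p" "q - p \<le> m - 2"
proof -
  obtain p q where "e = {p, q}" "p \<noteq> q" using assms unfolding edges_def card_2_iff by auto
  then obtain p q where pq: "e = {p, q}" "p < q" by (metis insert_commute linorder_neqE_nat)
  have "Max {p, q} - Min {p, q} = q - p" using pq by simp
  hence "2 \<le> q - p" "q - p \<le> m - 2" "q < m"
    using assms pq by (auto simp: edges_def edge_length_def)
  thus ?thesis using that pq by blast
qed

text \<open>Interleaving within one period survives reduction mod \<open>m\<close>; the four cases
  record which endpoints wrap around.\<close>

lemma edge_cross:
  assumes "a < c" "c < b" "b < d" "d < a + int m"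
  shows "cross m (edge m a b) (edge m c d)" "edge m a b \<noteq> edge m c d"
proof -
  have m: "int m > 0" using assms by linarith
  define k where "k = a div int m"
  define A where "A = nat (a - int m * k)"
  have a0: "0 \<le> a - int m * k" "a - int m * k < int m" unfolding k_def using m
    by (simp_all add: minus_mult_div_eq_mod)
  define B C D where "B = nat (b - int m * k)" and "C = nat (c - int m * k)" and "D = nat (d - int m * k)"
  have i: "int A = a - int m * k" "int B = b - int m * k" "int C = c - int m * k" "int D = d - int m * k"
    using a0 assms by (simp_all add: A_def B_def C_def D_def)
  have ord: "A < C" "C < B" "B < D" "D < A + m" "A < m" using i assms a0 by linarith+
  have e: "edge m a b = edge m (int A) (int B)" "edge m c d = edge m (int C) (int D)"
    using edge_period[of m "int A" k "int B"] edge_period[of m "int C" k "int D"] i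
    by (simp_all add: i)
  have md: "int X mod int m = int (if X < m then X else X - m)" if "X < 2 * m" for X
    using that mod_wrap[of "int m" "int X"] by auto
  define f where "f X = (if X < m then X else X - m)" for X
  have E: "edge m a b = {f A, f B}" "edge m c d = {f C, f D}"
    using ord unfolding e by (simp_all add: edge_def md f_def)
  consider "D < m" | "B < m" "D \<ge> m" | "C < m" "B \<ge> m" | "C \<ge> m" by linarith
  hence "cross m {f A, f B} {f C, f D}"
  proof cases
    case 1
    thus ?thesis using interleaved_imp_cross[of A C B D m] ord by (simp add: f_def)
  next
    case 2
    hence "cross m {f D, f C} {f A, f B}"
      using interleaved_imp_cross[of "D - m" A C B m] ord by (simp add: f_def)
    thus ?thesis by (metis cross_commute insert_commute)
  next
    case 3
    hence "cross m {f B, f A} {f D, f C}"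
      using interleaved_imp_cross[of "B - m" "D - m" A C m] ord by (simp add: f_def)
    thus ?thesis by (metis insert_commute)
  next
    case 4
    hence "cross m {f C, f D} {f B, f A}"
      using interleaved_imp_cross[of "C - m" "B - m" "D - m" A m] ord by (simp add: f_def)
    thus ?thesis by (metis cross_commute insert_commute)
  qed
  moreover have "f A \<noteq> f C" "f A \<noteq> f D" using ord by (auto simp: f_def)
  hence "{f A, f B} \<noteq> {f C, f D}" by blast
  ultimately show "cross m (edge m a b) (edge m c d)" "edge m a b \<noteq> edge m c d"
    unfolding E by blast+
qed

text \<open>If three edges interleave pairwise, their right endpoints come in the same order as
  their left ones and all after them. The six branches below are the possible orders of the left
  endpoints.\<close>

lemma no_3_crossing_iff:
  assumes T: "T \<subseteq> edges m"
  shows "no_3_crossing m T \<longleftrightarrow> \<not> (\<exists>p0 p1 p2 p3 p4 p5. p0 < p1 \<and> p1 < p2 \<and> p2 < p3 \<and> p3 < p4 \<and>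
    p4 < p5 \<and> p5 < m \<and> {p0, p3} \<in> T \<and> {p1, p4} \<in> T \<and> {p2, p5} \<in> T)"
    (is "_ \<longleftrightarrow> \<not> (\<exists>p0 p1 p2 p3 p4 p5. ?P p0 p1 p2 p3 p4 p5)")
proof -
  have "\<exists>p0 p1 p2 p3 p4 p5. ?P p0 p1 p2 p3 p4 p5"
    if efg: "e \<in> T" "f \<in> T" "g \<in> T" "e \<noteq> f" "e \<noteq> g" "f \<noteq> g" "cross m e f" "cross m e g" "cross m f g"
    for e f g
  proof -
    obtain a a' where a: "a < a'" "a' < m" "e = {a, a'}" using edges_repr[of e m] efg T by blast
    obtain b b' where b: "b < b'" "b' < m" "f = {b, b'}" using edges_repr[of f m] efg T by blast
    obtain c c' where c: "c < c'" "c' < m" "g = {c, c'}" using edges_repr[of g m] efg T by blast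
    have 1: "a < b \<and> b < a' \<and> a' < b' \<or> b < a \<and> a < b' \<and> b' < a'"
      using cross_imp_interleaved[OF a(1,2) b(1,2)] efg a b by simp
    have 2: "a < c \<and> c < a' \<and> a' < c' \<or> c < a \<and> a < c' \<and> c' < a'"
      using cross_imp_interleaved[OF a(1,2) c(1,2)] efg a c by simp
    have 3: "b < c \<and> c < b' \<and> b' < c' \<or> c < b \<and> b < c' \<and> c' < b'"
      using cross_imp_interleaved[OF b(1,2) c(1,2)] efg b c by simp
    have ex: ?thesis if "?P p0 p1 p2 p3 p4 p5" for p0 p1 p2 p3 p4 p5 using that by blast
    have T: "{a, a'} \<in> T" "{b, b'} \<in> T" "{c, c'} \<in> T" using a b c efg by auto
    show ?thesis
    proof (cases "a < b")
      case ab: True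
      show ?thesis
      proof (cases "b < c")
        case True
        show ?thesis by (rule ex[of a b c a' b' c']) (use 1 2 3 ab True a b c T in auto)
      next
        case bc: False
        show ?thesis
        proof (cases "a < c")
          case True
          show ?thesis by (rule ex[of a c b a' c' b']) (use 1 2 3 ab bc True a b c T in auto)
        next
          case False
          show ?thesis by (rule ex[of c a b c' a' b']) (use 1 2 3 ab bc False a b c T in auto)
        qed
      qed
    next
      case ba: False
      show ?thesis
      proof (cases "a < c")
        case True
        show ?thesis by (rule ex[of b a c b' a' c']) (use 1 2 3 ba True a b c T in auto)
      next
        case ca: False
        show ?thesis
        proof (cases "b < c")
          case True
          show ?thesis by (rule ex[of b c a b' c' a']) (use 1 2 3 ba ca True a b c T in auto)
        next
          case False
          show ?thesis by (rule ex[of c b a c' b' a']) (use 1 2 3 ba ca False a b c T in auto)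
        qed
      qed
    qed
  qed
  note A = this
  have "\<not> no_3_crossing m T" if P: "?P p0 p1 p2 p3 p4 p5" for p0 p1 p2 p3 p4 p5
  proof -
    have "cross m {p0, p3} {p1, p4}" "cross m {p0, p3} {p2, p5}" "cross m {p1, p4} {p2, p5}"
      using P by (auto intro!: interleaved_imp_cross)
    moreover have "{p0, p3} \<noteq> {p1, p4}" "{p0, p3} \<noteq> {p2, p5}" "{p1, p4} \<noteq> {p2, p5}"
      using P by (auto simp: doubleton_eq_iff)
    moreover have "{p0, p3} \<in> T" "{p1, p4} \<in> T" "{p2, p5} \<in> T" using P by simp_all
    ultimately show ?thesis unfolding no_3_crossing_def by meson
  qed
  note B = this
  show ?thesis
  proof
    assume "no_3_crossing m T"
    thus "\<not> (\<exists>p0 p1 p2 p3 p4 p5. ?P p0 p1 p2 p3 p4 p5)" using B by metis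
  next
    assume n: "\<not> (\<exists>p0 p1 p2 p3 p4 p5. ?P p0 p1 p2 p3 p4 p5)"
    show "no_3_crossing m T"
      unfolding no_3_crossing_def
    proof (rule notI, elim bexE conjE)
      fix e f g
      assume "e \<in> T" "f \<in> T" "g \<in> T" "e \<noteq> f" "e \<noteq> g" "f \<noteq> g"
        "cross m e f" "cross m e g" "cross m f g"
      from A[OF this] show False using n by (rule notE[rotated])
    qed
  qed
qed

section \<open>Edges as cells of the space-time strip\<close>

definition cell_edge :: "nat \<Rightarrow> nat \<Rightarrow> nat \<Rightarrow> nat set" where
  "cell_edge m t i = edge m ((int t - int i - 2) div 2) ((int t + int i + 2) div 2)"

definition cells :: "nat \<Rightarrow> (nat \<times> nat) set" where
  "cells m = {(t, i). t < m \<and> i + 4 \<le> m \<and> even (t + i)}"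

lemma cell_endpoints:
  assumes "even (t + i)"
  obtains a b where "cell_edge m t i = edge m a b" "a + b = int t" "b - a = int i + 2"
proof -
  let ?a = "(int t - int i - 2) div 2" and ?b = "(int t + int i + 2) div 2"
  have "even (int t + int i)" "even (int t - int i)" using assms by auto
  hence "?a + ?b = int t" "?b - ?a = int i + 2" by presburger+
  thus ?thesis using that cell_edge_def by blast
qed

lemma edge_length_cell:
  assumes "even (t + i)" "i + 4 \<le> m"
  shows "cell_edge m t i \<in> edges m" "edge_length m (cell_edge m t i) = min (i + 2) (m - 2 - i)"
proof -
  obtain a b where ab: "cell_edge m t i = edge m a b" "b - a = int i + 2"
    using cell_endpoints assms by metis
  have "2 \<le> b - a" "b - a \<le> int m - 2" using ab assms by linarith+
  note * = edge_in_edges[OF this]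
  show "cell_edge m t i \<in> edges m" using * ab by simp
  have "int (edge_length m (cell_edge m t i)) = int (min (i + 2) (m - 2 - i))"
    using *(2) ab assms by (auto simp: min_def)
  thus "edge_length m (cell_edge m t i) = min (i + 2) (m - 2 - i)" by linarith
qed

text \<open>The conditional is the inverse of \<open>cell_edge\<close>: for \<open>p + q\<close> at
  least \<open>m\<close> the lift whose time lies in the window is
  \<open>(q - m, p)\<close>.\<close>

lemma cell_edge_explicit:
  assumes "(t, i) \<in> cells m"
  obtains p q where "cell_edge m t i = {p, q}" "p < q" "q < m"
    "(if p + q < m then (p + q, q - p - 2) else (p + q - m, m - (q - p) - 2)) = (t, i)"
proof -
  obtain a b where ab: "cell_edge m t i = edge m a b" "a + b = int t" "b - a = int i + 2"
    using cell_endpoints assms unfolding cells_def by blast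
  have ti: "int t < int m" "int i + 4 \<le> int m" using assms by (auto simp: cells_def)
  have b: "0 < b" "b < int m" using ab ti by linarith+
  show ?thesis
  proof (cases "a \<ge> 0")
    case True
    have "cell_edge m t i = {nat a, nat b}" using edge_nat[of "nat a" m "nat b"] ab b True by simp
    moreover have "nat a + nat b = t" "nat b - nat a - 2 = i" using ab True b by linarith+
    ultimately show ?thesis using that[of "nat a" "nat b"] ab True b ti by simp
  next
    case False
    have "cell_edge m t i = edge m b (a + int m)" using ab edge_glide by simp
    also have "\<dots> = {nat b, nat (a + int m)}"
      using edge_nat[of "nat b" m "nat (a + int m)"] b False ab ti by simp
    finally have e: "cell_edge m t i = {nat b, nat (a + int m)}" .
    have "nat b + nat (a + int m) = t + m" "m - (nat (a + int m) - nat b) - 2 = i"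
      using ab False b ti by linarith+
    thus ?thesis using that[OF e] ab False b ti by simp
  qed
qed

lemma cells_bij: "bij_betw (\<lambda>(t, i). cell_edge m t i) (cells m) (edges m)"
proof (rule bij_betw_imageI)
  show "inj_on (\<lambda>(t, i). cell_edge m t i) (cells m)"
  proof (rule inj_onI, clarsimp)
    fix t i t' i'
    assume c: "(t, i) \<in> cells m" "(t', i') \<in> cells m" and eq: "cell_edge m t i = cell_edge m t' i'"
    obtain p q where pq: "cell_edge m t i = {p, q}" "p < q"
      "(if p + q < m then (p + q, q - p - 2) else (p + q - m, m - (q - p) - 2)) = (t, i)"
      using cell_edge_explicit[OF c(1)] by metis
    obtain p' q' where pq': "cell_edge m t' i' = {p', q'}" "p' < q'"
      "(if p' + q' < m then (p' + q', q' - p' - 2) else (p' + q' - m, m - (q' - p') - 2)) = (t', i')"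
      using cell_edge_explicit[OF c(2)] by metis
    have "{p, q} = {p', q'}" using eq pq(1) pq'(1) by simp
    hence "p = p' \<and> q = q'" using pq(2) pq'(2) by (auto simp: doubleton_eq_iff)
    hence "(t, i) = (t', i')" using pq(3) pq'(3) by metis
    thus "t = t' \<and> i = i'" by simp
  qed
  show "(\<lambda>(t, i). cell_edge m t i) ` cells m = edges m"
  proof
    show "(\<lambda>(t, i). cell_edge m t i) ` cells m \<subseteq> edges m"
      by (auto simp: cells_def intro: edge_length_cell)
    show "edges m \<subseteq> (\<lambda>(t, i). cell_edge m t i) ` cells m"
    proof
      fix e assume "e \<in> edges m"
      then obtain p q where pq: "p < q" "q < m" "e = {p, q}" "2 \<le> q - p" "q - p \<le> m - 2"
        using edges_repr by blast
      show "e \<in> (\<lambda>(t, i). cell_edge m t i) ` cells m"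
      proof (cases "p + q < m")
        case True
        have "(int (p + q) - int (q - p - 2) - 2) div 2 = int p"
          "(int (p + q) + int (q - p - 2) + 2) div 2 = int q" using pq by linarith+
        hence "cell_edge m (p + q) (q - p - 2) = e"
          using pq edge_nat[of p m q] by (simp only: cell_edge_def)
        moreover have "(p + q, q - p - 2) \<in> cells m" using pq True by (auto simp: cells_def)
        ultimately show ?thesis by force
      next
        case False
        have "(int (p + q - m) - int (m - (q - p) - 2) - 2) div 2 = int q - int m"
          "(int (p + q - m) + int (m - (q - p) - 2) + 2) div 2 = int p" using pq False by linarith+
        hence "cell_edge m (p + q - m) (m - (q - p) - 2) = edge m (int q - int m) (int p)"
          by (simp only: cell_edge_def)
        also have "\<dots> = e"
          using pq edge_nat[of p m q] edge_glide[of m "int p" "int q - int m"] by simp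
        finally have "cell_edge m (p + q - m) (m - (q - p) - 2) = e" .
        moreover have "(p + q - m, m - (q - p) - 2) \<in> cells m" using pq False
          by (auto simp: cells_def)
        ultimately show ?thesis by force
      qed
    qed
  qed
qed

definition contact :: "nat \<Rightarrow> nat set set \<Rightarrow> nat \<Rightarrow> nat \<Rightarrow> bool" where
  "contact m T t i \<longleftrightarrow> cell_edge m t i \<in> T"

section \<open>2-triangulations as reduced networks\<close>

lemma chain3: "strict_chain D 3 u w \<longleftrightarrow> (\<exists>u1 u2 u3 w1 w2 w3. u1 < u2 \<and> u2 < u3 \<and> u3 < u \<and>
    w1 < w2 \<and> w2 < w3 \<and> w3 < w \<and> D u1 w1 \<and> D u2 w2 \<and> D u3 w3)"
proof
  assume "strict_chain D 3 u w"
  then obtain u3 w3 where 3: "u3 < u" "w3 < w" "D u3 w3" "strict_chain D (Suc (Suc 0)) u3 w3"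
    unfolding numeral_3_eq_3 strict_chain.simps(2)[of D "Suc (Suc 0)"] by blast
  then obtain u2 w2 where 2: "u2 < u3" "w2 < w3" "D u2 w2" "strict_chain D (Suc 0) u2 w2"
    unfolding strict_chain.simps(2)[of D "Suc 0"] by blast
  then obtain u1 w1 where "u1 < u2" "w1 < w2" "D u1 w1" by auto
  thus "\<exists>u1 u2 u3 w1 w2 w3. u1 < u2 \<and> u2 < u3 \<and> u3 < u \<and>
      w1 < w2 \<and> w2 < w3 \<and> w3 < w \<and> D u1 w1 \<and> D u2 w2 \<and> D u3 w3"
    using 2 3 by metis
next
  assume "\<exists>u1 u2 u3 w1 w2 w3. u1 < u2 \<and> u2 < u3 \<and> u3 < u \<and>
      w1 < w2 \<and> w2 < w3 \<and> w3 < w \<and> D u1 w1 \<and> D u2 w2 \<and> D u3 w3"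
  then obtain u1 u2 u3 w1 w2 w3 where uw: "u1 < u2" "u2 < u3" "u3 < u"
      "w1 < w2" "w2 < w3" "w3 < w" and D: "D u1 w1" "D u2 w2" "D u3 w3" by metis
  have "strict_chain D (Suc 0) u2 w2" using uw D by auto
  hence "strict_chain D (Suc (Suc 0)) u3 w3" using uw D strict_chain.simps(2)[of D "Suc 0" u3 w3] by blast
  thus "strict_chain D 3 u w"
    using uw D strict_chain.simps(2)[of D "Suc (Suc 0)" u w] unfolding numeral_3_eq_3 by blast
qed

text \<open>Up to translation the cone coordinates are the two endpoints of the edge. This turns
  strict chains of contacts into mutually crossing edges.\<close>

lemma cone_cell:
  assumes "u \<le> j + w"
  shows "cell_edge m (j mod 2 + u + w) (j + w - u) =
    edge m (int u - int (j div 2) - 1) (int w + int ((j + 1) div 2) + 1)"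
proof -
  let ?s = "int (j mod 2)" 
  have e: "int (j + w - u) = int j + int w - int u" using assms by simp
  have j: "int j = 2 * int (j div 2) + ?s" by presburger
  have j': "int ((j + 1) div 2) = int (j div 2) + ?s" by presburger
  have "(int (j mod 2 + u + w) - int (j + w - u) - 2) div 2 = int u - int (j div 2) - 1"
    unfolding e using j by simp
  moreover have "(int (j mod 2 + u + w) + int (j + w - u) + 2) div 2 = int w + int ((j + 1) div 2) + 1"
    unfolding e using j j' by simp
  ultimately show ?thesis by (simp only: cell_edge_def)
qed

text \<open>An edge with endpoint sum at least \<open>m\<close> is replaced by its glided lift. The
  sums increase along the triple, so the replaced edges are the last ones and become the first; the
  cases count them.\<close>

lemma crossing_lift:
  assumes p: "p0 < p1" "p1 < p2" "p2 < p3" "p3 < p4" "p4 < p5" "p5 < m"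
    and T: "{p0, p3} \<in> T" "{p1, p4} \<in> T" "{p2, p5} \<in> T"
  obtains a1 a2 a3 b1 b2 b3 where "a1 < a2" "a2 < a3" "a3 < b1" "b1 < b2" "b2 < b3"
    "b3 < a1 + int m" "0 \<le> a1 + b1" "a3 + b3 < int m"
    "edge m a1 b1 \<in> T" "edge m a2 b2 \<in> T" "edge m a3 b3 \<in> T"
proof -
  have e: "edge m (int p0) (int p3) \<in> T" "edge m (int p1) (int p4) \<in> T" "edge m (int p2) (int p5) \<in> T"
    using p T by (simp_all add: edge_nat)
  have g: "edge m (b - int m) a = edge m a b" for a b
    using edge_glide[of m a "b - int m"] by simp
  consider "p2 + p5 < m" | "p1 + p4 < m" "m \<le> p2 + p5" | "p0 + p3 < m" "m \<le> p1 + p4" | "m \<le> p0 + p3"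
    by linarith
  thus ?thesis
  proof cases
    case 1
    thus ?thesis using that[of "int p0" "int p1" "int p2" "int p3" "int p4" "int p5"] p e by simp
  next
    case 2
    thus ?thesis using that[of "int p5 - int m" "int p0" "int p1" "int p2" "int p3" "int p4"] p e g
      by simp
  next
    case 3
    thus ?thesis
      using that[of "int p4 - int m" "int p5 - int m" "int p0" "int p1" "int p2" "int p3"] p e g by simp
  next
    case 4
    thus ?thesis
      using that[of "int p3 - int m" "int p4 - int m" "int p5 - int m" "int p0" "int p1" "int p2"] p e g
      by simp
  qed
qed

text \<open>A cone must be found that contains the lifted triple. The cone of \<open>j\<close> has
  its apex at endpoints \<open>(a0, b0)\<close> with \<open>a0 + b0 = j mod 2\<close> and
  \<open>b0 - a0 = j + 2\<close>; its far end is \<open>(b0, a0 + m)\<close>.\<close>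

lemma corner:
  fixes a1 :: int
  assumes "a1 < a2" "a2 < a3" "a3 < b1" "b1 < b2" "b2 < b3" "b3 < a1 + m" "0 \<le> a1 + b1" "a3 + b3 < m"
  obtains j where "0 \<le> j" "j + 4 \<le> m" "- (j div 2) - 1 \<le> a1" "(j + 1) div 2 + 1 \<le> b1"
    "a3 < (j + 1) div 2 + 1" "b3 < m - (j div 2) - 1"
proof -
  \<comment> \<open>The apex may not be later than the first edge, which forces \<open>s = 0\<close>
    if that edge has time 0. Otherwise \<open>s = 1\<close> makes room for a last edge at time
    \<open>m - 1\<close>. Then \<open>a0\<close> is the least value with \<open>b3 < a0 + m\<close>
    and \<open>b0\<close> at most \<open>b1\<close>.\<close>
  define s where "s = (if a1 + b1 = 0 then 0 else 1 :: int)"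
  define a0 where "a0 = max (b3 - m + 1) (s - b1)"
  define b0 where "b0 = s - a0"
  have h: "a0 \<le> a1" "b0 \<le> b1" "a3 < b0" "b3 < a0 + m" "a0 + b0 = s" "s = 0 \<or> s = 1"
    using assms unfolding a0_def b0_def s_def by auto
  have "- ((b0 - a0 - 2) div 2) - 1 = a0" "(b0 - a0 - 2 + 1) div 2 + 1 = b0"
    using h(5,6) by presburger+
  moreover have "0 \<le> b0 - a0 - 2" "b0 - a0 - 2 + 4 \<le> m" using h assms by linarith+
  ultimately show ?thesis using that[of "b0 - a0 - 2"] h by simp
qed

text \<open>The bounds \<open>j + 2\<close> and \<open>m - 4 - j + 2\<close> say exactly that in a
  chain all first endpoints precede all second ones and everything fits into one period.\<close>

lemma no_3_crossing_iff_no_chain: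
  assumes T: "T \<subseteq> edges m" and m: "m \<ge> 4"
  shows "no_3_crossing m T \<longleftrightarrow>
    (\<forall>j\<le>m - 4. \<not> strict_chain (cone_contact (m - 4) (contact m T) j) 3 (j + 2) (m - 4 - j + 2))"
proof
  assume n: "no_3_crossing m T"
  show "\<forall>j\<le>m - 4. \<not> strict_chain (cone_contact (m - 4) (contact m T) j) 3 (j + 2) (m - 4 - j + 2)"
  proof (intro allI impI notI)
    fix j assume j: "j \<le> m - 4" and "strict_chain (cone_contact (m - 4) (contact m T) j) 3 (j + 2) (m - 4 - j + 2)"
    then obtain u1 u2 u3 w1 w2 w3 where u: "u1 < u2" "u2 < u3" "u3 < j + 2"
      "w1 < w2" "w2 < w3" "w3 < m - 4 - j + 2"
      and c: "cone_contact (m - 4) (contact m T) j u1 w1" "cone_contact (m - 4) (contact m T) j u2 w2"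
        "cone_contact (m - 4) (contact m T) j u3 w3"
      unfolding chain3 by blast
    define a where "a u = int u - int (j div 2) - 1" for u
    define b where "b w = int w + int ((j + 1) div 2) + 1" for w
    have e: "edge m (a u) (b w) \<in> T" if "cone_contact (m - 4) (contact m T) j u w" for u w
      using that cone_cell[of u j w m] by (simp add: cone_contact_def contact_def a_def b_def)
    have "int j + 1 = int (j div 2) + int ((j + 1) div 2) + 1" by presburger
    moreover have "int (m - 4 - j) = int m - 4 - int j" using m j by simp
    ultimately have o: "a u1 < a u2" "a u2 < a u3" "a u3 < b w1" "b w1 < b w2" "b w2 < b w3"
      "b w3 < a u1 + int m"
      using u unfolding a_def b_def by linarith+
    have "cross m (edge m (a u1) (b w1)) (edge m (a u2) (b w2))"
      "cross m (edge m (a u1) (b w1)) (edge m (a u3) (b w3))"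
      "cross m (edge m (a u2) (b w2)) (edge m (a u3) (b w3))"
      "edge m (a u1) (b w1) \<noteq> edge m (a u2) (b w2)"
      "edge m (a u1) (b w1) \<noteq> edge m (a u3) (b w3)"
      "edge m (a u2) (b w2) \<noteq> edge m (a u3) (b w3)"
      by (rule edge_cross; use o in linarith)+
    thus False using n e c unfolding no_3_crossing_def by blast
  qed
next
  assume nc: "\<forall>j\<le>m - 4. \<not> strict_chain (cone_contact (m - 4) (contact m T) j) 3 (j + 2) (m - 4 - j + 2)"
  show "no_3_crossing m T"
    unfolding no_3_crossing_iff[OF T]
  proof (rule notI, elim exE conjE)
    fix p0 p1 p2 p3 p4 p5
    assume "p0 < p1" "p1 < p2" "p2 < p3" "p3 < p4" "p4 < p5" "p5 < m"
      "{p0, p3} \<in> T" "{p1, p4} \<in> T" "{p2, p5} \<in> T"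
    then obtain a1 a2 a3 b1 b2 b3 where ab: "a1 < a2" "a2 < a3" "a3 < b1" "b1 < b2" "b2 < b3"
      "b3 < a1 + int m" "0 \<le> a1 + b1" "a3 + b3 < int m"
      and e: "edge m a1 b1 \<in> T" "edge m a2 b2 \<in> T" "edge m a3 b3 \<in> T"
      by (rule crossing_lift)
    from corner[OF ab] obtain j' where j': "0 \<le> j'" "j' + 4 \<le> int m" "- (j' div 2) - 1 \<le> a1"
      "(j' + 1) div 2 + 1 \<le> b1" "a3 < (j' + 1) div 2 + 1" "b3 < int m - (j' div 2) - 1" .
    define j where "j = nat j'"
    have [simp]: "int j = j'" using j' by (simp add: j_def)
    have jd: "int (j div 2) = j' div 2" "int ((j + 1) div 2) = (j' + 1) div 2"
      by (simp_all add: zdiv_int)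
    have jj: "j' = j' div 2 + (j' + 1) div 2" by presburger
    define u where "u a = nat (a + j' div 2 + 1)" for a :: int
    define w where "w b = nat (b - (j' + 1) div 2 - 1)" for b :: int
    have iu: "int (u a) = a + j' div 2 + 1" if "a1 \<le> a" for a
      using that j' unfolding u_def by simp
    have iw: "int (w b) = b - (j' + 1) div 2 - 1" if "b1 \<le> b" for b
      using that j' unfolding w_def by simp
    have c: "cone_contact (m - 4) (contact m T) j (u a) (w b)"
      if "edge m a b \<in> T" "a1 \<le> a" "b1 \<le> b" "a + 2 \<le> b" "b + 2 \<le> a + int m" for a b
    proof -
      have "u a \<le> j + w b" using iu[of a] iw[of b] that jj \<open>int j = j'\<close> by linarith
      moreover have "j + w b \<le> m - 4 + u a" using iu[of a] iw[of b] that jj m \<open>int j = j'\<close> by linarith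
      moreover have "edge m (int (u a) - int (j div 2) - 1) (int (w b) + int ((j + 1) div 2) + 1) =
          edge m a b"
        unfolding jd using iu[of a] iw[of b] that by simp
      ultimately show ?thesis using that cone_cell[of "u a" j "w b" m]
        by (simp add: cone_contact_def contact_def)
    qed
    have "strict_chain (cone_contact (m - 4) (contact m T) j) 3 (j + 2) (m - 4 - j + 2)"
      unfolding chain3
    proof (intro exI conjI)
      show "cone_contact (m - 4) (contact m T) j (u a1) (w b1)" by (rule c) (use e ab in linarith)+
      show "cone_contact (m - 4) (contact m T) j (u a2) (w b2)" by (rule c) (use e ab in linarith)+
      show "cone_contact (m - 4) (contact m T) j (u a3) (w b3)" by (rule c) (use e ab in linarith)+
      note k = iu[of a1] iu[of a2] iu[of a3] iw[of b1] iw[of b2] iw[of b3] \<open>int j = j'\<close> jj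
      show "u a1 < u a2" "u a2 < u a3" "u a3 < j + 2" "w b1 < w b2" "w b2 < w b3"
        using k ab j' by linarith+
      show "w b3 < m - 4 - j + 2" using k ab j' m by linarith
    qed
    moreover have "j \<le> m - 4" using j' m \<open>int j = j'\<close> by linarith
    ultimately show False using nc by blast
  qed
qed

section \<open>Maximality versus reducedness\<close>

definition short_edges :: "nat \<Rightarrow> nat set set" where
  "short_edges m = {e \<in> edges m. edge_length m e = 2}"

text \<open>An edge of a 3-crossing has two endpoints of the other edges strictly on either side,
  hence length at least 3.\<close>

lemma no_3_crossing_short:
  assumes T: "T \<subseteq> edges m" and n: "no_3_crossing m T"
  shows "no_3_crossing m (T \<union> short_edges m)"
proof -
  have T': "T \<union> short_edges m \<subseteq> edges m" using T by (auto simp: short_edges_def)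
  have *: "{p, q} \<in> T" if "{p, q} \<in> T \<union> short_edges m" "p + 3 \<le> q" "q + 3 \<le> p + m" for p q
  proof -
    have "Max {p, q} - Min {p, q} = q - p" using that by simp
    hence "edge_length m {p, q} \<noteq> 2" using that by (auto simp: edge_length_def min_def)
    thus ?thesis using that by (auto simp: short_edges_def)
  qed
  show ?thesis
    unfolding no_3_crossing_iff[OF T']
  proof (rule notI, elim exE conjE)
    fix p0 p1 p2 p3 p4 p5
    assume p: "p0 < p1" "p1 < p2" "p2 < p3" "p3 < p4" "p4 < p5" "p5 < m"
      and e: "{p0, p3} \<in> T \<union> short_edges m" "{p1, p4} \<in> T \<union> short_edges m"
        "{p2, p5} \<in> T \<union> short_edges m"
    have "{p0, p3} \<in> T" by (rule *[OF e(1)]) (use p in linarith)+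
    moreover have "{p1, p4} \<in> T" by (rule *[OF e(2)]) (use p in linarith)+
    moreover have "{p2, p5} \<in> T" by (rule *[OF e(3)]) (use p in linarith)+
    ultimately show False using n p unfolding no_3_crossing_iff[OF T] by metis
  qed
qed

lemma two_triangulation_short:
  assumes "two_triangulation m T"
  shows "short_edges m \<subseteq> T"
proof -
  have "T \<subseteq> edges m" "no_3_crossing m T" using assms by (auto simp: two_triangulation_def)
  from no_3_crossing_short[OF this] have "T \<union> short_edges m = T"
    using assms unfolding two_triangulation_def by (auto simp: short_edges_def)
  thus ?thesis by blast
qed

lemma contact_boundary:
  assumes "short_edges m \<subseteq> T" "m \<ge> 4"
  shows "even t \<Longrightarrow> contact m T t 0" "even (t + (m - 4)) \<Longrightarrow> contact m T t (m - 4)"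
proof -
  show "even t \<Longrightarrow> contact m T t 0"
    using assms edge_length_cell[of t 0 m] by (auto simp: contact_def short_edges_def)
  show "even (t + (m - 4)) \<Longrightarrow> contact m T t (m - 4)"
    using assms edge_length_cell[of t "m - 4" m] by (auto simp: contact_def short_edges_def)
qed

lemma contact_image:
  assumes "S \<subseteq> cells m" "(t, i) \<in> cells m"
  shows "contact m ((\<lambda>(t, i). cell_edge m t i) ` S) t i \<longleftrightarrow> (t, i) \<in> S"
proof
  assume "contact m ((\<lambda>(t, i). cell_edge m t i) ` S) t i"
  then obtain x where "x \<in> S" "(\<lambda>(t, i). cell_edge m t i) x = (\<lambda>(t, i). cell_edge m t i) (t, i)"
    by (auto simp: contact_def)
  moreover have "x \<in> cells m" using \<open>x \<in> S\<close> assms by blast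
  ultimately show "(t, i) \<in> S"
    using inj_onD[OF bij_betw_imp_inj_on[OF cells_bij[of m]], of x "(t, i)"] assms by simp
qed (force simp: contact_def)

lemma edges_eqI:
  assumes "T \<subseteq> edges m" "T' \<subseteq> edges m"
    and "\<And>t i. (t, i) \<in> cells m \<Longrightarrow> contact m T t i \<longleftrightarrow> contact m T' t i"
  shows "T = T'"
proof -
  have "e \<in> T \<longleftrightarrow> e \<in> T'" if "e \<in> edges m" for e
  proof -
    have "e \<in> (\<lambda>(t, i). cell_edge m t i) ` cells m" using cells_bij[of m] that by (simp add: bij_betw_def)
    then obtain t i where "(t, i) \<in> cells m" "e = cell_edge m t i" by auto
    thus ?thesis using assms(3)[of t i] by (simp add: contact_def)
  qed
  thus ?thesis using assms(1,2) by blast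
qed

text \<open>Each comparator of \<open>T\<close> that meets an inverted pair is made a contact. This
  adds edges but does not alter the sorting run, so the larger set \<open>T'\<close> still has no
  3-crossing. By maximality nothing was added: no comparator met an inverted pair.\<close>

theorem two_triangulation_network:
  assumes T: "two_triangulation m T" and m: "m \<ge> 4"
  shows "reversing (m - 4) (strand (m - 4) (contact m T) m)" "reduced (m - 4) (contact m T) m"
proof -
  define N where "N = m - 4"
  have mN: "N + 4 = m" using m by (simp add: N_def)
  define C where "C = contact m T"
  define D where "D = completion N C"
  have TE: "T \<subseteq> edges m" and n: "no_3_crossing m T" using T by (auto simp: two_triangulation_def)
  note bd = contact_boundary[OF two_triangulation_short[OF T] m]
  have rev: "reversing N (strand N D m)"
    using sorts_iff_no_chain[of C N] bd n no_3_crossing_iff_no_chain[OF TE m]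
    by (simp add: D_def C_def mN flip: N_def)
  have redD: "reduced N D m" unfolding D_def by (rule reduced_completion)
  define S where "S = {(t, i) \<in> cells m. D t i}"
  define T' where "T' = (\<lambda>(t, i). cell_edge m t i) ` S"
  have cT': "contact m T' t i \<longleftrightarrow> D t i" if "(t, i) \<in> cells m" for t i
    unfolding T'_def using contact_image[of S m t i] that by (auto simp: S_def)
  have sub: "C t i \<Longrightarrow> D t i" for t i using completion_iff by (auto simp: D_def)
  have T'E: "T' \<subseteq> edges m" using cells_bij[of m] by (auto simp: T'_def S_def bij_betw_def)
  have TT': "T \<subseteq> T'"
  proof
    fix e assume e: "e \<in> T"
    hence "e \<in> (\<lambda>(t, i). cell_edge m t i) ` cells m" using TE cells_bij[of m] by (auto simp: bij_betw_def)
    then obtain t i where ti: "(t, i) \<in> cells m" "e = cell_edge m t i" by auto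
    hence "D t i" using e sub by (auto simp: C_def contact_def)
    thus "e \<in> T'" using ti by (force simp: T'_def S_def)
  qed
  have act: "active N (contact m T' t) t i = active N (D t) t i" if "t < m" for t i
    using cT'[of t i] that mN by (auto simp: active_def cells_def)
  have str: "strand N (contact m T') t x = strand N D t x" if "t \<le> m" for t x
    by (rule strand_cong) (use act that in auto)
  have red': "reduced N (contact m T') m"
  proof -
    have "strand N (contact m T') t = strand N D t" if "t < m" for t using str that by auto
    thus ?thesis using redD act by (simp add: reduced_def)
  qed
  have "strand N (completion N (contact m T')) m x = strand N D m x" for x
    using strand_completion_reduced[OF red'] str by simp
  hence "reversing N (strand N (completion N (contact m T')) (N + 4))"
    using rev by (simp add: reversing_def mN)
  hence "no_3_crossing m T'"
    using sorts_iff_no_chain[of "contact m T'" N] contact_boundary[of m T'] m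
      two_triangulation_short[OF T] TT' no_3_crossing_iff_no_chain[OF T'E m]
    by (simp flip: N_def)
  hence "T' = T" using T TT' T'E unfolding two_triangulation_def by blast
  hence "strand N C t x = strand N D t x" if "t \<le> m" for t x using str that by (simp add: C_def)
  thus "reversing (m - 4) (strand (m - 4) (contact m T) m)"
    using rev by (simp add: reversing_def N_def C_def)
  show "reduced (m - 4) (contact m T) m" using red' \<open>T' = T\<close> by (simp add: N_def)
qed

lemma crossings_contact:
  assumes "m \<ge> 4"
  shows "crossings (m - 4) (contact m T) m =
    {(t, i) \<in> cells m. 0 < i \<and> i < m - 4 \<and> \<not> contact m T t i}"
  using assms by (auto simp: crossings_def active_def cells_def)

lemma finite_edges: "finite (edges m)"
  by (rule finite_subset[of _ "Pow {..<m}"]) (auto simp: edges_def)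

text \<open>By the count the network is reduced, hence it is its own completion and \<open>T\<close>
  has no 3-crossing. For maximality, a larger set is extended to a 2-triangulation \<open>M\<close>;
  its crossings are among those of \<open>T\<close> and again number
  \<open>N choose 2\<close>.\<close>

theorem two_triangulationI:
  assumes TE: "T \<subseteq> edges m" and m: "m \<ge> 4" and sh: "short_edges m \<subseteq> T"
    and rev: "reversing (m - 4) (strand (m - 4) (contact m T) m)"
    and card: "card (crossings (m - 4) (contact m T) m) = (m - 4) choose 2"
  shows "two_triangulation m T"
proof -
  define N where "N = m - 4"
  have mN: "N + 4 = m" using m by (simp add: N_def)
  note bd = contact_boundary[OF sh m]
  have red: "reduced N (contact m T) m" using reduced_if_card rev card by (simp add: N_def)
  have "reversing N (strand N (completion N (contact m T)) (N + 4))"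
    using rev strand_completion_reduced[OF red] by (simp add: reversing_def mN flip: N_def)
  hence n: "no_3_crossing m T"
    using sorts_iff_no_chain[of "contact m T" N] bd no_3_crossing_iff_no_chain[OF TE m]
    by (simp flip: N_def)
  have "T' = T" if T': "T \<subseteq> T'" "T' \<subseteq> edges m" "no_3_crossing m T'" for T'
  proof -
    let ?F = "{X. X \<subseteq> edges m \<and> no_3_crossing m X}"
    have "finite ?F" by (rule finite_subset[of _ "Pow (edges m)"]) (auto simp: finite_edges)
    then obtain M where M: "M \<in> ?F" "T' \<subseteq> M" "\<forall>X\<in>?F. M \<subseteq> X \<longrightarrow> M = X"
      using finite_has_maximal2[of ?F T'] T' by auto
    have tM: "two_triangulation m M" using M unfolding two_triangulation_def by blast
    have "card (crossings (m - 4) (contact m M) m) = (m - 4) choose 2"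
      using two_triangulation_network[OF tM m] by (rule card_crossings)
    moreover have "crossings (m - 4) (contact m M) m \<subseteq> crossings (m - 4) (contact m T) m"
      using M T' unfolding crossings_contact[OF m] by (auto simp: contact_def)
    ultimately have eq: "crossings (m - 4) (contact m M) m = crossings (m - 4) (contact m T) m"
      using card finite_crossings card_subset_eq by metis
    have "M = T"
    proof (rule edges_eqI)
      show "M \<subseteq> edges m" "T \<subseteq> edges m" using M TE by auto
      fix t i assume ti: "(t, i) \<in> cells m"
      show "contact m M t i \<longleftrightarrow> contact m T t i"
      proof (cases "0 < i \<and> i < m - 4")
        case True
        hence "(t, i) \<in> crossings (m - 4) (contact m M) m \<longleftrightarrow> \<not> contact m M t i"
          "(t, i) \<in> crossings (m - 4) (contact m T) m \<longleftrightarrow> \<not> contact m T t i"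
          using ti unfolding crossings_contact[OF m] by auto
        thus ?thesis using eq by simp
      next
        case False
        hence "i = 0 \<or> i = m - 4" using ti m by (auto simp: cells_def)
        moreover have "even (t + i)" using ti by (simp add: cells_def)
        ultimately have "contact m T t i" "contact m M t i"
          using bd contact_boundary[OF two_triangulation_short[OF tM] m] by (metis add.right_neutral)+
        thus ?thesis by simp
      qed
    qed
    thus ?thesis using M T' by auto
  qed
  thus ?thesis using TE n unfolding two_triangulation_def by blast
qed

section \<open>Square roots of the reversal\<close>

definition rv :: "nat \<Rightarrow> nat \<Rightarrow> nat" where
  "rv N x = (if x < N then N - 1 - x else x)"

lemma rv_rv [simp]: "rv N (rv N x) = x"
  by (auto simp: rv_def)

lemma rv_less [simp]: "rv N x < N \<longleftrightarrow> x < N"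
  by (auto simp: rv_def)

lemma rv_inj [simp]: "rv N x = rv N y \<longleftrightarrow> x = y"
  by (metis rv_rv)

lemma rv_mono: "x < N \<Longrightarrow> y < N \<Longrightarrow> rv N x < rv N y \<longleftrightarrow> y < x"
  by (auto simp: rv_def)

lemma rv_neq: "even N \<Longrightarrow> x < N \<Longrightarrow> rv N x \<noteq> x"
  unfolding rv_def by presburger

lemma strand_idem: "x \<ge> N \<Longrightarrow> strand N C t x = x"
  by (induction t) (simp_all add: layer_idem)

lemma reversing_iff: "reversing N (strand N C t) \<longleftrightarrow> (\<forall>x. strand N C t x = rv N x)"
  by (auto simp: reversing_def rv_def strand_idem)

text \<open>The transposition of \<open>x\<close> and \<open>y\<close> together with its mirror
  image; for \<open>y = rv N x\<close> both coincide. This is the effect on labels of changing a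
  cell and its mirror cell.\<close>

definition dswap :: "nat \<Rightarrow> nat \<Rightarrow> nat \<Rightarrow> nat \<Rightarrow> nat" where
  "dswap N x y z = (if z = x then y else if z = y then x
    else if z = rv N x then rv N y else if z = rv N y then rv N x else z)"

lemma dswap_dswap:
  assumes "rv N x \<noteq> x" "rv N y \<noteq> y"
  shows "dswap N x y (dswap N x y z) = z"
  using assms unfolding dswap_def by (smt (verit, best) rv_rv)

lemma dswap_rv:
  assumes "rv N x \<noteq> x" "rv N y \<noteq> y"
  shows "dswap N (rv N x) (rv N y) z = dswap N x y z"
  using assms unfolding dswap_def by (smt (verit, best) rv_rv)

lemma dswap_commute: "dswap N y x z = dswap N x y z"
  unfolding dswap_def by (smt (verit, best) rv_rv)

lemma dswap_left [simp]: "dswap N x y x = y"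
  and dswap_right [simp]: "dswap N x y y = x"
  by (simp_all add: dswap_def)

lemma dswap_rv_left: "rv N x \<noteq> x \<Longrightarrow> rv N y \<noteq> y \<Longrightarrow> dswap N x y (rv N x) = rv N y"
  and dswap_rv_right: "rv N x \<noteq> x \<Longrightarrow> rv N y \<noteq> y \<Longrightarrow> dswap N x y (rv N y) = rv N x"
  using rv_rv by (auto simp: dswap_def)

lemma dswap_other:
  "z \<noteq> x \<Longrightarrow> z \<noteq> y \<Longrightarrow> z \<noteq> rv N x \<Longrightarrow> z \<noteq> rv N y \<Longrightarrow> dswap N x y z = z"
  by (simp add: dswap_def)

lemma dswap_conj:
  assumes "\<And>u v. f u = f v \<longleftrightarrow> u = v" "\<And>u. f (rv N u) = rv N (f u)"
  shows "f (dswap N x y z) = dswap N (f x) (f y) (f z)"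
  unfolding dswap_def by (simp add: assms(1) flip: assms(2))

text \<open>A permutation whose square is the reversal behaves like a complex structure: it acts without
  fixed points on the pairs \<open>{x, rv N x}\<close>.\<close>

locale square_root_of_reversal =
  fixes N :: nat and V :: "nat \<Rightarrow> nat"
  assumes even_N: "even N" and V_V: "\<And>x. V (V x) = rv N x" and V_less: "\<And>x. V x < N \<longleftrightarrow> x < N"
begin

lemma V_inj [simp]: "V x = V y \<longleftrightarrow> x = y"
  by (metis V_V rv_rv)

lemma V_rv [simp]: "V (rv N x) = rv N (V x)"
  by (metis V_V)

lemma rv_fpf: "x < N \<Longrightarrow> rv N x \<noteq> x"
  using rv_neq even_N by blast

lemma V_fpf: "x < N \<Longrightarrow> V x \<noteq> x" "x < N \<Longrightarrow> V x \<noteq> rv N x"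
  using rv_fpf by (metis V_V, metis V_V V_rv rv_rv)

lemma V_dswap: "V (dswap N x y z) = dswap N (V x) (V y) (V z)"
  by (rule dswap_conj) simp_all

text \<open>On the pairs \<open>{x, rv N x}\<close> the map \<open>V\<close> is an involution
  without fixed points, so it cannot preserve a set of three pairs.\<close>

lemma no_three_orbits:
  assumes lt: "x < N" "y < N" "w < N"
    and d: "y \<noteq> x" "y \<noteq> rv N x" "w \<noteq> x" "w \<noteq> rv N x" "w \<noteq> y" "w \<noteq> rv N y"
    and cl: "V x \<in> {x, rv N x, y, rv N y, w, rv N w}" "V y \<in> {x, rv N x, y, rv N y, w, rv N w}"
      "V w \<in> {x, rv N x, y, rv N y, w, rv N w}"
  shows False
proof -
  define q where "q u = {u, rv N u}" for u
  have q: "q u = q v \<longleftrightarrow> u = v \<or> u = rv N v" for u v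
    unfolding q_def by (auto simp: doubleton_eq_iff)
  have qV: "q (V u) = q (V v) \<longleftrightarrow> q u = q v" for u v
    unfolding q by (metis V_inj V_rv)
  have qn: "q (V x) \<noteq> q x" "q (V y) \<noteq> q y" "q (V w) \<noteq> q w" unfolding q using V_fpf lt by blast+
  have qVV: "q (V (V u)) = q u" for u unfolding q V_V by simp
  have qd: "q y \<noteq> q x" "q w \<noteq> q x" "q w \<noteq> q y" unfolding q using d by simp_all
  have qr: "q (rv N u) = q u" for u unfolding q by simp
  have img: "q u \<in> {q x, q y, q w}" if "u \<in> {x, rv N x, y, rv N y, w, rv N w}" for u
    using that by (auto simp: qr)
  have cl': "q (V x) = q y \<or> q (V x) = q w" "q (V y) = q x \<or> q (V y) = q w"
    "q (V w) = q x \<or> q (V w) = q y"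
    using img[OF cl(1)] img[OF cl(2)] img[OF cl(3)] qn by simp_all
  show False
  proof (cases "q (V x) = q y")
    case True
    hence "q (V y) = q x" using qV qVV by metis
    thus False using cl'(3) True qV qd by metis
  next
    case False
    hence w: "q (V x) = q w" using cl' by simp
    hence "q (V w) = q x" using qV qVV by metis
    thus False using cl'(2) w qV qd by metis
  qed
qed

text \<open>Cancelling one \<open>V\<close> from \<open>V f V f = V V\<close> gives
  \<open>f V f = V\<close>, so \<open>V\<close> maps fixed points of \<open>f\<close> to fixed
  points.\<close>

lemma square_root_fixes:
  assumes "\<And>u. V (f (V (f u))) = rv N u"
  shows "f (V (f u)) = V u" "f (V u) = V u \<longleftrightarrow> f u = u"
proof -
  show *: "f (V (f u)) = V u" for u
  proof -
    have "V (f (V (f u))) = V (V u)" using assms V_V by simp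
    thus ?thesis by simp
  qed
  have **: "f (V u) = V u" if "f u = u" for u using *[of u] that by simp
  show "f (V u) = V u \<longleftrightarrow> f u = u"
  proof
    assume "f (V u) = V u"
    hence "f (V (V (V (V u)))) = V (V (V (V u)))" using ** by blast
    thus "f u = u" by (simp add: V_V)
  qed (rule **)
qed

text \<open>This is the case of diameters. The labels moved by the product form a
  \<open>V\<close>-invariant set, so \<open>V x\<close> lies in the pair of \<open>z\<close>, as it
  never lies in its own.\<close>

lemma exchange_short:
  assumes lt: "x < N" "z < N"
    and eq: "\<And>u. V (dswap N x (rv N x) (dswap N z (rv N z)
      (V (dswap N x (rv N x) (dswap N z (rv N z) u))))) = rv N u"
  shows "z = x \<or> z = rv N x \<or> z = V x \<or> z = rv N (V x)"
proof (rule ccontr)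
  assume n: "\<not> ?thesis"
  define f where "f u = dswap N x (rv N x) (dswap N z (rv N z) u)" for u
  have c: "f (V u) = V u \<longleftrightarrow> f u = u" for u
    by (rule square_root_fixes) (use eq in \<open>simp add: f_def\<close>)
  have nz: "x \<noteq> z" "x \<noteq> rv N z" "V x \<noteq> z" "V x \<noteq> rv N z" using n by auto
  have "f x = rv N x" using nz by (simp add: f_def dswap_other)
  hence "f (V x) \<noteq> V x" using c[of x] rv_fpf[OF lt(1)] by simp
  moreover have "f (V x) = V x" using nz V_fpf[OF lt(1)] by (simp add: f_def dswap_other)
  ultimately show False by simp
qed

text \<open>Two exchanges with one pair in common multiply to a permutation that moves precisely the
  three pairs of \<open>x\<close>, \<open>y\<close> and \<open>w\<close>; \<open>V\<close> would
  have to preserve these.\<close>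

lemma exchange_overlap:
  assumes lt: "x < N" "y < N" "w < N"
    and d: "y \<noteq> x" "y \<noteq> rv N x" "w \<noteq> x" "w \<noteq> rv N x" "w \<noteq> y" "w \<noteq> rv N y"
    and eq: "\<And>u. V (dswap N x y (dswap N x w (V (dswap N x y (dswap N x w u))))) = rv N u"
  shows False
proof -
  define f where "f u = dswap N x y (dswap N x w u)" for u
  have c: "f (V u) = V u \<longleftrightarrow> f u = u" for u
    by (rule square_root_fixes) (use eq in \<open>simp add: f_def\<close>)
  have "f x = w" using d by (simp add: f_def dswap_other)
  moreover have "f w = y" by (simp add: f_def)
  moreover have "y \<noteq> rv N w" using d by auto
  hence "f y = x" using d by (simp add: f_def dswap_other)
  ultimately have "f (V x) \<noteq> V x" "f (V y) \<noteq> V y" "f (V w) \<noteq> V w" using c d by simp_all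
  moreover have "u \<in> {x, rv N x, y, rv N y, w, rv N w}" if "f u \<noteq> u" for u
    using that by (cases "u \<in> {x, rv N x, y, rv N y, w, rv N w}") (auto simp: f_def dswap_other)
  ultimately show False using no_three_orbits[OF lt d] by blast
qed

text \<open>The argument depends on how many of the pairs of \<open>z\<close> and \<open>w\<close>
  belong to \<open>x\<close> or \<open>y\<close>. One is impossible by
  \<open>exchange_overlap\<close>. If none does, \<open>f V f = V\<close> carries the exchange of
  \<open>x\<close> and \<open>y\<close> to that of \<open>V x\<close> and \<open>V y\<close>. Two
  leave a direct and a crosswise matching.\<close>

lemma exchange_long:
  assumes lt: "x < N" "y < N" "z < N" "w < N"
    and d: "y \<noteq> x" "y \<noteq> rv N x" "w \<noteq> z" "w \<noteq> rv N z"
    and eq: "\<And>u. V (dswap N x y (dswap N z w (V (dswap N x y (dswap N z w u))))) = rv N u"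
  shows "{z, w} \<in> {{x, y}, {rv N x, rv N y}, {V x, V y}, {rv N (V x), rv N (V y)}}"
proof -
  define f where "f u = dswap N x y (dswap N z w u)" for u
  have fV: "f (V (f u)) = V u" and c: "f (V u) = V u \<longleftrightarrow> f u = u" for u
    by (rule square_root_fixes; use eq in \<open>simp add: f_def\<close>)+
  have ff: "rv N x \<noteq> x" "rv N y \<noteq> y" "rv N z \<noteq> z" "rv N w \<noteq> w" using rv_fpf lt by auto
  have d': "x \<noteq> rv N y" "z \<noteq> rv N w" using d by auto
  let ?A = "{x, rv N x, y, rv N y}" and ?B = "{z, rv N z, w, rv N w}"
  have Vx: "V x \<noteq> x" "V x \<noteq> rv N x" using V_fpf lt by auto
  have out: "u \<in> ?A \<union> ?B" if "f u \<noteq> u" for u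
    using that by (cases "u \<in> ?A \<union> ?B") (auto simp: f_def dswap_other)
  have inA: "V y = rv N x" if "V x = y" using that V_V by blast
  have inA': "V y = x" if "V x = rv N y"
    using that V_V[of x] by (metis V_rv rv_rv)
  \<comment> \<open>Exactly one common pair: taking mirror images and swapping \<open>x\<close> with
    \<open>y\<close> brings it into the form of \<open>exchange_overlap\<close>.\<close>
  have half: False
    if zw: "a \<in> ?A" "b \<notin> ?A" "b < N"
      and eq': "\<And>u. V (dswap N x y (dswap N a b (V (dswap N x y (dswap N a b u))))) = rv N u" for a b
  proof -
    have b: "b \<noteq> x" "b \<noteq> rv N x" "b \<noteq> y" "b \<noteq> rv N y" using zw by auto
    have rb: "rv N b < N" "rv N b \<noteq> x" "rv N b \<noteq> rv N x" "rv N b \<noteq> y" "rv N b \<noteq> rv N y"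
      "rv N b \<noteq> b" using b zw rv_fpf by auto
    have xy: "dswap N x y = dswap N y x" using dswap_commute by blast
    consider "a = x" | "a = rv N x" | "a = y" | "a = rv N y" using zw by auto
    thus False
    proof cases
      case 1
      show False by (rule exchange_overlap[of x y b]) (use lt zw d b eq' 1 in auto)
    next
      case 2
      have "dswap N a b = dswap N x (rv N b)"
        using dswap_rv[of N x "rv N b"] ff rb 2 by auto
      thus False using exchange_overlap[of x y "rv N b"] lt d rb eq' by auto
    next
      case 3
      thus False using exchange_overlap[of y x b] lt zw d d' b eq' xy by auto
    next
      case 4
      have "dswap N a b = dswap N y (rv N b)"
        using dswap_rv[of N y "rv N b"] ff rb 4 by auto
      thus False using exchange_overlap[of y x "rv N b"] lt d d' rb eq' xy by auto
    qed
  qed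
  consider "z \<notin> ?A" "w \<notin> ?A" | "z \<in> ?A" "w \<in> ?A" | "z \<in> ?A" "w \<notin> ?A" | "z \<notin> ?A" "w \<in> ?A"
    by blast
  thus ?thesis
  proof cases
    case 1
    have sx: "dswap N z w u = u" if "u \<in> ?A" for u
      using that 1 by (intro dswap_other) auto
    have fx: "f x = y" "f y = x" "f (rv N x) = rv N y" "f (rv N y) = rv N x"
      unfolding f_def using sx ff by (simp_all add: dswap_rv_left dswap_rv_right)
    have Vxy: "f (V x) = V y" using fV[of y] fx by simp
    have "f (V x) \<noteq> V x" using c[of x] fx d by simp
    hence "V x \<in> ?A \<or> V x \<in> ?B" using out by blast
    thus ?thesis
    proof
      assume "V x \<in> ?A"
      hence "V x = y \<or> V x = rv N y" using Vx by auto
      thus ?thesis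
      proof
        assume "V x = y"
        thus ?thesis using inA Vxy fx ff by simp
      next
        assume "V x = rv N y"
        thus ?thesis using inA' Vxy fx ff by simp
      qed
    next
      assume B: "V x \<in> ?B"
      have "dswap N z w (V x) \<in> ?B" using B ff by (auto simp: dswap_rv_left dswap_rv_right)
      hence "dswap N z w (V x) \<notin> ?A" using 1 by auto
      hence "f (V x) = dswap N z w (V x)" unfolding f_def by (intro dswap_other) auto
      hence "V y = dswap N z w (V x)" using Vxy by simp
      moreover have "V x = z \<or> V x = w \<or> V x = rv N z \<or> V x = rv N w" using B by blast
      ultimately show ?thesis
        using ff by (elim disjE) (simp_all add: dswap_rv_left dswap_rv_right insert_commute)
    qed
  next
    case 2
    hence "{z, w} = {x, y} \<or> {z, w} = {rv N x, rv N y} \<or>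
        {z, w} = {x, rv N y} \<or> {z, w} = {rv N x, y}"
      using d d' ff by auto
    \<comment> \<open>The crosswise matching makes \<open>f\<close> flip pairs, so \<open>V\<close>
      must interchange the pairs of \<open>x\<close> and \<open>y\<close>; then
      \<open>{V x, V y}\<close> is itself crosswise.\<close>
    moreover have ?thesis if zw: "{z, w} = {x, rv N y} \<or> {z, w} = {rv N x, y}"
    proof -
      have "dswap N (rv N x) y x = rv N y"
        using dswap_rv[of N x "rv N y" x] ff by simp
      hence "dswap N z w x = rv N y"
        using zw dswap_commute by (auto simp: doubleton_eq_iff)
      hence "f x = rv N x" using ff by (simp add: f_def dswap_rv_right)
      hence "V x \<in> ?A \<union> ?B" using out c[of x] ff by metis
      moreover have "?B \<subseteq> ?A" using 2 by auto
      ultimately have "V x \<in> ?A" by blast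
      hence "V x = y \<or> V x = rv N y" using Vx by blast
      hence "V x = y \<and> V y = rv N x \<or> V x = rv N y \<and> V y = x" using inA inA' by blast
      thus ?thesis using zw by (elim disjE conjE) (simp_all add: insert_commute)
    qed
    ultimately show ?thesis by (elim disjE) simp_all
  next
    case 3
    show ?thesis by (rule FalseE, rule half[OF 3 lt(4)]) (rule eq)
  next
    case 4
    have sym: "dswap N w z = dswap N z w" using dswap_commute by blast
    show ?thesis by (rule FalseE, rule half[OF 4(2,1) lt(3)]) (unfold sym, rule eq)
  qed
qed

text \<open>The order of the two factors depends on which cell comes first in time. Interchanging
  the roles of the two exchanges is harmless, as \<open>V\<close> and \<open>rv N\<close> carry the
  four alternatives back.\<close>

lemma exchange_unique:
  assumes lt: "x < N" "y < N" "z < N" "w < N"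
    and d: "y \<noteq> x" "w \<noteq> z" "y = rv N x \<longleftrightarrow> w = rv N z"
    and eq: "(\<forall>u. V (dswap N x y (dswap N z w (V (dswap N x y (dswap N z w u))))) = rv N u) \<or>
      (\<forall>u. V (dswap N z w (dswap N x y (V (dswap N z w (dswap N x y u))))) = rv N u)"
  shows "{z, w} \<in> {{x, y}, {rv N x, rv N y}, {V x, V y}, {rv N (V x), rv N (V y)}}"
  using eq
proof
  assume *: "\<forall>u. V (dswap N x y (dswap N z w (V (dswap N x y (dswap N z w u))))) = rv N u"
  show ?thesis
  proof (cases "y = rv N x")
    case True
    hence "z = x \<or> z = rv N x \<or> z = V x \<or> z = rv N (V x)"
      using exchange_short[of x z] lt d * by simp
    thus ?thesis using True d by (elim disjE) simp_all
  next
    case False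
    show ?thesis by (rule exchange_long) (use lt d False * in auto)
  qed
next
  assume *: "\<forall>u. V (dswap N z w (dswap N x y (V (dswap N z w (dswap N x y u))))) = rv N u"
  have "{x, y} \<in> {{z, w}, {rv N z, rv N w}, {V z, V w}, {rv N (V z), rv N (V w)}}"
  proof (cases "y = rv N x")
    case True
    hence "x = z \<or> x = rv N z \<or> x = V z \<or> x = rv N (V z)"
      using exchange_short[of z x] lt d * by simp
    thus ?thesis using True d by (elim disjE) simp_all
  next
    case False
    show ?thesis by (rule exchange_long) (use lt d False * in auto)
  qed
  hence "{x, y} = {z, w} \<or> {x, y} = {rv N z, rv N w} \<or> {x, y} = {V z, V w} \<or>
    {x, y} = {rv N (V z), rv N (V w)}" by simp
  thus ?thesis
  proof (elim disjE)
    assume "{x, y} = {rv N z, rv N w}"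
    hence "rv N ` {x, y} = rv N ` {rv N z, rv N w}" by (rule arg_cong)
    thus ?thesis by simp
  next
    assume "{x, y} = {V z, V w}"
    hence "(\<lambda>u. rv N (V u)) ` {x, y} = (\<lambda>u. rv N (V u)) ` {V z, V w}" by (rule arg_cong)
    thus ?thesis by (simp add: V_V)
  next
    assume "{x, y} = {rv N (V z), rv N (V w)}"
    hence "V ` {x, y} = V ` {rv N (V z), rv N (V w)}" by (rule arg_cong)
    thus ?thesis by (simp add: V_V)
  qed simp
qed

text \<open>Conjugation by \<open>V\<close> interchanges the two exchanges, because conjugation by
  \<open>rv N\<close> fixes each of them. So in the square everything cancels except
  \<open>V V\<close>.\<close>

lemma exchange_exists:
  assumes lt: "x < N" "y < N"
  shows "V (dswap N x y (dswap N (V x) (V y) (V (dswap N x y (dswap N (V x) (V y) u))))) = rv N u"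
    "V (dswap N (V x) (V y) (dswap N x y (V (dswap N (V x) (V y) (dswap N x y u))))) = rv N u"
proof -
  have ff: "rv N x \<noteq> x" "rv N y \<noteq> y" "rv N (V x) \<noteq> V x" "rv N (V y) \<noteq> V y"
    using lt rv_fpf V_less by auto
  note r = dswap_rv[OF ff(1,2)] dswap_rv[OF ff(3,4)]
  show "V (dswap N x y (dswap N (V x) (V y) (V (dswap N x y (dswap N (V x) (V y) u))))) = rv N u"
    "V (dswap N (V x) (V y) (dswap N x y (V (dswap N (V x) (V y) (dswap N x y u))))) = rv N u"
    using ff by (simp_all add: V_dswap V_V r dswap_dswap)
qed

text \<open>For a reduced reversing network these are the pairs that cross in its first
  half.\<close>

definition inverted :: "nat \<Rightarrow> nat \<Rightarrow> bool" where
  "inverted a b \<longleftrightarrow> (a < b) \<noteq> (V a < V b)"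

lemma inverted_rv: "a < N \<Longrightarrow> b < N \<Longrightarrow> inverted (rv N a) (rv N b) \<longleftrightarrow> inverted b a"
  by (simp add: inverted_def rv_mono V_less)

lemma inverted_commute: "inverted a b \<longleftrightarrow> inverted b a"
  unfolding inverted_def using nat_neq_iff[of a b] nat_neq_iff[of "V a" "V b"] by auto

text \<open>\<open>V\<close> applied twice is the reversal, so each pair is inverted in exactly one
  of the two applications.\<close>

lemma inverted_V: "a < N \<Longrightarrow> b < N \<Longrightarrow> a \<noteq> b \<Longrightarrow> inverted (V a) (V b) \<longleftrightarrow> \<not> inverted a b"
  unfolding inverted_def V_V using nat_neq_iff[of a b] by (auto simp: rv_mono)

end

section \<open>Mirror-symmetric networks and toggled cells\<close>

locale mirror_network =
  fixes N :: nat and C :: "nat \<Rightarrow> nat \<Rightarrow> bool"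
  assumes even_N: "even N"
    and C_mirror: "\<And>t i. even (t + i) \<Longrightarrow> i \<le> N \<Longrightarrow> C t (N - i) = C t i"
begin

lemma active_mirror:
  assumes "i \<le> N"
  shows "active N (C t) t (N - i) = active N (C t) t i"
proof (cases "even (t + i)")
  case True
  thus ?thesis using assms C_mirror[of t i] even_N by (auto simp: active_def)
next
  case False
  thus ?thesis using assms even_N by (auto simp: active_def)
qed

lemma layer_rv: "layer N (C t) t (rv N p) = rv N (layer N (C t) t p)"
proof (cases "p < N")
  case True
  have a: "active N (C t) t (rv N p) = active N (C t) t (Suc p)"
    "active N (C t) t (Suc (rv N p)) = active N (C t) t p"
    using active_mirror[of "Suc p" t] active_mirror[of p t] True by (simp_all add: rv_def Suc_diff_Suc)
  have ex: "active N (C t) t p \<Longrightarrow> \<not> active N (C t) t (Suc p)" by (rule active_parity)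
  have b: "active N (C t) t p \<Longrightarrow> 0 < p" "active N (C t) t (Suc p) \<Longrightarrow> Suc p < N"
    by (auto simp: active_def)
  show ?thesis
    unfolding layer_def a using True ex b by (auto simp: rv_def)
next
  case False
  thus ?thesis by (simp add: rv_def layer_idem)
qed

lemma strand_rv: "strand N C t (rv N x) = rv N (strand N C t x)"
  by (induction t) (simp_all add: layer_rv)

text \<open>Changing a cell and its mirror cell composes the layer with an exchange of the adjacent
  wires. Strands commute with \<open>rv N\<close>, so this can be pulled back to an exchange of
  labels at time 0.\<close>

lemma toggle:
  assumes i0: "0 < i0" "i0 < N" "even (t0 + i0)"
    and tog: "\<And>t i. t < L \<Longrightarrow> active N (D t) t i =
      (active N (C t) t i \<noteq> (t = t0 \<and> (i = i0 \<or> i = N - i0)))"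
    and xy: "Suc (strand N C t0 x) = i0" "strand N C t0 y = i0"
  shows "t \<le> L \<Longrightarrow> strand N D t u = (if t \<le> t0 then strand N C t u else strand N C t (dswap N x y u))"
proof (induction t)
  case (Suc t)
  hence t: "t < L" by simp
  show ?case
  proof (cases "t = t0")
    case False
    hence "active N (D t) t i = active N (C t) t i" for i using tog[OF t] by simp
    hence "layer N (D t) t p = layer N (C t) t p" for p by (simp add: layer_def)
    thus ?thesis using Suc False by auto
  next
    case True
    have ev: "even (N - i0 + t0)" using i0 even_N by auto
    have p0: "strand N C t0 x = i0 - 1" using xy by simp
    have "layer N (D t0) t0 p = layer N (C t0) t0 (dswap N (i0 - 1) i0 p)" for p
    proof -
      have r: "rv N (i0 - 1) = N - i0" "rv N i0 = N - i0 - 1" using i0 by (auto simp: rv_def)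
      have T: "active N (D t0) t0 i = (active N (C t0) t0 i \<noteq> (i = i0 \<or> i = N - i0))" for i
        using tog[of t0 i] t True by simp
      have n: "\<not> active N c t0 (i0 - 1)" "\<not> active N c t0 (Suc i0)"
        "\<not> active N c t0 (N - i0 - 1)" "\<not> active N c t0 (Suc (N - i0))" for c
        using i0 ev by (auto simp: active_def)
      have m: "active N (C t0) t0 (N - i0) = active N (C t0) t0 i0" using active_mirror i0 by simp
      have s: "Suc (i0 - 1) = i0" "Suc (N - i0 - 1) = N - i0" "i0 - 1 \<noteq> i0" "N - i0 - 1 \<noteq> N - i0"
        "i0 - 1 \<noteq> N - i0" "N - i0 - 1 \<noteq> i0"
        using i0 even_N by (auto, presburger+)
      have n': "\<not> active N (C t0) t0 (i0 - Suc 0)" "\<not> active N (C t0) t0 (N - Suc i0)"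
        using n[of "C t0"] by simp_all
      consider "p = i0 - 1" | "p = i0" | "p = N - i0" | "p = N - i0 - 1"
        | "p \<notin> {i0 - 1, i0, N - i0, N - i0 - 1}" by blast
      thus ?thesis
      proof cases
        case 1
        show ?thesis unfolding 1 dswap_left unfolding layer_def T using n m s by simp
      next
        case 2
        show ?thesis unfolding 2 dswap_right unfolding layer_def T using n m s by simp
      next
        case 3
        have "dswap N (i0 - 1) i0 (N - i0) = N - i0 - 1"
          using s r by (auto simp: dswap_def)
        thus ?thesis unfolding 3 unfolding layer_def T using n m s by simp
      next
        case 4
        have "dswap N (i0 - 1) i0 (N - i0 - 1) = N - i0"
          using s r by (auto simp: dswap_def)
        thus ?thesis unfolding 4 unfolding layer_def T using n m s by simp
      next
        case 5
        have "Suc p \<noteq> i0" "Suc p \<noteq> N - i0" using 5 by auto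
        thus ?thesis using 5 r by (auto simp: dswap_other layer_def T)
      qed
    qed
    moreover have "dswap N (i0 - 1) i0 (strand N C t0 u) = strand N C t0 (dswap N x y u)"
      using dswap_conj[of "strand N C t0" N x y u] strand_inj strand_rv p0 xy by simp
    ultimately show ?thesis using Suc True by simp
  qed
qed simp

text \<open>The later cell is toggled first: this leaves the strands up to time \<open>t1\<close>
  alone, so \<open>z\<close> and \<open>w\<close> are still the labels found at
  \<open>(t2, i2)\<close> when that cell is toggled.\<close>

lemma two_toggles_ordered:
  assumes i1: "0 < i1" "i1 < N" "even (t1 + i1)" and i2: "0 < i2" "i2 < N" "even (t2 + i2)"
    and tt: "t2 \<le> t1" "t1 < L" and ne: "\<not> (t1 = t2 \<and> (i2 = i1 \<or> i2 = N - i1))"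
    and tog: "\<And>t i. t < L \<Longrightarrow> active N (D t) t i = (active N (C t) t i \<noteq>
      (t = t1 \<and> (i = i1 \<or> i = N - i1) \<or> t = t2 \<and> (i = i2 \<or> i = N - i2)))"
    and xy: "Suc (strand N C t1 x) = i1" "strand N C t1 y = i1"
    and zw: "Suc (strand N C t2 z) = i2" "strand N C t2 w = i2"
  shows "strand N D L u = strand N C L (dswap N x y (dswap N z w u))"
proof -
  define D1 where "D1 t i = (C t i \<noteq> (t = t1 \<and> (i = i1 \<or> i = N - i1)))" for t i
  have ev: "even (t1 + (N - i1))" "even (t2 + (N - i2))" using i1 i2 even_N by auto
  have D1: "active N (D1 t) t i = (active N (C t) t i \<noteq> (t = t1 \<and> (i = i1 \<or> i = N - i1)))" for t i
    using i1 ev by (auto simp: active_def D1_def)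
  have S1: "strand N D1 t u = (if t \<le> t1 then strand N C t u else strand N C t (dswap N x y u))"
    if "t \<le> L" for t u
    by (rule toggle[OF i1 _ xy that]) (rule D1)
  interpret D: mirror_network N D1
  proof
    show "D1 t (N - i) = D1 t i" if "even (t + i)" "i \<le> N" for t i
      using C_mirror[OF that] that i1 by (auto simp: D1_def)
  qed (rule even_N)
  have "strand N D L u = (if L \<le> t2 then strand N D1 L u else strand N D1 L (dswap N z w u))"
  proof (rule D.toggle[OF i2])
    show "active N (D t) t i = (active N (D1 t) t i \<noteq> (t = t2 \<and> (i = i2 \<or> i = N - i2)))"
      if "t < L" for t i
    proof -
      have "N - i1 = N - i2 \<longleftrightarrow> i1 = i2" "N - i1 = i2 \<longleftrightarrow> i1 = N - i2" using i1 i2 by auto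
      thus ?thesis using tog[OF that, of i] D1[of t i] ne by auto
    qed
    show "Suc (strand N D1 t2 z) = i2" "strand N D1 t2 w = i2"
      using zw S1 tt by simp_all
  qed simp
  thus ?thesis using tt S1 by simp
qed

lemma two_toggles:
  assumes i1: "0 < i1" "i1 < N" "even (t1 + i1)" and i2: "0 < i2" "i2 < N" "even (t2 + i2)"
    and tt: "t1 < L" "t2 < L" and ne: "\<not> (t1 = t2 \<and> (i2 = i1 \<or> i2 = N - i1))"
    and tog: "\<And>t i. t < L \<Longrightarrow> active N (D t) t i = (active N (C t) t i \<noteq>
      (t = t1 \<and> (i = i1 \<or> i = N - i1) \<or> t = t2 \<and> (i = i2 \<or> i = N - i2)))"
    and xy: "Suc (strand N C t1 x) = i1" "strand N C t1 y = i1"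
    and zw: "Suc (strand N C t2 z) = i2" "strand N C t2 w = i2"
  shows "(\<forall>u. strand N D L u = strand N C L (dswap N x y (dswap N z w u))) \<or>
    (\<forall>u. strand N D L u = strand N C L (dswap N z w (dswap N x y u)))"
proof (cases "t2 \<le> t1")
  case True
  thus ?thesis using two_toggles_ordered[OF i1 i2 True tt(1) ne tog xy zw] by blast
next
  case False
  have ne': "\<not> (t2 = t1 \<and> (i1 = i2 \<or> i1 = N - i2))" using False by simp
  have "strand N D L u = strand N C L (dswap N z w (dswap N x y u))" for u
    by (rule two_toggles_ordered[OF i2 i1 _ tt(2) ne' _ zw xy]) (use False tog in auto)
  thus ?thesis by blast
qed

end

text \<open>For a periodic set of edges \<open>L = 2 * n\<close> is a quarter turn. A half turn
  shifts time by \<open>m\<close>, which amounts to mirroring the height; this is the origin of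
  \<open>C_mirror\<close>.\<close>

locale symmetric_network = mirror_network +
  fixes L :: nat
  assumes even_L: "even L"
    and C_period: "\<And>t i. even (t + i) \<Longrightarrow> i \<le> N \<Longrightarrow> C (L + t) i = C t i"
begin

lemma strand_add: "strand N C (L + t) x = strand N C t (strand N C L x)"
proof (induction t)
  case (Suc t)
  have "active N (C (L + t)) (L + t) i = active N (C t) t i" for i
    using C_period[of t i] even_L by (auto simp: active_def)
  hence "layer N (C (L + t)) (L + t) p = layer N (C t) t p" for p by (simp add: layer_def)
  thus ?case using Suc by simp
qed simp

lemma reversing_iff_square:
  "reversing N (strand N C (2 * L)) \<longleftrightarrow> (\<forall>x. strand N C L (strand N C L x) = rv N x)"
  unfolding reversing_iff mult_2 strand_add ..

end

lemma wire_labels: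
  assumes "0 < i" "i < N"
  obtains z w where "Suc (strand N C t z) = i" "strand N C t w = i" "z < N" "w < N" "z \<noteq> w"
proof -
  obtain z w where z: "strand N C t z = i - 1" and w: "strand N C t w = i"
    using strand_surj by metis
  have "strand N C t z < N" "strand N C t w < N" using z w assms by linarith+
  hence "z < N" "w < N" by simp_all
  moreover have "Suc (strand N C t z) = i" using z assms by simp
  moreover from this have "z \<noteq> w" using w by auto
  ultimately show ?thesis using that w by blast
qed

context symmetric_network
begin

definition toggled :: "(nat \<Rightarrow> nat \<Rightarrow> bool) \<Rightarrow> nat \<times> nat \<Rightarrow> nat \<times> nat \<Rightarrow> bool" where
  "toggled D = (\<lambda>(t1, i1) (t2, i2). \<forall>t<L. \<forall>i. active N (D t) t i = (active N (C t) t i \<noteq>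
    (t = t1 \<and> (i = i1 \<or> i = N - i1) \<or> t = t2 \<and> (i = i2 \<or> i = N - i2))))"

lemma middle_iff:
  assumes "0 < i" "i < N" "Suc (strand N C t z) = i" "strand N C t w = i"
  shows "w = rv N z \<longleftrightarrow> 2 * i = N"
proof -
  have "w = rv N z \<longleftrightarrow> strand N C t w = strand N C t (rv N z)" by (simp add: strand_inj)
  also have "\<dots> \<longleftrightarrow> i = rv N (strand N C t z)" by (simp add: assms strand_rv)
  also have "strand N C t z = i - 1" using assms(3) by simp
  also have "i = rv N (i - 1) \<longleftrightarrow> 2 * i = N" using assms(1,2) by (auto simp: rv_def)
  finally show ?thesis .
qed

lemma pair_at_mirror:
  assumes "0 < i" "i < N"
  shows "pair_at N C (t, N - i) = rv N ` pair_at N C (t, i)"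
proof -
  obtain z w where zw: "Suc (strand N C t z) = i" "strand N C t w = i"
    using wire_labels assms by metis
  hence "pair_at N C (t, i) = {z, w}" by (rule pair_at_eqI)
  moreover have "pair_at N C (t, N - i) = {rv N w, rv N z}"
  proof (rule pair_at_eqI)
    have "rv N i = N - i - 1" "rv N (i - 1) = N - i" using assms by (auto simp: rv_def)
    moreover have "strand N C t z = i - 1" using zw by simp
    ultimately show "Suc (strand N C t (rv N w)) = N - i" "strand N C t (rv N z) = N - i"
      unfolding strand_rv zw(2) using assms(2) by simp_all
  qed
  ultimately show ?thesis by auto
qed

context
  assumes rev: "reversing N (strand N C (2 * L))" and red: "reduced N C (2 * L)"
begin

abbreviation "V \<equiv> strand N C L"

interpretation square_root_of_reversal N V
proof
  show "V (V x) = rv N x" for x using rev reversing_iff_square by blast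
qed (rule even_N, rule strand_less)

lemma crossing_inverted:
  assumes "t < L" "active N (C t) t i" "Suc (strand N C t z) = i" "strand N C t w = i"
  shows "inverted z w"
proof -
  have "ordered (strand N C t) i" using red assms unfolding reduced_def by simp
  then obtain x y where "x < y" "Suc (strand N C t x) = i" "strand N C t y = i"
    unfolding ordered_def by blast
  moreover from this have "x = z" "y = w" using assms strand_inj by (metis Suc_inject, metis)
  ultimately have zw: "z < w" by simp
  have "strand N C (Suc t) w < strand N C (Suc t) z"
    using crossing_swaps[OF assms(2-4)] by simp
  hence "V w < V z"
    using reduced_stays_inverted[OF red zw, of "Suc t" L] assms(1) by simp
  thus ?thesis using zw by (simp add: inverted_def)
qed

lemma inverted_crossing:
  assumes "inverted a b" "a \<noteq> b"
  obtains t i z w where "t < L" "active N (C t) t i" "Suc (strand N C t z) = i" "strand N C t w = i"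
    "{z, w} = {a, b}"
proof -
  note result = that
  have *: thesis if ab: "{x, y} = {a, b}" "x < y" "\<not> V x < V y" for x y
  proof -
    have "strand N C 0 x < strand N C 0 y" using ab by simp
    then obtain r where "r < L" "active N (C r) r (strand N C r y)"
      "strand N C r y = Suc (strand N C r x)"
      using first_crossing[of N C 0 x y L] ab by auto
    thus thesis by (intro result[of r "strand N C r y" x y]) (use ab in simp_all)
  qed
  show thesis
  proof (cases "a < b")
    case True
    hence "\<not> V a < V b" using assms by (simp add: inverted_def)
    thus ?thesis by (rule *[OF refl True])
  next
    case False
    hence "b < a" using assms by simp
    moreover have "\<not> V b < V a" using False assms by (simp add: inverted_def)
    ultimately show ?thesis by (rule *[OF insert_commute])
  qed
qed

text \<open>The strands \<open>x\<close> and \<open>y\<close> touch at the contact. Of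
  \<open>{x, y}\<close> and \<open>{V x, V y}\<close> one is inverted by \<open>V\<close>, and
  \<open>(t2, i2)\<close> is where that pair crosses. The condition on \<open>2 * i = N\<close>
  supplies the hypothesis of \<open>exchange_unique\<close> that separates diameters from other
  edges.\<close>

theorem network_exchange:
  assumes t1: "t1 < L" and i1: "0 < i1" "i1 < N" "even (t1 + i1)" and nact: "\<not> active N (C t1) t1 i1"
  obtains t2 i2 where "t2 < L" "active N (C t2) t2 i2" "2 * i2 = N \<longleftrightarrow> 2 * i1 = N"
    "\<forall>D. toggled D (t1, i1) (t2, i2) \<longrightarrow> (\<forall>u. strand N D L (strand N D L u) = rv N u)"
    "\<forall>D t i. toggled D (t1, i1) (t, i) \<and> (\<forall>u. strand N D L (strand N D L u) = rv N u) \<and>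
      t < L \<and> active N (C t) t i \<and> (2 * i = N \<longleftrightarrow> 2 * i1 = N) \<longrightarrow> t = t2 \<and> (i = i2 \<or> i = N - i2)"
proof -
  obtain x y where x: "Suc (strand N C t1 x) = i1" and y: "strand N C t1 y = i1"
    and lt: "x < N" "y < N" and ne: "x \<noteq> y"
    using wire_labels[OF i1(1,2)] .
  define a b where "a = (if inverted x y then x else V x)" and "b = (if inverted x y then y else V y)"
  have ab: "inverted a b" "a \<noteq> b" "a < N" "b < N"
    using lt ne inverted_V[OF lt ne] by (auto simp: a_def b_def)
  obtain t2 i2 z w where t2: "t2 < L" "active N (C t2) t2 i2"
    and z: "Suc (strand N C t2 z) = i2" and w: "strand N C t2 w = i2" and zw: "{z, w} = {a, b}"
    using inverted_crossing[OF ab(1,2)] .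
  have i2: "0 < i2" "i2 < N" "even (t2 + i2)" using t2 by (auto simp: active_def)
  have abm: "b = rv N a \<longleftrightarrow> y = rv N x" by (auto simp: a_def b_def simp flip: V_rv)
  have zwm: "w = rv N z \<longleftrightarrow> b = rv N a" using zw by (auto simp: doubleton_eq_iff)
  show thesis
  proof (rule that[OF t2])
    show "2 * i2 = N \<longleftrightarrow> 2 * i1 = N"
      using middle_iff[OF i1(1,2) x y] middle_iff[OF i2(1,2) z w] abm zwm by simp
    have swap: "dswap N z w = dswap N a b"
      using zw dswap_commute by (auto simp: doubleton_eq_iff)
    show "\<forall>D. toggled D (t1, i1) (t2, i2) \<longrightarrow> (\<forall>u. strand N D L (strand N D L u) = rv N u)"
    proof (rule allI, rule impI)
      fix D assume D: "toggled D (t1, i1) (t2, i2)"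
      have neq: "\<not> (t1 = t2 \<and> (i2 = i1 \<or> i2 = N - i1))"
        using nact t2 active_mirror[of i1 t1] i1 by auto
      have "(\<forall>u. strand N D L u = V (dswap N x y (dswap N z w u))) \<or>
          (\<forall>u. strand N D L u = V (dswap N z w (dswap N x y u)))"
        by (rule two_toggles[OF i1 i2 t1 t2(1) neq _ x y z w]) (use D in \<open>simp add: toggled_def\<close>)
      thus "\<forall>u. strand N D L (strand N D L u) = rv N u"
      \<comment> \<open>If \<open>x\<close> and \<open>y\<close> themselves cross in the first half,
        the two exchanges cancel and \<open>V\<close> is unchanged; otherwise
        \<open>exchange_exists\<close> applies.\<close>
      proof (cases "inverted x y")
        case True
        hence "dswap N z w = dswap N x y" using swap by (simp add: a_def b_def)
        moreover have "dswap N x y (dswap N x y u) = u" for u using dswap_dswap rv_fpf lt by simp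
        ultimately have "strand N D L u = V u" for u
          using \<open>_ \<or> _\<close> by auto
        thus ?thesis using V_V by simp
      next
        case False
        hence "dswap N z w = dswap N (V x) (V y)" using swap by (simp add: a_def b_def)
        thus ?thesis using \<open>_ \<or> _\<close> exchange_exists[OF lt] by auto
      qed
    qed
  next
    show "\<forall>D t i. toggled D (t1, i1) (t, i) \<and> (\<forall>u. strand N D L (strand N D L u) = rv N u) \<and>
      t < L \<and> active N (C t) t i \<and> (2 * i = N \<longleftrightarrow> 2 * i1 = N) \<longrightarrow> t = t2 \<and> (i = i2 \<or> i = N - i2)"
    proof (intro allI impI, elim conjE)
      fix D t i
      assume D: "toggled D (t1, i1) (t, i)" and sq: "\<forall>u. strand N D L (strand N D L u) = rv N u"
        and t: "t < L" and act: "active N (C t) t i" and mid: "2 * i = N \<longleftrightarrow> 2 * i1 = N"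
      have i: "0 < i" "i < N" "even (t + i)" using act by (auto simp: active_def)
      obtain p q where p: "Suc (strand N C t p) = i" and q: "strand N C t q = i"
        and ltp: "p < N" "q < N" and nep: "p \<noteq> q"
        using wire_labels[OF i(1,2)] .
      have neq: "\<not> (t1 = t \<and> (i = i1 \<or> i = N - i1))"
        using nact act active_mirror[of i1 t1] i1 by auto
      have tw: "(\<forall>u. strand N D L u = V (dswap N x y (dswap N p q u))) \<or>
          (\<forall>u. strand N D L u = V (dswap N p q (dswap N x y u)))"
        by (rule two_toggles[OF i1 i t1 t neq _ x y p q]) (use D in \<open>simp add: toggled_def\<close>)
      have eq: "(\<forall>u. V (dswap N x y (dswap N p q (V (dswap N x y (dswap N p q u))))) = rv N u) \<or>
        (\<forall>u. V (dswap N p q (dswap N x y (V (dswap N p q (dswap N x y u))))) = rv N u)"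
        using tw
      proof
        assume *: "\<forall>u. strand N D L u = V (dswap N x y (dswap N p q u))"
        show ?thesis using sq unfolding *[rule_format] by blast
      next
        assume *: "\<forall>u. strand N D L u = V (dswap N p q (dswap N x y u))"
        show ?thesis using sq unfolding *[rule_format] by blast
      qed
      have m: "y = rv N x \<longleftrightarrow> q = rv N p"
        using mid middle_iff[OF i1(1,2) x y] middle_iff[OF i(1,2) p q] by simp
      have "{p, q} \<in> {{x, y}, {rv N x, rv N y}, {V x, V y}, {rv N (V x), rv N (V y)}}"
        by (rule exchange_unique[OF lt ltp _ _ m eq]) (use ne nep in auto)
      hence or: "{p, q} = {x, y} \<or> {p, q} = {rv N x, rv N y} \<or> {p, q} = {V x, V y} \<or>
          {p, q} = {rv N (V x), rv N (V y)}" by simp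
      have inv: "inverted p q" by (rule crossing_inverted[OF t act p q])
      have Vlt: "V x < N" "V y < N" using lt by simp_all
      have *: "inverted c d" if "{p, q} = {c, d}" for c d
        using inv inverted_commute that by (auto simp: doubleton_eq_iff)
      \<comment> \<open>As \<open>p\<close> and \<open>q\<close> cross in the first half,
        \<open>inverted_V\<close> rules out two of the four alternatives.\<close>
      have "{p, q} = {a, b} \<or> {p, q} = {rv N a, rv N b}"
      proof (cases "inverted x y")
        case True
        have "{p, q} \<noteq> {V x, V y}" using *[of "V x" "V y"] inverted_V[OF lt ne] True by blast
        moreover have "{p, q} \<noteq> {rv N (V x), rv N (V y)}"
          using *[of "rv N (V x)" "rv N (V y)"] inverted_rv[OF Vlt] inverted_commute[of "V x"]
            inverted_V[OF lt ne] True by blast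
        ultimately show ?thesis using or True by (simp add: a_def b_def)
      next
        case False
        have "{p, q} \<noteq> {x, y}" using *[of x y] False by blast
        moreover have "{p, q} \<noteq> {rv N x, rv N y}"
          using *[of "rv N x" "rv N y"] inverted_rv[OF lt] inverted_commute[of x] False by blast
        ultimately show ?thesis using or False by (simp add: a_def b_def)
      qed
      moreover have P: "pair_at N C (t2, i2) = {a, b}" using pair_at_eqI[OF z w] zw by simp
      moreover have Q: "pair_at N C (t, i) = {p, q}" by (rule pair_at_eqI[OF p q])
      moreover have "pair_at N C (t, N - i) = {rv N p, rv N q}"
        using pair_at_mirror[OF i(1,2)] Q by simp
      moreover have "{rv N p, rv N q} = {a, b}" if "{p, q} = {rv N a, rv N b}"
        using arg_cong[OF that, of "image (rv N)"] by simp
      ultimately have "pair_at N C (t, i) = pair_at N C (t2, i2) \<or>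
          pair_at N C (t, N - i) = pair_at N C (t2, i2)" by metis
      moreover have "(t, i) \<in> crossings N C (2 * L)" "(t, N - i) \<in> crossings N C (2 * L)"
        "(t2, i2) \<in> crossings N C (2 * L)"
        using t t2 act active_mirror[of i t] i by (auto simp: crossings_def)
      ultimately have "(t, i) = (t2, i2) \<or> (t, N - i) = (t2, i2)"
        using inj_onD[OF reduced_inj[OF red]] by metis
      thus "t = t2 \<and> (i = i2 \<or> i = N - i2)" using i by auto
    qed
  qed
qed

end

end

section \<open>Periodic edges\<close>

lemma rotate_edge_add: "rotate_edge n j (rotate_edge n k e) = rotate_edge n (k + j) e"
proof -
  have "((x + k * n) mod (4 * n) + j * n) mod (4 * n) = (x + (k + j) * n) mod (4 * n)" for x
    by (simp only: mod_add_left_eq) (simp add: algebra_simps)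
  thus ?thesis unfolding rotate_edge_def image_image by simp
qed

lemma rotate_edge_0: "e \<subseteq> {..<4 * n} \<Longrightarrow> rotate_edge n 0 e = e"
  and rotate_edge_full: "e \<subseteq> {..<4 * n} \<Longrightarrow> rotate_edge n 4 e = e"
proof -
  assume e: "e \<subseteq> {..<4 * n}"
  have "(\<lambda>k. (k + 0 * n) mod (4 * n)) ` e = (\<lambda>k. k) ` e"
    "(\<lambda>k. (k + 4 * n) mod (4 * n)) ` e = (\<lambda>k. k) ` e"
    by (intro image_cong refl; use e in auto)+
  thus "rotate_edge n 0 e = e" "rotate_edge n 4 e = e" by (simp_all add: rotate_edge_def)
qed

lemma edges_subset: "e \<in> edges m \<Longrightarrow> e \<subseteq> {..<m}"
  by (simp add: edges_def)

lemma rotate_edge_edge: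
  assumes "n \<ge> 1"
  shows "rotate_edge n j (edge (4 * n) a b) = edge (4 * n) (a + int (j * n)) (b + int (j * n))"
proof -
  have "(nat (c mod int (4 * n)) + j * n) mod (4 * n) = nat ((c + int (j * n)) mod int (4 * n))" for c
  proof -
    have "int (nat (c mod int (4 * n))) = c mod int (4 * n)" using assms by simp
    hence "int ((nat (c mod int (4 * n)) + j * n) mod (4 * n)) = (c + int (j * n)) mod int (4 * n)"
      by (simp only: zmod_int of_nat_add mod_add_left_eq)
    thus ?thesis by linarith
  qed
  thus ?thesis by (simp add: rotate_edge_def edge_def)
qed

lemma rotate_cell:
  assumes "n \<ge> 1"
  shows "rotate_edge n j (cell_edge (4 * n) t i) = cell_edge (4 * n) (t + 2 * n * j) i"
proof -
  have "(int (t + 2 * n * j) - int i - 2) div 2 = (int t - int i - 2) div 2 + int (j * n)"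
    "(int (t + 2 * n * j) + int i + 2) div 2 = (int t + int i + 2) div 2 + int (j * n)"
    by (simp_all add: algebra_simps)
  thus ?thesis unfolding cell_edge_def rotate_edge_edge[OF assms] by (simp only:)
qed

text \<open>If \<open>(a, b)\<close> lifts the edge at \<open>(t, m - 4 - i)\<close>, then its
  glided lift \<open>(b, a + m)\<close> has endpoint sum \<open>t + m\<close> and difference
  \<open>i + 2\<close>.\<close>

lemma cell_half_turn:
  assumes "even m" "even (t + i)" "i \<le> m - 4" "m \<ge> 4"
  shows "cell_edge m (t + m) i = cell_edge m t (m - 4 - i)"
proof -
  have e: "int (m - 4 - i) = int m - 4 - int i" using assms by simp
  have ev: "even (int t + int i)" "even (int m)" using assms by auto
  have "(int (t + m) - int i - 2) div 2 = (int t + int (m - 4 - i) + 2) div 2"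
    "(int (t + m) + int i + 2) div 2 = (int t - int (m - 4 - i) - 2) div 2 + int m"
    unfolding e using ev by presburger+
  thus ?thesis unfolding cell_edge_def using edge_glide by metis
qed

lemma orbit_eq:
  assumes "e \<subseteq> {..<4 * n}" "f \<in> orbit n e"
  shows "orbit n f = orbit n e"
proof -
  obtain j where j: "j < 4" "f = rotate_edge n j e" using assms by (auto simp: orbit_def)
  have mod4: "rotate_edge n k e \<in> orbit n e" for k
  proof (induction k rule: less_induct)
    case (less k)
    show ?case
    proof (cases "k < 4")
      case True
      thus ?thesis by (auto simp: orbit_def)
    next
      case False
      have "rotate_edge n k e = rotate_edge n (k - 4) (rotate_edge n 4 e)"
        using False by (simp add: rotate_edge_add)
      thus ?thesis using less[of "k - 4"] False rotate_edge_full[OF assms(1)] by simp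
    qed
  qed
  have f: "rotate_edge n k f = rotate_edge n (j + k) e" for k using j by (simp add: rotate_edge_add)
  have "e = rotate_edge n (4 - j) f"
    using f[of "4 - j"] j rotate_edge_full[OF assms(1)] by simp
  hence e: "rotate_edge n k e = rotate_edge n (4 - j + k) f" for k by (metis rotate_edge_add)
  have sub: "f \<subseteq> {..<4 * n}"
  proof
    fix v assume "v \<in> f"
    then obtain k where "k \<in> e" "v = (k + j * n) mod (4 * n)" using j by (auto simp: rotate_edge_def)
    moreover have "4 * n > 0" using assms(1) \<open>k \<in> e\<close> by auto
    ultimately show "v \<in> {..<4 * n}" by simp
  qed
  show ?thesis
  proof
    show "orbit n f \<subseteq> orbit n e" using mod4 f by (auto simp: orbit_def[of n f])
    have mod4f: "rotate_edge n k f \<in> orbit n f" for k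
    proof (induction k rule: less_induct)
      case (less k)
      show ?case
      proof (cases "k < 4")
        case True
        thus ?thesis by (auto simp: orbit_def)
      next
        case False
        have "rotate_edge n k f = rotate_edge n (k - 4) (rotate_edge n 4 f)"
          using False by (simp add: rotate_edge_add)
        thus ?thesis using less[of "k - 4"] False rotate_edge_full[OF sub] by simp
      qed
    qed
    show "orbit n e \<subseteq> orbit n f" using mod4f e by (auto simp: orbit_def[of n e])
  qed
qed

lemma orbit_self: "e \<subseteq> {..<4 * n} \<Longrightarrow> e \<in> orbit n e"
  using rotate_edge_0[of e n] by (force simp: orbit_def)

locale periodic_polygon =
  fixes n :: nat
  assumes n: "n \<ge> 1"
begin

abbreviation "m \<equiv> 4 * n"
abbreviation "N \<equiv> 4 * n - 4"
abbreviation "cl \<equiv> cell_edge (4 * n)"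

lemma m4: "m \<ge> 4" using n by simp

definition base_cell :: "nat \<Rightarrow> nat \<Rightarrow> bool" where
  "base_cell t i \<longleftrightarrow> t < 2 * n \<and> i + 4 \<le> m \<and> even (t + i)"

text \<open>A quarter turn adds \<open>2 * n\<close> to the time and a half turn mirrors the height,
  so an orbit meets the times below \<open>2 * n\<close> in one cell and its mirror cell.\<close>

definition orbit_cells :: "nat \<Rightarrow> nat \<Rightarrow> (nat \<times> nat) set" where
  "orbit_cells t i = {(t, i), (t + 2 * n, i), (t, N - i), (t + 2 * n, N - i)}"

lemma orbit_cells_subset: "base_cell t i \<Longrightarrow> orbit_cells t i \<subseteq> cells m"
  using n by (auto simp: base_cell_def orbit_cells_def cells_def)

lemma cell_in_edges: "base_cell t i \<Longrightarrow> cl t i \<in> edges m"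
  using n by (auto simp: base_cell_def intro!: edge_length_cell)

lemma orbit_cell:
  assumes "base_cell t i"
  shows "orbit n (cl t i) = (\<lambda>(t, i). cl t i) ` orbit_cells t i"
proof -
  have ev: "even (t + i)" "even (t + 2 * n + i)" "i \<le> m - 4" using assms by (auto simp: base_cell_def)
  have four: "{j. j < 4} = {0, 1, 2, 3 :: nat}" by auto
  have "orbit n (cl t i) = (\<lambda>j. rotate_edge n j (cl t i)) ` {j. j < 4}"
    unfolding orbit_def by (rule setcompr_eq_image)
  also have "\<dots> = {rotate_edge n 0 (cl t i), rotate_edge n 1 (cl t i),
      rotate_edge n 2 (cl t i), rotate_edge n 3 (cl t i)}"
    unfolding four by simp
  also have "\<dots> = {cl t i, cl (t + 2 * n) i, cl (t + m) i, cl (t + 2 * n + m) i}"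
  proof -
    have "t + 2 * n * 0 = t" "t + 2 * n * 1 = t + 2 * n" "t + 2 * n * 2 = t + m"
      "t + 2 * n * 3 = t + 2 * n + m" by simp_all
    thus ?thesis unfolding rotate_cell[OF n] by (simp only:)
  qed
  also have "cl (t + m) i = cl t (N - i)" by (rule cell_half_turn) (use ev n in auto)
  also have "cl (t + 2 * n + m) i = cl (t + 2 * n) (N - i)" by (rule cell_half_turn) (use ev n in auto)
  finally show ?thesis by (auto simp: orbit_cells_def)
qed

lemma cl_in_orbit:
  assumes "base_cell t i" "base_cell t' i'"
  shows "cl t' i' \<in> orbit n (cl t i) \<longleftrightarrow> t' = t \<and> (i' = i \<or> i' = N - i)"
proof -
  have c: "(t', i') \<in> cells m" using assms(2) n by (auto simp: base_cell_def cells_def)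
  have inj: "inj_on (\<lambda>(t, i). cl t i) (cells m)" using bij_betw_imp_inj_on[OF cells_bij] .
  have "cl t' i' \<in> orbit n (cl t i) \<longleftrightarrow> (\<lambda>(t, i). cl t i) (t', i') \<in> (\<lambda>(t, i). cl t i) ` orbit_cells t i"
    by (simp add: orbit_cell[OF assms(1)])
  also have "\<dots> \<longleftrightarrow> (t', i') \<in> orbit_cells t i"
    by (rule inj_on_image_mem_iff[OF inj c orbit_cells_subset[OF assms(1)]])
  also have "\<dots> \<longleftrightarrow> t' = t \<and> (i' = i \<or> i' = N - i)"
    using assms by (auto simp: orbit_cells_def base_cell_def)
  finally show ?thesis .
qed

lemma card_orbit:
  assumes "base_cell t i"
  shows "card (orbit n (cl t i)) = (if 2 * i = N then 2 else 4)"
proof -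
  have inj: "inj_on (\<lambda>(t, i). cl t i) (orbit_cells t i)"
    using bij_betw_imp_inj_on[OF cells_bij] orbit_cells_subset[OF assms] by (rule inj_on_subset)
  have "card (orbit n (cl t i)) = card (orbit_cells t i)"
    unfolding orbit_cell[OF assms] by (rule card_image[OF inj])
  also have "\<dots> = (if 2 * i = N then 2 else 4)"
  proof (cases "2 * i = N")
    case True
    hence "N - i = i" by simp
    thus ?thesis unfolding orbit_cells_def using True n by (simp add: card_insert_if)
  next
    case False
    hence "N - i \<noteq> i" using assms by (auto simp: base_cell_def)
    thus ?thesis unfolding orbit_cells_def using False n by (auto simp: card_insert_if)
  qed
  finally show ?thesis .
qed

lemma orbit_mirror:
  assumes "base_cell t i"
  shows "orbit n (cl t (N - i)) = orbit n (cl t i)"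
proof (rule orbit_eq)
  show "cl t i \<subseteq> {..<4 * n}" using cell_in_edges[OF assms] by (rule edges_subset)
  have "base_cell t (N - i)" using assms by (auto simp: base_cell_def)
  thus "cl t (N - i) \<in> orbit n (cl t i)" using cl_in_orbit[OF assms] by simp
qed

lemma periodic_edge_cell:
  assumes "E \<in> periodic_edges n"
  obtains t i where "base_cell t i" "E = orbit n (cl t i)"
proof -
  obtain e where e: "e \<in> edges m" "E = orbit n e" using assms by (auto simp: periodic_edges_def)
  have "e \<in> (\<lambda>(t, i). cl t i) ` cells m" using e cells_bij[of m] by (simp add: bij_betw_def)
  then obtain t i where ti: "(t, i) \<in> cells m" "e = cl t i" by auto
  show ?thesis
  proof (cases "t < 2 * n")
    case True
    thus ?thesis using that ti e n by (auto simp: cells_def base_cell_def)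
  next
    case False
    define s where "s = t - 2 * n"
    have b: "base_cell s i" using False ti by (auto simp: cells_def base_cell_def s_def)
    have "e = rotate_edge n 1 (cl s i)" unfolding rotate_cell[OF n] using False ti by (simp add: s_def)
    hence "e \<in> orbit n (cl s i)" unfolding orbit_def by force
    hence "E = orbit n (cl s i)"
      using e orbit_eq[OF edges_subset[OF cell_in_edges[OF b]]] by simp
    thus ?thesis using that b by blast
  qed
qed

lemma orbit_edge_length:
  assumes "base_cell t i" "e \<in> orbit n (cl t i)"
  shows "e \<in> edges m" "edge_length m e = min (i + 2) (m - 2 - i)"
proof -
  have i: "i \<le> N" "even (t + i)" using assms by (auto simp: base_cell_def)
  have *: "cl s k \<in> edges m \<and> edge_length m (cl s k) = min (i + 2) (m - 2 - i)"
    if "(s, k) \<in> orbit_cells t i" for s k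
  proof -
    have sk: "even (s + k)" "k + 4 \<le> m"
      using that orbit_cells_subset[OF assms(1)] by (auto simp: cells_def)
    have "k = i \<or> k = N - i" using that by (auto simp: orbit_cells_def)
    hence "min (k + 2) (m - 2 - k) = min (i + 2) (m - 2 - i)" using i n by (auto simp: min_def)
    thus ?thesis using edge_length_cell[OF sk] by simp
  qed
  thus "e \<in> edges m" "edge_length m e = min (i + 2) (m - 2 - i)"
    using assms(2) unfolding orbit_cell[OF assms(1)] by auto
qed

lemma relevant_cell:
  assumes "base_cell t i"
  shows "relevant n (orbit n (cl t i)) \<longleftrightarrow> 0 < i \<and> i < N"
proof
  assume "relevant n (orbit n (cl t i))"
  then obtain e where e: "e \<in> edges m" "orbit n (cl t i) = orbit n e" "edge_length m e > 2"
    by (auto simp: relevant_def)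
  hence "e \<in> orbit n (cl t i)" using orbit_self[OF edges_subset] by simp
  from orbit_edge_length(2)[OF assms this] e(3) show "0 < i \<and> i < N" by auto
next
  assume "0 < i \<and> i < N"
  moreover have "cl t i \<in> orbit n (cl t i)"
    using orbit_self[OF edges_subset[OF cell_in_edges[OF assms]]] .
  ultimately show "relevant n (orbit n (cl t i))"
    using orbit_edge_length[OF assms] unfolding relevant_def by fastforce
qed

lemma periodic_edges_disjoint:
  assumes "E \<in> periodic_edges n" "F \<in> periodic_edges n" "E \<inter> F \<noteq> {}"
  shows "E = F"
proof -
  obtain e f g where ef: "e \<in> edges m" "E = orbit n e" "f \<in> edges m" "F = orbit n f" "g \<in> E" "g \<in> F"
    using assms by (auto simp: periodic_edges_def)
  thus ?thesis using orbit_eq[OF edges_subset] by metis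
qed

lemma periodic_edge_subset: "E \<in> periodic_edges n \<Longrightarrow> E \<subseteq> edges m"
  using periodic_edge_cell orbit_edge_length(1) by (metis subsetI)

lemma periodic_edge_nonempty: "E \<in> periodic_edges n \<Longrightarrow> E \<noteq> {}"
  using orbit_self[OF edges_subset] by (auto simp: periodic_edges_def)

definition periodic_set :: "nat set set \<Rightarrow> bool" where
  "periodic_set T \<longleftrightarrow> T \<subseteq> edges m \<and> rotate_edge n 1 ` T = T"

lemma periodic_two_triangulation_iff:
  "periodic_two_triangulation n T \<longleftrightarrow> two_triangulation m T \<and> periodic_set T"
  by (auto simp: periodic_two_triangulation_def periodic_set_def two_triangulation_def)

lemma periodic_set_orbit:
  assumes "periodic_set T" "e \<in> T"
  shows "orbit n e \<subseteq> T"
proof -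
  have "rotate_edge n j e \<in> T" for j
  proof (induction j)
    case 0
    have e: "e \<subseteq> {..<4 * n}" using assms edges_subset by (auto simp: periodic_set_def)
    show ?case using rotate_edge_0[OF e] assms by simp
  next
    case (Suc j)
    have "rotate_edge n (Suc j) e = rotate_edge n 1 (rotate_edge n j e)" by (simp add: rotate_edge_add)
    thus ?case using Suc assms(1) unfolding periodic_set_def by blast
  qed
  thus ?thesis by (auto simp: orbit_def)
qed

lemma periodic_set_periodic_edge:
  assumes "periodic_set T" "E \<in> periodic_edges n" "E \<inter> T \<noteq> {}"
  shows "E \<subseteq> T"
proof -
  obtain e where e: "e \<in> E" "e \<in> T" using assms by blast
  obtain f where f: "f \<in> edges m" "E = orbit n f" using assms by (auto simp: periodic_edges_def)
  have "orbit n e = E" using orbit_eq[OF edges_subset[OF f(1)]] f e by simp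
  thus ?thesis using periodic_set_orbit[OF assms(1) e(2)] by simp
qed

lemma periodic_set_Union:
  assumes "periodic_set T"
  shows "T = \<Union> (periodic_edges_of n T)"
proof
  show "T \<subseteq> \<Union> (periodic_edges_of n T)"
  proof
    fix e assume e: "e \<in> T"
    hence "e \<in> edges m" using assms by (auto simp: periodic_set_def)
    hence "orbit n e \<in> periodic_edges n" "e \<in> orbit n e"
      using orbit_self[OF edges_subset] by (auto simp: periodic_edges_def)
    thus "e \<in> \<Union> (periodic_edges_of n T)"
      using periodic_set_orbit[OF assms e] by (auto simp: periodic_edges_of_def)
  qed
qed (auto simp: periodic_edges_of_def)

lemma rotate_orbit:
  assumes "E \<in> periodic_edges n"
  shows "rotate_edge n 1 ` E = E"
proof -
  have r: "rotate_edge n j e \<in> E" if "e \<in> E" "j < 4" for e j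
  proof -
    obtain g where g: "g \<in> edges m" "E = orbit n g" using assms by (auto simp: periodic_edges_def)
    have "orbit n e = E" using orbit_eq[OF edges_subset[OF g(1)]] g that by simp
    thus ?thesis using that by (auto simp: orbit_def)
  qed
  have "e \<in> rotate_edge n 1 ` E" if "e \<in> E" for e
  proof (rule image_eqI)
    have "e \<subseteq> {..<4 * n}" using periodic_edge_subset[OF assms] that edges_subset by blast
    thus "e = rotate_edge n 1 (rotate_edge n 3 e)"
      using rotate_edge_full by (simp add: rotate_edge_add)
    show "rotate_edge n 3 e \<in> E" using r[OF that] by simp
  qed
  moreover have "rotate_edge n 1 ` E \<subseteq> E" using r[of _ 1] by auto
  ultimately show ?thesis by blast
qed

lemma periodic_set_exchange:
  assumes T: "periodic_set T" and E: "E \<in> periodic_edges n" and F: "F \<in> periodic_edges n"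
  shows "periodic_set ((T - E) \<union> F)"
proof -
  have inj: "inj_on (rotate_edge n 1) (edges m)"
  proof (rule inj_on_inverseI)
    fix e assume "e \<in> edges m"
    thus "rotate_edge n 3 (rotate_edge n 1 e) = e"
      using rotate_edge_full[OF edges_subset] by (simp add: rotate_edge_add)
  qed
  have TE: "T \<subseteq> edges m" using T by (simp add: periodic_set_def)
  have "rotate_edge n 1 ` (T - E) = rotate_edge n 1 ` T - rotate_edge n 1 ` E"
    by (rule inj_on_image_set_diff[OF inj]) (use TE periodic_edge_subset[OF E] in auto)
  hence "rotate_edge n 1 ` ((T - E) \<union> F) = (T - E) \<union> F"
    using rotate_orbit[OF E] rotate_orbit[OF F] T by (simp add: image_Un periodic_set_def)
  thus ?thesis using TE periodic_edge_subset[OF F] by (auto simp: periodic_set_def)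
qed

lemma periodic_edges_of_exchange:
  assumes T: "periodic_set T" and E: "E \<in> periodic_edges_of n T"
    and F: "F \<in> periodic_edges n" "F \<notin> periodic_edges_of n T"
  shows "periodic_edges_of n ((T - E) \<union> F) = (periodic_edges_of n T - {E}) \<union> {F}"
proof -
  have FT: "F \<inter> T = {}" using periodic_set_periodic_edge[OF T F(1)] F by (auto simp: periodic_edges_of_def)
  have "G \<subseteq> (T - E) \<union> F \<longleftrightarrow> G \<subseteq> T \<and> G \<noteq> E \<or> G = F" if G: "G \<in> periodic_edges n" for G
  proof (cases "G = F")
    case False
    hence GF: "G \<inter> F = {}" using periodic_edges_disjoint G F by blast
    have "G = E \<or> G \<inter> E = {}" using periodic_edges_disjoint G E by (auto simp: periodic_edges_of_def)
    thus ?thesis using GF False periodic_edge_nonempty[OF G] by blast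
  qed auto
  thus ?thesis using F E by (auto simp: periodic_edges_of_def)
qed

lemma contact_symmetric:
  assumes "periodic_set T"
  shows "symmetric_network N (contact m T) (2 * n)"
proof
  have *: "rotate_edge n j e \<in> T \<longleftrightarrow> e \<in> T" if "e \<in> edges m" "j < 4" for j e
  proof -
    have o: "e \<in> orbit n e" "rotate_edge n j e \<in> orbit n e" "orbit n e \<in> periodic_edges n"
      using that orbit_self[OF edges_subset] by (auto simp: orbit_def periodic_edges_def)
    thus ?thesis using periodic_set_periodic_edge[OF assms o(3)] by blast
  qed
  have e: "cl t i \<in> edges m" if "even (t + i)" "i \<le> N" for t i
    using edge_length_cell[of t i m] that n by simp
  show "contact m T (2 * n + t) i = contact m T t i" if "even (t + i)" "i \<le> N" for t i
    using *[OF e[OF that], of 1] rotate_cell[OF n, of 1 t i] by (simp add: contact_def add.commute)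
  show "contact m T t (N - i) = contact m T t i" if "even (t + i)" "i \<le> N" for t i
    using *[OF e[OF that], of 2] rotate_cell[OF n, of 2 t i] cell_half_turn[of m t i] that n
    by (simp add: contact_def)
qed auto

lemma card_crossings_contact:
  assumes "short_edges m \<subseteq> T" "T \<subseteq> edges m"
  shows "card (crossings N (contact m T) m) = card (edges m - T)"
proof -
  have inj: "inj_on (\<lambda>(t, i). cl t i) (crossings N (contact m T) m)"
    by (rule inj_on_subset[OF bij_betw_imp_inj_on[OF cells_bij]])
      (auto simp: crossings_contact[OF m4])
  have "(\<lambda>(t, i). cl t i) ` crossings N (contact m T) m = edges m - T"
  proof
    show "(\<lambda>(t, i). cl t i) ` crossings N (contact m T) m \<subseteq> edges m - T"
      unfolding crossings_contact[OF m4]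
      by (auto simp: cells_def contact_def intro: edge_length_cell)
    show "edges m - T \<subseteq> (\<lambda>(t, i). cl t i) ` crossings N (contact m T) m"
    proof
      fix e assume e: "e \<in> edges m - T"
      hence "e \<in> (\<lambda>(t, i). cl t i) ` cells m" using cells_bij[of m] by (simp add: bij_betw_def)
      then obtain t i where ti: "(t, i) \<in> cells m" "e = cl t i" by auto
      have ev: "even (t + i)" and nc: "\<not> contact m T t i"
        using ti e by (auto simp: cells_def contact_def)
      have "i \<noteq> 0"
      proof
        assume "i = 0"
        thus False using contact_boundary(1)[OF assms(1) m4, of t] ev nc by simp
      qed
      moreover have "i \<noteq> N"
      proof
        assume "i = N"
        thus False using contact_boundary(2)[OF assms(1) m4, of t] ev nc by simp
      qed
      ultimately have "0 < i" "i < N" using ti by (auto simp: cells_def)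
      hence "(t, i) \<in> crossings N (contact m T) m"
        using ti nc unfolding crossings_contact[OF m4] by simp
      thus "e \<in> (\<lambda>(t, i). cl t i) ` crossings N (contact m T) m" using ti by force
    qed
  qed
  thus ?thesis using card_image[OF inj] by simp
qed

end

section \<open>Flips\<close>

context periodic_polygon
begin

lemma periodic_edge_base:
  assumes "E \<in> periodic_edges n" "relevant n E"
  obtains t i where "base_cell t i" "0 < i" "i < N" "E = orbit n (cl t i)"
proof -
  obtain t i where c: "base_cell t i" "E = orbit n (cl t i)"
    using periodic_edge_cell[OF assms(1)] .
  thus ?thesis using that relevant_cell[OF c(1)] assms(2) by simp
qed

lemma exchange_toggled:
  assumes T: "periodic_set T" and c1: "base_cell t1 i1" "0 < i1" "i1 < N"
    and c2: "base_cell t2 i2" "0 < i2" "i2 < N"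
    and E: "orbit n (cl t1 i1) \<subseteq> T" and F: "orbit n (cl t2 i2) \<inter> T = {}"
  shows "symmetric_network.toggled N (contact m T) (2 * n)
    (contact m ((T - orbit n (cl t1 i1)) \<union> orbit n (cl t2 i2))) (t1, i1) (t2, i2)"
proof -
  let ?D = "contact m ((T - orbit n (cl t1 i1)) \<union> orbit n (cl t2 i2))"
  interpret S: symmetric_network N "contact m T" "2 * n" by (rule contact_symmetric[OF T])
  have "active N (?D t) t i = (active N (contact m T t) t i \<noteq>
      (t = t1 \<and> (i = i1 \<or> i = N - i1) \<or> t = t2 \<and> (i = i2 \<or> i = N - i2)))" if t: "t < 2 * n" for t i
  proof (cases "0 < i \<and> i < N \<and> even (t + i)")
    case True
    hence b: "base_cell t i" using t by (auto simp: base_cell_def)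
    have A1: "cl t i \<in> orbit n (cl t1 i1) \<longleftrightarrow> t = t1 \<and> (i = i1 \<or> i = N - i1)"
      by (rule cl_in_orbit[OF c1(1) b])
    have A2: "cl t i \<in> orbit n (cl t2 i2) \<longleftrightarrow> t = t2 \<and> (i = i2 \<or> i = N - i2)"
      by (rule cl_in_orbit[OF c2(1) b])
    have "?D t i \<longleftrightarrow> cl t i \<in> T \<and> cl t i \<notin> orbit n (cl t1 i1) \<or> cl t i \<in> orbit n (cl t2 i2)"
      by (auto simp: contact_def)
    moreover have "cl t i \<in> orbit n (cl t1 i1) \<Longrightarrow> cl t i \<in> T" "cl t i \<in> orbit n (cl t2 i2) \<Longrightarrow> cl t i \<notin> T"
      using E F by auto
    ultimately show ?thesis using True unfolding active_def A1[symmetric] A2[symmetric]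
      by (auto simp: contact_def)
  next
    case False
    hence "\<not> (t = t1 \<and> (i = i1 \<or> i = N - i1))" "\<not> (t = t2 \<and> (i = i2 \<or> i = N - i2))"
      using c1 c2 by (auto simp: base_cell_def)
    thus ?thesis using False by (auto simp: active_def)
  qed
  thus ?thesis unfolding S.toggled_def by simp
qed

lemma periodic_network:
  assumes "periodic_two_triangulation n T"
  shows "periodic_set T" "short_edges m \<subseteq> T" "T \<subseteq> edges m"
    "reversing N (strand N (contact m T) (2 * (2 * n)))" "reduced N (contact m T) (2 * (2 * n))"
    "card (edges m - T) = N choose 2"
proof -
  have tt: "two_triangulation m T" and p: "periodic_set T"
    using assms periodic_two_triangulation_iff by auto
  show "periodic_set T" by (rule p)
  show s: "short_edges m \<subseteq> T" by (rule two_triangulation_short[OF tt])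
  show TE: "T \<subseteq> edges m" using p by (simp add: periodic_set_def)
  have e: "2 * (2 * n) = m" by simp
  note net = two_triangulation_network[OF tt m4]
  show "reversing N (strand N (contact m T) (2 * (2 * n)))" "reduced N (contact m T) (2 * (2 * n))"
    unfolding e by (rule net)+
  show "card (edges m - T) = N choose 2"
    using card_crossings[OF net] card_crossings_contact[OF s TE] by simp
qed

lemma periodic_exchange_eq:
  assumes T: "periodic_set T" and T': "periodic_set T'" and E: "E \<in> periodic_edges_of n T"
    and F: "F \<in> periodic_edges n" "F \<notin> periodic_edges_of n T"
    and eq: "periodic_edges_of n T' = (periodic_edges_of n T - {E}) \<union> {F}"
  shows "T' = (T - E) \<union> F"
proof -
  have E': "E \<in> periodic_edges n" using E by (simp add: periodic_edges_of_def)
  have "T' = \<Union> (periodic_edges_of n T')" by (rule periodic_set_Union[OF T'])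
  also have "\<dots> = \<Union> (periodic_edges_of n ((T - E) \<union> F))"
    using eq periodic_edges_of_exchange[OF T E F] by simp
  also have "\<dots> = (T - E) \<union> F"
    by (rule periodic_set_Union[OF periodic_set_exchange[OF T E' F(1)], symmetric])
  finally show ?thesis .
qed

lemma card_exchange:
  assumes "E \<subseteq> T" "F \<inter> T = {}" "F \<subseteq> edges m" "T \<subseteq> edges m"
  shows "card ((T - E) \<union> F) + card E = card T + card F"
proof -
  have fin: "finite T" "finite E" "finite F"
    using assms finite_edges finite_subset by metis+
  have "card ((T - E) \<union> F) = card (T - E) + card F"
    using assms fin by (intro card_Un_disjoint) auto
  moreover have "card (T - E) + card E = card T"
    using assms fin card_Diff_subset card_mono by (metis le_add_diff_inverse2)
  ultimately show ?thesis by simp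
qed

text \<open>The exchanged network still reverses the wires, and \<open>E\<close> and
  \<open>F\<close> have equally many edges, so the count of missing edges stays
  \<open>N choose 2\<close> and \<open>two_triangulationI\<close> applies.\<close>

theorem unique_exchange:
  assumes T: "periodic_two_triangulation n T" and E: "E \<in> periodic_edges_of n T" and rel: "relevant n E"
  shows "\<exists>!T'. periodic_two_triangulation n T' \<and> (\<exists>F. F \<in> periodic_edges n \<and>
    F \<notin> periodic_edges_of n T \<and> periodic_edges_of n T' = (periodic_edges_of n T - {E}) \<union> {F})"
proof -
  note p = periodic_network[OF T]
  have EE: "E \<in> periodic_edges n" "E \<subseteq> T" using E by (auto simp: periodic_edges_of_def)
  obtain t1 i1 where c1: "base_cell t1 i1" "0 < i1" "i1 < N" and Eo: "E = orbit n (cl t1 i1)"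
    using periodic_edge_base[OF EE(1) rel] .
  interpret S: symmetric_network N "contact m T" "2 * n" by (rule contact_symmetric[OF p(1)])
  have t1: "t1 < 2 * n" "even (t1 + i1)" using c1 by (auto simp: base_cell_def)
  have "cl t1 i1 \<in> T" using EE Eo orbit_self[OF edges_subset[OF cell_in_edges[OF c1(1)]]] by auto
  hence nact: "\<not> active N (contact m T t1) t1 i1" by (simp add: active_def contact_def)
  obtain t2 i2 where t2: "t2 < 2 * n" and act: "active N (contact m T t2) t2 i2"
    and mid: "2 * i2 = N \<longleftrightarrow> 2 * i1 = N"
    and ex: "\<forall>D. S.toggled D (t1, i1) (t2, i2) \<longrightarrow>
      (\<forall>u. strand N D (2 * n) (strand N D (2 * n) u) = rv N u)"
    and un: "\<forall>D t i. S.toggled D (t1, i1) (t, i) \<and>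
      (\<forall>u. strand N D (2 * n) (strand N D (2 * n) u) = rv N u) \<and>
      t < 2 * n \<and> active N (contact m T t) t i \<and> (2 * i = N \<longleftrightarrow> 2 * i1 = N) \<longrightarrow>
      t = t2 \<and> (i = i2 \<or> i = N - i2)"
    using S.network_exchange[OF p(4,5) t1(1) c1(2,3) t1(2) nact] .
  have c2: "base_cell t2 i2" "0 < i2" "i2 < N" using t2 act by (auto simp: base_cell_def active_def)
  define F where "F = orbit n (cl t2 i2)"
  have F: "F \<in> periodic_edges n" using cell_in_edges[OF c2(1)] by (auto simp: F_def periodic_edges_def)
  have "cl t2 i2 \<notin> T" using act by (simp add: active_def contact_def)
  hence "\<not> F \<subseteq> T" using orbit_self[OF edges_subset[OF cell_in_edges[OF c2(1)]]] by (auto simp: F_def)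
  hence FT: "F \<inter> T = {}" "F \<notin> periodic_edges_of n T"
    using periodic_set_periodic_edge[OF p(1) F] by (auto simp: periodic_edges_of_def)
  define T' where "T' = (T - E) \<union> F"
  have pT': "periodic_set T'" unfolding T'_def by (rule periodic_set_exchange[OF p(1) EE(1) F])
  have T'E: "T' \<subseteq> edges m" using pT' by (simp add: periodic_set_def)
  have sh: "short_edges m \<subseteq> T'"
  proof
    fix e assume e: "e \<in> short_edges m"
    hence "e \<notin> E" using orbit_edge_length(2)[OF c1(1), of e] c1 by (auto simp: Eo short_edges_def)
    thus "e \<in> T'" using e p(2) by (auto simp: T'_def)
  qed
  interpret S': symmetric_network N "contact m T'" "2 * n" by (rule contact_symmetric[OF pT'])
  have "S.toggled (contact m T') (t1, i1) (t2, i2)"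
    unfolding T'_def F_def Eo
    by (rule exchange_toggled[OF p(1) c1 c2]) (use EE FT in \<open>simp_all add: Eo F_def\<close>)
  hence "\<forall>u. strand N (contact m T') (2 * n) (strand N (contact m T') (2 * n) u) = rv N u"
    using ex by blast
  hence rev: "reversing N (strand N (contact m T') (2 * (2 * n)))"
    using S'.reversing_iff_square by blast
  have "card E = card F" unfolding Eo F_def card_orbit[OF c1(1)] card_orbit[OF c2(1)] using mid by simp
  hence "card T' = card T"
    using card_exchange[OF EE(2) FT(1) periodic_edge_subset[OF F] p(3)] by (simp add: T'_def)
  hence "card (edges m - T') = card (edges m - T)"
    using p(3) T'E finite_edges by (metis card_Diff_subset finite_subset)
  hence "card (crossings N (contact m T') m) = N choose 2"
    using card_crossings_contact[OF sh T'E] p(6) by simp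
  moreover have "2 * (2 * n) = m" by simp
  ultimately have "two_triangulation m T'"
    using two_triangulationI[OF T'E m4 sh] rev by simp
  hence ptt: "periodic_two_triangulation n T'" using pT' periodic_two_triangulation_iff by blast
  have uniq: "T'' = T'"
    if T'': "periodic_two_triangulation n T''" and G: "G \<in> periodic_edges n" "G \<notin> periodic_edges_of n T"
      and eq: "periodic_edges_of n T'' = (periodic_edges_of n T - {E}) \<union> {G}" for T'' G
  proof -
    note p'' = periodic_network[OF T'']
    have T''eq: "T'' = (T - E) \<union> G" by (rule periodic_exchange_eq[OF p(1) p''(1) E G eq])
    have GT: "G \<inter> T = {}" using periodic_set_periodic_edge[OF p(1) G(1)] G by (auto simp: periodic_edges_of_def)
    obtain t i where c: "base_cell t i" and Go: "G = orbit n (cl t i)"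
      using periodic_edge_cell[OF G(1)] .
    have self: "cl t i \<in> G" using orbit_self[OF edges_subset[OF cell_in_edges[OF c]]] Go by simp
    \<comment> \<open>\<open>T\<close> contains all short edges, so a new periodic edge is always
      relevant.\<close>
    have "cl t i \<notin> short_edges m" using self GT p(2) by auto
    hence "edge_length m (cl t i) \<noteq> 2" using cell_in_edges[OF c] by (simp add: short_edges_def)
    hence len: "min (i + 2) (m - 2 - i) \<noteq> 2"
      using orbit_edge_length(2)[OF c, of "cl t i"] self Go by simp
    have "2 \<le> i + 2" "2 \<le> m - 2 - i" using c by (auto simp: base_cell_def)
    hence "i + 2 \<noteq> 2" "m - 2 - i \<noteq> 2" using len by (metis min.absorb1, metis min.absorb2)
    moreover have "i + 4 \<le> m" using c by (simp add: base_cell_def)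
    ultimately have i: "0 < i" "i < N" by linarith+
    interpret S'': symmetric_network N "contact m T''" "2 * n" by (rule contact_symmetric[OF p''(1)])
    have tog: "S.toggled (contact m T'') (t1, i1) (t, i)"
      unfolding T''eq Go Eo
      by (rule exchange_toggled[OF p(1) c1 c i]) (use EE GT in \<open>simp_all add: Eo Go\<close>)
    have sq: "\<forall>u. strand N (contact m T'') (2 * n) (strand N (contact m T'') (2 * n) u) = rv N u"
      using p''(4) S''.reversing_iff_square by blast
    \<comment> \<open>All 2-triangulations of the polygon miss equally many edges. Hence
      \<open>G\<close> is as large as \<open>E\<close>, and this decides whether it consists of
      diameters.\<close>
    have "card (edges m - T'') = card (edges m - T)" using p(6) p''(6) by simp
    hence "card (edges m) - card T'' = card (edges m) - card T"
      using p(3) p''(3) finite_edges by (metis card_Diff_subset finite_subset)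
    moreover have "card T'' \<le> card (edges m)" "card T \<le> card (edges m)"
      using p(3) p''(3) finite_edges card_mono by metis+
    ultimately have "card T'' = card T" by linarith
    hence "card E = card G"
      using card_exchange[OF EE(2) GT periodic_edge_subset[OF G(1)] p(3)] by (simp add: T''eq)
    hence mid': "2 * i = N \<longleftrightarrow> 2 * i1 = N"
      unfolding Eo Go card_orbit[OF c1(1)] card_orbit[OF c] by (auto split: if_splits)
    have "active N (contact m T t) t i"
      using i c self GT by (auto simp: active_def contact_def base_cell_def)
    moreover have "t < 2 * n" using c by (simp add: base_cell_def)
    ultimately have "t = t2 \<and> (i = i2 \<or> i = N - i2)"
      using un[rule_format, of "contact m T''" t i] tog sq mid' by blast
    hence "G = F" using orbit_mirror[OF c2(1)] Go F_def by auto
    thus ?thesis using T''eq T'_def by simp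
  qed
  show ?thesis
  proof (rule ex1I[of _ T'])
    show "periodic_two_triangulation n T' \<and> (\<exists>F. F \<in> periodic_edges n \<and>
        F \<notin> periodic_edges_of n T \<and> periodic_edges_of n T' = (periodic_edges_of n T - {E}) \<union> {F})"
      using ptt F FT(2) periodic_edges_of_exchange[OF p(1) E F FT(2)] unfolding T'_def by blast
  qed (use uniq in blast)
qed

section \<open>Counting the relevant periodic edges\<close>

lemma card_parity_cells:
  "card {(t, i). t < 2 * k \<and> 0 < i \<and> i < M \<and> even (t + i)} = k * (M - 1)"
proof -
  let ?A = "{..<k} \<times> {0<..<M}" and ?f = "\<lambda>(s, i). (2 * s + i mod 2, i :: nat)"
  have "bij_betw ?f ?A {(t, i). t < 2 * k \<and> 0 < i \<and> i < M \<and> even (t + i)}"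
  proof (rule bij_betw_imageI)
    show "inj_on ?f ?A" by (auto simp: inj_on_def)
    show "?f ` ?A = {(t, i). t < 2 * k \<and> 0 < i \<and> i < M \<and> even (t + i)}"
    proof
      show "?f ` ?A \<subseteq> {(t, i). t < 2 * k \<and> 0 < i \<and> i < M \<and> even (t + i)}"
      proof
        fix x assume "x \<in> ?f ` ?A"
        then obtain s i where x: "x = (2 * s + i mod 2, i)" "s < k" "0 < i" "i < M" by auto
        have "2 * s + i mod 2 < 2 * k" using x(2) by presburger
        moreover have "even (2 * s + i mod 2 + i)" by presburger
        ultimately show "x \<in> {(t, i). t < 2 * k \<and> 0 < i \<and> i < M \<and> even (t + i)}" using x by simp
      qed
      show "{(t, i). t < 2 * k \<and> 0 < i \<and> i < M \<and> even (t + i)} \<subseteq> ?f ` ?A"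
      proof clarify
        fix t i assume ti: "t < 2 * k" "0 < i" "i < M" "even (t + i)"
        have "(t, i) = ?f (t div 2, i)" using ti(4) by simp presburger
        moreover have "(t div 2, i) \<in> ?A" using ti by auto
        ultimately show "(t, i) \<in> ?f ` ?A" by blast
      qed
    qed
  qed
  hence "card ?A = card {(t, i). t < 2 * k \<and> 0 < i \<and> i < M \<and> even (t + i)}"
    by (rule bij_betw_same_card)
  hence "card {(t, i). t < 2 * k \<and> 0 < i \<and> i < M \<and> even (t + i)} = card ?A" by (rule sym)
  thus ?thesis by (simp add: card_cartesian_product)
qed

lemma card_relevant_edges: "card (edges m - short_edges m) = 2 * n * (N - 1)"
proof -
  have "card (edges m - short_edges m) = card (crossings N (contact m (short_edges m)) m)"
    using card_crossings_contact[of "short_edges m"] by (auto simp: short_edges_def)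
  also have "crossings N (contact m (short_edges m)) m =
      {(t, i). t < 2 * (2 * n) \<and> 0 < i \<and> i < N \<and> even (t + i)}"
  proof -
    have "\<not> contact m (short_edges m) t i" if "(t, i) \<in> cells m" "0 < i" "i < N" for t i
      using edge_length_cell(2)[of t i m] that by (auto simp: contact_def short_edges_def cells_def)
    thus ?thesis unfolding crossings_contact[OF m4] by (auto simp: cells_def)
  qed
  finally show ?thesis by (simp only: card_parity_cells)
qed

text \<open>Two distinct orbits of diameters would contain three mutually crossing diameters.\<close>

lemma diameter_orbit_unique:
  assumes n3: "no_3_crossing m T" and c: "base_cell t i" "base_cell t' i" "2 * i = N"
    and T: "orbit n (cl t i) \<subseteq> T" "orbit n (cl t' i) \<subseteq> T"
  shows "t = t'"
proof -
  have *: False if c: "base_cell t i" "base_cell t' i" and T: "orbit n (cl t i) \<subseteq> T"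
    "orbit n (cl t' i) \<subseteq> T" and lt: "t < t'" for t t'
  proof -
    obtain a b where ab: "cl t i = edge m a b" "a + b = int t" "b - a = int i + 2"
      using cell_endpoints[of t i m] c by (auto simp: base_cell_def)
    obtain a' b' where ab': "cl t' i = edge m a' b'" "a' + b' = int t'" "b' - a' = int i + 2"
      using cell_endpoints[of t' i m] c by (auto simp: base_cell_def)
    have r: "rotate_edge n 1 (cl t i) = edge m (a + int n) (b + int n)"
      unfolding ab(1) rotate_edge_edge[OF n] by simp
    have i: "int i + 2 = 2 * int n" using \<open>2 * i = N\<close> n by linarith
    have "t' < 2 * n" using c by (simp add: base_cell_def)
    hence o: "a < a'" "a' < a + int n" "b = a + 2 * int n" "b' = a' + 2 * int n"
      using ab ab' lt i by linarith+
    have m: "int m = 4 * int n" by simp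
    have x: "cross m (edge m a b) (edge m a' b')" "edge m a b \<noteq> edge m a' b'"
      "cross m (edge m a b) (edge m (a + int n) (b + int n))" "edge m a b \<noteq> edge m (a + int n) (b + int n)"
      "cross m (edge m a' b') (edge m (a + int n) (b + int n))" "edge m a' b' \<noteq> edge m (a + int n) (b + int n)"
      by (rule edge_cross; use o m n in linarith)+
    have in1: "edge m a b \<in> T" "edge m a' b' \<in> T" unfolding ab(1)[symmetric] ab'(1)[symmetric]
      using T orbit_self[OF edges_subset[OF cell_in_edges[OF c(1)]]]
        orbit_self[OF edges_subset[OF cell_in_edges[OF c(2)]]] by auto
    have "rotate_edge n 1 (cl t i) \<in> orbit n (cl t i)"
      unfolding orbit_def by (rule CollectI, rule exI[of _ 1]) simp
    hence in2: "edge m (a + int n) (b + int n) \<in> T" using T r by auto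
    have "\<exists>e\<in>T. \<exists>f\<in>T. \<exists>g\<in>T. e \<noteq> f \<and> e \<noteq> g \<and> f \<noteq> g \<and> cross m e f \<and> cross m e g \<and> cross m f g"
      by (rule bexI[OF bexI[OF bexI[OF _ in2] in1(2)] in1(1)]) (intro conjI x)
    thus False using n3 unfolding no_3_crossing_def by (rule notE[rotated])
  qed
  show ?thesis using *[of t t'] *[of t' t] c T by (metis linorder_neqE_nat)
qed

text \<open>\<open>T\<close> has \<open>2 * n * (N - 1) - (N choose 2)\<close> relevant edges. They
  fall into orbits of size four and at most one orbit of diameters, of size two; divisibility
  settles whether the latter occurs.\<close>

lemma card_relevant_periodic_edges:
  assumes T: "periodic_two_triangulation n T"
  shows "card {E \<in> periodic_edges_of n T. relevant n E} = 2 * (n - 1)"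
proof (cases "n = 1")
  case True
  have "\<not> relevant n E" if "E \<in> periodic_edges n" for E
    using periodic_edge_base[OF that] True by auto
  hence "{E \<in> periodic_edges_of n T. relevant n E} = {}" by (auto simp: periodic_edges_of_def)
  hence "card {E \<in> periodic_edges_of n T. relevant n E} = 0" by (simp only: card.empty)
  thus ?thesis using True by simp
next
  case False
  hence n2: "n \<ge> 2" using n by simp
  note p = periodic_network[OF T]
  let ?R = "{E \<in> periodic_edges_of n T. relevant n E}"
  define A where "A = {E \<in> ?R. card E = 2}"
  have R: "E \<in> periodic_edges n" "E \<subseteq> T" "relevant n E" if "E \<in> ?R" for E
    using that by (auto simp: periodic_edges_of_def)
  have finR: "finite ?R"
  proof (rule finite_subset)
    show "?R \<subseteq> Pow (edges m)" using R(2) p(3) by blast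
    show "finite (Pow (edges m))" using finite_edges by simp
  qed
  have U: "\<Union> ?R = T - short_edges m"
  proof
    show "\<Union> ?R \<subseteq> T - short_edges m"
    proof
      fix e assume "e \<in> \<Union> ?R"
      then obtain E where E: "E \<in> ?R" "e \<in> E" by blast
      obtain t i where c: "base_cell t i" "0 < i" "i < N" "E = orbit n (cl t i)"
        using periodic_edge_base[OF R(1,3)[OF E(1)]] .
      have "edge_length m e = min (i + 2) (m - 2 - i)"
        using orbit_edge_length(2)[OF c(1)] E(2) c(4) by simp
      hence "edge_length m e \<noteq> 2" using c(2,3) by simp
      moreover have "e \<in> T" using R(2)[OF E(1)] E(2) by blast
      ultimately show "e \<in> T - short_edges m" by (simp add: short_edges_def)
    qed
    show "T - short_edges m \<subseteq> \<Union> ?R"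
    proof
      fix e assume e: "e \<in> T - short_edges m"
      hence "e \<in> edges m" using p(3) by auto
      moreover from this have "edge_length m e > 2" using e by (auto simp: short_edges_def edges_def)
      ultimately have "relevant n (orbit n e)" "orbit n e \<in> periodic_edges n" "e \<in> orbit n e"
        using orbit_self[OF edges_subset] by (auto simp: relevant_def periodic_edges_def)
      thus "e \<in> \<Union> ?R" using periodic_set_orbit[OF p(1)] e by (auto simp: periodic_edges_of_def)
    qed
  qed
  have c24: "card E = 2 \<or> card E = 4" if ER: "E \<in> ?R" for E
  proof -
    obtain t i where "base_cell t i" "E = orbit n (cl t i)"
      using periodic_edge_base[OF R(1,3)[OF ER]] .
    thus ?thesis using card_orbit by simp
  qed
  have "card (\<Union> ?R) = sum card ?R"
  proof (rule card_Union_disjoint)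
    show "pairwise disjnt ?R"
    proof (rule pairwiseI)
      fix E F assume EF: "E \<in> ?R" "F \<in> ?R" "E \<noteq> F"
      thus "disjnt E F"
        using periodic_edges_disjoint[OF R(1)[OF EF(1)] R(1)[OF EF(2)]] unfolding disjnt_def by argo
    qed
    show "finite E" if "E \<in> ?R" for E using c24[OF that] card_ge_0_finite[of E] by linarith
  qed
  also have "sum card ?R = sum card A + sum card (?R - A)"
    using finR by (subst sum.subset_diff[of A]) (auto simp: A_def)
  also have "sum card A = 2 * card A"
    using sum_constant[of "2 :: nat" A] by (simp add: A_def)
  also have "sum card (?R - A) = sum (\<lambda>_. 4) (?R - A)"
    by (rule sum.cong[OF refl]) (use c24 in \<open>auto simp: A_def\<close>)
  also have "\<dots> = 4 * card (?R - A)" by simp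
  finally have 1: "card (T - short_edges m) = 2 * card A + 4 * card (?R - A)" unfolding U .
  have A: "A \<subseteq> ?R" by (auto simp: A_def)
  have 2: "card (?R - A) + card A = card ?R"
    using A finR by (metis card_Diff_subset card_mono finite_subset le_add_diff_inverse2)
  have "edges m - short_edges m = (T - short_edges m) \<union> (edges m - T)" using p(2,3) by auto
  moreover have "card ((T - short_edges m) \<union> (edges m - T)) = card (T - short_edges m) + card (edges m - T)"
    by (rule card_Un_disjoint) (use finite_edges[of m] p(3) finite_subset in auto)
  ultimately have 3: "card (T - short_edges m) + (N choose 2) = 2 * n * (N - 1)"
    using card_relevant_edges p(6) by simp
  obtain k where k: "n = k + 2" using n2 by (metis add.commute le_Suc_ex)
  have "N choose 2 = (2 * k + 2) * (4 * k + 3)"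
  proof -
    have "N = 4 * k + 4" "N - 1 = 4 * k + 3" using k by simp_all
    hence "N * (N - 1) = (4 * k + 4) * (4 * k + 3)" by (simp only:)
    also have "\<dots> = 2 * ((2 * k + 2) * (4 * k + 3))" by (simp add: algebra_simps)
    finally show ?thesis unfolding choose_two by simp
  qed
  moreover have "N - 1 = 4 * k + 3" using k by simp
  ultimately have "card (T - short_edges m) + (2 * k + 2) * (4 * k + 3) = (2 * k + 4) * (4 * k + 3)"
    using 3 k by (simp add: algebra_simps)
  hence 4: "card (T - short_edges m) = 8 * k + 6" by (simp add: algebra_simps)
  have "card A \<le> 1"
  proof -
    have "E = E'" if "E \<in> A" "E' \<in> A" for E E'
    proof -
      have E: "E \<in> ?R" "card E = 2" "E' \<in> ?R" "card E' = 2" using that by (auto simp: A_def)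
      obtain t i where c: "base_cell t i" "E = orbit n (cl t i)"
        using periodic_edge_base[OF R(1,3)[OF E(1)]] .
      obtain t' i' where c': "base_cell t' i'" "E' = orbit n (cl t' i')"
        using periodic_edge_base[OF R(1,3)[OF E(3)]] .
      have i: "2 * i = N" "2 * i' = N"
        using E(2,4) card_orbit[OF c(1)] card_orbit[OF c'(1)] c(2) c'(2) by (auto split: if_splits)
      hence [simp]: "i' = i" by simp
      have "no_3_crossing m T"
        using T by (simp add: periodic_two_triangulation_def two_triangulation_def)
      hence "t = t'" by (rule diameter_orbit_unique[of T t i t']) (use c c' i R(2)[OF E(1)] R(2)[OF E(3)] in auto)
      thus ?thesis using c c' by simp
    qed
    moreover have "finite A" using A finR by (rule finite_subset)
    ultimately have "card A \<le> Suc 0" using card_le_Suc0_iff_eq by blast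
    thus ?thesis by simp
  qed
  \<comment> \<open>Half of \<open>8 * k + 6\<close> is odd, so an orbit of diameters must be
    present.\<close>
  moreover have "card A + 2 * card (?R - A) = 4 * k + 3" using 1 4 by simp
  ultimately have "card A = 1" "card (?R - A) = 2 * k + 1" by presburger+
  thus ?thesis using 2 k by simp
qed

lemma flip_iff:
  "flip n T T' \<longleftrightarrow> periodic_two_triangulation n T \<and> (\<exists>E. E \<in> periodic_edges_of n T \<and> relevant n E \<and>
    periodic_two_triangulation n T' \<and> (\<exists>F. F \<in> periodic_edges n \<and> F \<notin> periodic_edges_of n T \<and>
      periodic_edges_of n T' = (periodic_edges_of n T - {E}) \<union> {F}))"
  unfolding flip_def by blast

text \<open>The only point to check is that the new orbit \<open>F\<close> is relevant; it is, since
  the short edges already belong to \<open>T\<close>.\<close>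

lemma flip_sym:
  assumes "flip n T T'"
  shows "flip n T' T"
proof -
  obtain E F where T: "periodic_two_triangulation n T" "periodic_two_triangulation n T'"
    and E: "E \<in> periodic_edges_of n T" "relevant n E"
    and F: "F \<in> periodic_edges n" "F \<notin> periodic_edges_of n T"
    and eq: "periodic_edges_of n T' = (periodic_edges_of n T - {E}) \<union> {F}"
    using assms unfolding flip_def by blast
  note p = periodic_network[OF T(1)]
  have FT: "F \<inter> T = {}"
    using periodic_set_periodic_edge[OF p(1) F(1)] F by (auto simp: periodic_edges_of_def)
  obtain e where e: "e \<in> edges m" "F = orbit n e" using F by (auto simp: periodic_edges_def)
  have "e \<in> F" using e orbit_self[OF edges_subset] by simp
  hence "e \<notin> short_edges m" using FT p(2) by auto
  hence "edge_length m e > 2" using e by (auto simp: short_edges_def edges_def)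
  hence "relevant n F" using e by (auto simp: relevant_def)
  moreover have "F \<in> periodic_edges_of n T'" "E \<notin> periodic_edges_of n T'" "E \<in> periodic_edges n"
    using eq E F by (auto simp: periodic_edges_of_def)
  moreover have "periodic_edges_of n T = (periodic_edges_of n T' - {F}) \<union> {E}"
    using eq E F by auto
  ultimately show ?thesis unfolding flip_def using T by blast
qed

text \<open>Each relevant orbit has one flip, and the flip determines the orbit as the only one that
  \<open>T\<close> loses.\<close>

theorem card_flips:
  assumes T: "periodic_two_triangulation n T"
  shows "finite {T'. flip n T T'}" "card {T'. flip n T T'} = 2 * (n - 1)"
proof -
  let ?R = "{E \<in> periodic_edges_of n T. relevant n E}"
  define P where "P E T' \<longleftrightarrow> periodic_two_triangulation n T' \<and> (\<exists>F. F \<in> periodic_edges n \<and>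
    F \<notin> periodic_edges_of n T \<and> periodic_edges_of n T' = (periodic_edges_of n T - {E}) \<union> {F})" for E T'
  define g where "g E = (THE T'. P E T')" for E
  have P1: "\<exists>!T'. P E T'" if "E \<in> ?R" for E
  proof -
    have "E \<in> periodic_edges_of n T" "relevant n E" using that by auto
    thus ?thesis unfolding P_def by (rule unique_exchange[OF T])
  qed
  have g: "P E (g E)" if "E \<in> ?R" for E unfolding g_def by (rule theI'[OF P1[OF that]])
  have gu: "T' = g E" if "E \<in> ?R" "P E T'" for E T'
    unfolding g_def by (rule the1_equality[OF P1[OF that(1)] that(2), symmetric])
  have "flip n T T' \<longleftrightarrow> (\<exists>E\<in>?R. P E T')" for T' 
    unfolding flip_iff P_def by (simp only: T simp_thms Bex_def mem_Collect_eq conj_assoc)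
  hence fl: "flip n T T' \<longleftrightarrow> (\<exists>E\<in>?R. T' = g E)" for T' using g gu by metis
  have im: "{T'. flip n T T'} = g ` ?R" unfolding fl by (auto simp: image_def)
  have d: "periodic_edges_of n T - periodic_edges_of n (g E) = {E}" if "E \<in> ?R" for E
    using g[OF that] that unfolding P_def by auto
  have inj: "inj_on g ?R"
  proof (rule inj_onI)
    fix E E' assume "E \<in> ?R" "E' \<in> ?R" "g E = g E'"
    hence "{E} = {E'}" using d[of E] d[of E'] by (simp only:)
    thus "E = E'" by simp
  qed
  show "card {T'. flip n T T'} = 2 * (n - 1)"
    unfolding im card_image[OF inj] by (rule card_relevant_periodic_edges[OF T])
  have "T' \<in> Pow (edges m)" if "flip n T T'" for T'
    using that by (auto simp: flip_def periodic_two_triangulation_def two_triangulation_def)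
  hence "{T'. flip n T T'} \<subseteq> Pow (edges m)" by blast
  thus "finite {T'. flip n T T'}" by (rule finite_subset) (simp add: finite_edges)
qed

end

theorem theorem6p3:
  fixes n :: nat
  assumes "n \<ge> 1"
  shows "regular_of_degree (flip_graph n) (2 * (n - 1))"
proof -
  interpret periodic_polygon n using assms by unfold_locales
  have "finite {e \<in> snd (flip_graph n). T \<in> e} \<and> card {e \<in> snd (flip_graph n). T \<in> e} = 2 * (n - 1)"
    if T: "periodic_two_triangulation n T" for T
  proof -
    \<comment> \<open>Edges of the graph are unordered; by \<open>flip_sym\<close> each one at
      \<open>T\<close> may be read as a flip that starts from \<open>T\<close>.\<close>
    have "{e \<in> snd (flip_graph n). T \<in> e} = (\<lambda>T'. {T, T'}) ` {T'. flip n T T'}"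
      using flip_sym by (auto simp: flip_graph_def)
    moreover have "inj_on (\<lambda>T'. {T, T'}) {T'. flip n T T'}"
      by (auto simp: inj_on_def doubleton_eq_iff)
    ultimately show ?thesis using card_flips[OF T] by (simp add: card_image)
  qed
  thus ?thesis by (auto simp: regular_of_degree_def flip_graph_def)
qed

end
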